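(* Let $D$ be a holomorphic homogeneous regular domain in $\mathbb{C}^n$. Then the Kobayashi metric and the Bergman metric on $D$ are complete.
   Context: $B^n$ is the open unit ball in $\mathbb{C}^n$ and $B^n(0,r)$ is the open ball with center $0$ and radius $r$. For a bounded domain $D\subset\mathbb{C}^n$ and $p\in D$, the squeezing function is $s_D(p)=\sup_f\,\sup\{r : B^n(0,r)\subset f(D)\}$, where the outer supremum is over all (open) injective holomorphic maps $f: D\rightarrow B^n$ with $f(p)=0$. A holomorphic homogeneous regular domain is a bounded domain $D\subset\mathbb{C}^n$ whose squeezing function has a positive lower bound: there is $c>0$ with $s_D(p)\ge c$ for all $p\in D$. Completeness means that $D$ is a complete metric space for the Kobayashi distance, respectively for the distance induced by the Bergman metric. *)

theory Defs
  imports "HOL-Complex_Analysis.Complex_Analysis"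
begin

definition holomorphic_fun_on :: "(complex ^ 'n \<Rightarrow> complex) \<Rightarrow> (complex ^ 'n) set \<Rightarrow> bool" where
  "holomorphic_fun_on f S \<longleftrightarrow>
     (\<forall>z\<in>S. \<exists>f'. (f has_derivative f') (at z within S) \<and> (\<forall>c v. f' (c *s v) = c * f' v))"

definition holomorphic_map_on :: "(complex ^ 'n \<Rightarrow> complex ^ 'm) \<Rightarrow> (complex ^ 'n) set \<Rightarrow> bool" where
  "holomorphic_map_on f S \<longleftrightarrow> (\<forall>j. holomorphic_fun_on (\<lambda>z. f z $ j) S)"

definition Cn_domain :: "(complex ^ 'n) set \<Rightarrow> bool" where
  "Cn_domain D \<longleftrightarrow> open D \<and> connected D \<and> D \<noteq> {}"


subsection \<open>Squeezing function\<close>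

text \<open>By invariance of domain, the openness condition follows from the other ones when \<open>D\<close> is open.\<close>

definition squeezing_maps :: "(complex ^ 'n) set \<Rightarrow> complex ^ 'n \<Rightarrow> (complex ^ 'n \<Rightarrow> complex ^ 'n) set" where
  "squeezing_maps D p =
     {f. holomorphic_map_on f D \<and> inj_on f D \<and> f ` D \<subseteq> ball 0 1 \<and> f p = 0 \<and>
         (\<forall>U. open U \<and> U \<subseteq> D \<longrightarrow> open (f ` U))}"

definition squeezing :: "(complex ^ 'n) set \<Rightarrow> complex ^ 'n \<Rightarrow> real" where
  "squeezing D p = (SUP f \<in> squeezing_maps D p. Sup {r. ball 0 r \<subseteq> f ` D})"

definition holomorphic_homogeneous_regular :: "(complex ^ 'n) set \<Rightarrow> bool" where
  "holomorphic_homogeneous_regular D \<longleftrightarrow>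
     Cn_domain D \<and> bounded D \<and> (\<exists>c>0. \<forall>p\<in>D. c \<le> squeezing D p)"


subsection \<open>Kobayashi distance\<close>

definition poincare_dist :: "complex \<Rightarrow> complex \<Rightarrow> real" where
  "poincare_dist a b = artanh (cmod ((a - b) / (1 - cnj a * b)))"

definition holomorphic_disc :: "(complex \<Rightarrow> complex ^ 'n) \<Rightarrow> (complex ^ 'n) set \<Rightarrow> bool" where
  "holomorphic_disc f D \<longleftrightarrow> (\<forall>j. (\<lambda>\<zeta>. f \<zeta> $ j) holomorphic_on ball 0 1) \<and> f ` ball 0 1 \<subseteq> D"

text \<open>
  Infimum over all chains of \<open>m\<close> holomorphic discs \<open>f i\<close> that join the successive points \<open>p i\<close>.
  The value \<open>0\<close> off \<open>D\<close> (here and in the Bergman distance) is a convention: the locale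
  \<open>Metric_space\<close> demands nonnegativity and symmetry on the whole type.
\<close>

definition kobayashi_dist :: "(complex ^ 'n) set \<Rightarrow> complex ^ 'n \<Rightarrow> complex ^ 'n \<Rightarrow> real" where
  "kobayashi_dist D z w =
     (if z \<in> D \<and> w \<in> D
      then Inf {\<Sum>i<m. poincare_dist (a i) (b i) | (m::nat) p f a b.
                  p 0 = z \<and> p m = w \<and>
                  (\<forall>i<m. holomorphic_disc (f i) D \<and> a i \<in> ball 0 1 \<and> b i \<in> ball 0 1 \<and>
                         f i (a i) = p i \<and> f i (b i) = p (Suc i))}
      else 0)"


subsection \<open>Bergman metric\<close>

definition bergman_space :: "(complex ^ 'n) set \<Rightarrow> (complex ^ 'n \<Rightarrow> complex) set" where
  "bergman_space D =
     {f. holomorphic_fun_on f D \<and> set_integrable lborel D (\<lambda>z. (cmod (f z))\<^sup>2)}"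

definition is_bergman_kernel ::
    "(complex ^ 'n) set \<Rightarrow> (complex ^ 'n \<Rightarrow> complex ^ 'n \<Rightarrow> complex) \<Rightarrow> bool" where
  "is_bergman_kernel D K \<longleftrightarrow>
     (\<forall>w\<in>D. (\<lambda>z. K z w) \<in> bergman_space D \<and>
        (\<forall>f \<in> bergman_space D. f w = (LINT z:D|lborel. f z * cnj (K z w))))"

text \<open>The reproducing property determines the kernel on \<open>D \<times> D\<close>, but not its values elsewhere;
  hence \<open>SOME\<close> rather than \<open>THE\<close>. Only the values on \<open>D \<times> D\<close> are used below.\<close>

definition bergman_kernel :: "(complex ^ 'n) set \<Rightarrow> complex ^ 'n \<Rightarrow> complex ^ 'n \<Rightarrow> complex" where
  "bergman_kernel D = (SOME K. is_bergman_kernel D K)"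

text \<open>Wirtinger derivatives \<open>\<partial>/\<partial>z\<^sub>j = (\<partial>/\<partial>x\<^sub>j - \<i> \<partial>/\<partial>y\<^sub>j)/2\<close> and
  \<open>\<partial>/\<partial>cnj z\<^sub>j = (\<partial>/\<partial>x\<^sub>j + \<i> \<partial>/\<partial>y\<^sub>j)/2\<close>.\<close>

definition real_dir_deriv :: "complex ^ 'n \<Rightarrow> (complex ^ 'n \<Rightarrow> complex) \<Rightarrow> complex ^ 'n \<Rightarrow> complex" where
  "real_dir_deriv v u z = vector_derivative (\<lambda>t::real. u (z + t *\<^sub>R v)) (at 0)"

definition wirtinger :: "'n \<Rightarrow> (complex ^ 'n \<Rightarrow> complex) \<Rightarrow> complex ^ 'n \<Rightarrow> complex" where
  "wirtinger j u z = (real_dir_deriv (axis j 1) u z - \<i> * real_dir_deriv (axis j \<i>) u z) / 2"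

definition wirtinger_bar :: "'n \<Rightarrow> (complex ^ 'n \<Rightarrow> complex) \<Rightarrow> complex ^ 'n \<Rightarrow> complex" where
  "wirtinger_bar j u z = (real_dir_deriv (axis j 1) u z + \<i> * real_dir_deriv (axis j \<i>) u z) / 2"

definition bergman_metric_coeff :: "(complex ^ 'n) set \<Rightarrow> 'n \<Rightarrow> 'n \<Rightarrow> complex ^ 'n \<Rightarrow> complex" where
  "bergman_metric_coeff D j k =
     wirtinger j (wirtinger_bar k (\<lambda>z. complex_of_real (ln (Re (bergman_kernel D z z)))))"

definition bergman_norm :: "(complex ^ 'n) set \<Rightarrow> complex ^ 'n \<Rightarrow> complex ^ 'n \<Rightarrow> real" where
  "bergman_norm D z v =
     sqrt (Re (\<Sum>j\<in>UNIV. \<Sum>k\<in>UNIV. bergman_metric_coeff D j k z * (v $ j) * cnj (v $ k)))"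

text \<open>
  Infimum of the lengths \<open>L\<close> of piecewise \<open>C\<^sup>1\<close> paths. \<open>valid_path\<close> allows the velocity to be
  unbounded at the break points, so a path may have infinite length; \<open>has_integral\<close> (unlike
  \<open>integral\<close>, which would then be \<open>0\<close>) discards such paths.
\<close>

definition bergman_dist :: "(complex ^ 'n) set \<Rightarrow> complex ^ 'n \<Rightarrow> complex ^ 'n \<Rightarrow> real" where
  "bergman_dist D z w =
     (if z \<in> D \<and> w \<in> D
      then Inf {L. \<exists>\<gamma>. valid_path \<gamma> \<and> path_image \<gamma> \<subseteq> D \<and> pathstart \<gamma> = z \<and> pathfinish \<gamma> = w \<and>
                  ((\<lambda>t. bergman_norm D (\<gamma> t) (vector_derivative \<gamma> (at t))) has_integral L) {0..1}}
      else 0)"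

end

theory Submission
  imports Defs
begin

unbundle no fps_syntax

text \<open>
  Both distances dominate \<open>\<bar>\<phi> z - \<phi> w\<bar> / 2\<close> for every holomorphic \<open>\<phi>\<close> from \<open>D\<close> to the unit disc. For the
  Kobayashi distance this is the Schwarz--Pick lemma. For the Bergman distance it is the
  comparison with the Caratheodory metric: the Bergman length of \<open>v\<close> at \<open>z\<close>, times
  \<open>sqrt (K z z)\<close>, is the largest derivative along \<open>v\<close> of an \<open>L\<^sup>2\<close> holomorphic function of norm one
  vanishing at \<open>z\<close>, and \<open>(\<phi> - \<phi> z) K (\<cdot>, z)\<close> is such a function up to normalization.

  Let \<open>p n\<close> be a Cauchy sequence for such a distance and let \<open>f\<close> be a map with \<open>f (p N) = 0\<close> whose
  image contains the ball of radius \<open>c\<close>, where \<open>c\<close> does not depend on \<open>N\<close>. Applying the estimate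
  to the components of \<open>f\<close> shows that, for \<open>N\<close> large, \<open>f (p n)\<close> stays in the closed ball of radius
  \<open>c / 2\<close> for \<open>n \<ge> N\<close>. So the tail of the sequence stays in a compact subset of \<open>D\<close>, on which the
  distance is controlled by the Euclidean one.
\<close>

subsection \<open>Holomorphic functions of several variables\<close>

text \<open>The Bergman length is defined by real Wirtinger derivatives of
  \<open>ln (K z z)\<close>, a form that shows neither its sign nor its extremal meaning. The kernel
  is therefore polarized: \<open>K z (cnjv w)\<close> is holomorphic in the pair \<open>z\<close>,
  \<open>w\<close>, the Wirtinger derivatives become holomorphic derivatives in the two blocks of
  variables, and the Bergman form becomes a limit of mixed second differences of
  \<open>ln |K|\<close>. Such a difference compares \<open>K z z * K w w\<close> with
  \<open>|K z w|^2\<close>, hence is governed by Cauchy-Schwarz in the Bergman space; this is the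
  source of positivity and of the extremal bound. Joint holomorphy comes from separate holomorphy
  and local boundedness, the latter again by Cauchy-Schwarz. The facts on several variables all
  reduce to Cauchy estimates on complex lines. The factor 1/2 in the comparison is the price of
  subtracting the value at the base point, which gives a function bounded by 2, instead of moving
  that value to 0 by a disc automorphism. Completeness only asks for a constant independent of the
  points.\<close>

lemma norm_vector_scalar_mult: "norm (c *s v) = cmod c * norm v" for v :: "complex ^ 'n"
  unfolding norm_vec_def vector_smult_component norm_mult by (simp add: L2_set_right_distrib)

lemma vec_affine_has_derivative:
  "((\<lambda>s. z + s *s v) has_derivative (\<lambda>h. h *s v)) (at s within T)" for v :: "complex ^ 'n"
proof -
  have "bounded_linear (\<lambda>s. s *s v)"
    by (rule bounded_linearI'[where 'a=complex and 'b="complex ^ 'n"])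
       (auto simp: vec_eq_iff algebra_simps)
  from bounded_linear.has_derivative[OF this has_derivative_ident]
  show ?thesis by (auto intro!: derivative_eq_intros)
qed

lemma continuous_on_vec_affine [continuous_intros]:
  "continuous_on T (\<lambda>s. z + s *s v)" for v :: "complex ^ 'n"
  by (rule has_derivative_continuous_on[OF vec_affine_has_derivative])

lemma of_real_vector_scalar_mult: "complex_of_real t *s v = t *\<^sub>R v" for v :: "complex ^ 'n"
  by (simp add: vec_eq_iff complex_eq_iff)

text \<open>A one-variable derivative along the complex line through \<open>z\<close>, so that
  one-variable Cauchy estimates apply directly. For holomorphic \<open>f\<close> on an open set it
  is the value at \<open>v\<close> of the complex-linear total derivative.\<close>

definition dird :: "complex ^ 'n \<Rightarrow> (complex ^ 'n \<Rightarrow> complex) \<Rightarrow> complex ^ 'n \<Rightarrow> complex" where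
  "dird v f z = deriv (\<lambda>s. f (z + s *s v)) 0"

lemma dird_eqI:
  assumes L: "(f has_derivative L) (at z)" "\<And>c v. L (c *s v) = c * L v"
  shows "dird v f z = L v"
proof -
    have "((\<lambda>s. f (z + s *s v)) has_derivative (\<lambda>h. L (h *s v))) (at 0)"
      using has_derivative_compose[OF vec_affine_has_derivative[of z v 0 UNIV], of f L] L by simp
    then have "((\<lambda>s. f (z + s *s v)) has_field_derivative L v) (at 0)"
      by (simp add: L(2) has_field_derivative_def mult.commute[of _ "L v"])
    then show ?thesis unfolding dird_def by (rule DERIV_imp_deriv)
qed

lemma holomorphic_fun_on_dird:
  fixes f :: "complex ^ 'n \<Rightarrow> complex"
  assumes f: "holomorphic_fun_on f S" and S: "open S" and z: "z \<in> S"
  shows "(f has_derivative (\<lambda>v. dird v f z)) (at z)" "dird (c *s v) f z = c * dird v f z"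
proof -
  obtain L where L: "(f has_derivative L) (at z)" "\<And>c v. L (c *s v) = c * L v"
    using f z S unfolding holomorphic_fun_on_def by (metis at_within_open)
  have "dird v f z = L v" for v by (rule dird_eqI[OF L])
  then show "(f has_derivative (\<lambda>v. dird v f z)) (at z)" "dird (c *s v) f z = c * dird v f z"
    using L by auto
qed

lemma holomorphic_fun_onI:
  assumes "\<And>z. z \<in> S \<Longrightarrow> \<exists>L. (f has_derivative L) (at z) \<and> (\<forall>c v. L (c *s v) = c * L v)"
  shows "holomorphic_fun_on f S"
  using assms unfolding holomorphic_fun_on_def by (meson has_derivative_at_withinI)

lemma dird_add:
  assumes "holomorphic_fun_on f S" "open S" "z \<in> S"
  shows "dird (v + w) f z = dird v f z + dird w f z"
  using has_derivative_linear[OF holomorphic_fun_on_dird(1)[OF assms]] linear_add by blast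

lemma dird_sum:
  assumes "holomorphic_fun_on f S" "open S" "z \<in> S"
  shows "dird (\<Sum>i\<in>I. v i) f z = (\<Sum>i\<in>I. dird (v i) f z)"
  using has_derivative_linear[OF holomorphic_fun_on_dird(1)[OF assms]] linear_sum by blast

lemma holomorphic_fun_on_subset:
  "holomorphic_fun_on f S \<Longrightarrow> T \<subseteq> S \<Longrightarrow> holomorphic_fun_on f T"
  unfolding holomorphic_fun_on_def by (meson has_derivative_subset subsetD)

lemma holomorphic_fun_on_imp_continuous_on: "holomorphic_fun_on f S \<Longrightarrow> continuous_on S f"
  unfolding holomorphic_fun_on_def continuous_on_eq_continuous_within
  using has_derivative_continuous by blast

lemma holomorphic_fun_on_const: "holomorphic_fun_on (\<lambda>_. c) S"
  unfolding holomorphic_fun_on_def by (auto intro!: exI[of _ "\<lambda>_. 0"])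

lemma holomorphic_fun_on_nth: "holomorphic_fun_on (\<lambda>z. z $ j) S"
  unfolding holomorphic_fun_on_def
  by (auto intro!: exI[of _ "\<lambda>v. v $ j"] bounded_linear_imp_has_derivative bounded_linear_vec_nth)

lemma holomorphic_fun_on_add:
  "holomorphic_fun_on f S \<Longrightarrow> holomorphic_fun_on g S \<Longrightarrow> holomorphic_fun_on (\<lambda>z. f z + g z) S"
  unfolding holomorphic_fun_on_def
proof
  fix z assume fg: "\<forall>z\<in>S. \<exists>f'. (f has_derivative f') (at z within S) \<and> (\<forall>c v. f' (c *s v) = c * f' v)"
    "\<forall>z\<in>S. \<exists>f'. (g has_derivative f') (at z within S) \<and> (\<forall>c v. f' (c *s v) = c * f' v)"
    and "z \<in> S"
  then obtain f' g' where "(f has_derivative f') (at z within S)" "\<And>c v. f' (c *s v) = c * f' v"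
    "(g has_derivative g') (at z within S)" "\<And>c v. g' (c *s v) = c * g' v"
    by meson
  then show "\<exists>L. ((\<lambda>z. f z + g z) has_derivative L) (at z within S) \<and>
      (\<forall>c v. L (c *s v) = c * L v)"
    by (intro exI[of _ "\<lambda>v. f' v + g' v"]) (auto intro!: has_derivative_add simp: algebra_simps)
qed

lemma holomorphic_fun_on_mult:
  assumes "holomorphic_fun_on f S" "holomorphic_fun_on g S"
  shows "holomorphic_fun_on (\<lambda>z. f z * g z) S"
  unfolding holomorphic_fun_on_def
proof
  fix z assume "z \<in> S"
  then obtain f' g' where "(f has_derivative f') (at z within S)" "\<And>c v. f' (c *s v) = c * f' v"
    "(g has_derivative g') (at z within S)" "\<And>c v. g' (c *s v) = c * g' v"
    using assms unfolding holomorphic_fun_on_def by meson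
  then show "\<exists>L. ((\<lambda>z. f z * g z) has_derivative L) (at z within S) \<and>
      (\<forall>c v. L (c *s v) = c * L v)"
    by (intro exI[of _ "\<lambda>v. f z * g' v + f' v * g z"])
       (auto intro!: has_derivative_mult simp: algebra_simps)
qed

lemma holomorphic_fun_on_cmult:
  "holomorphic_fun_on f S \<Longrightarrow> holomorphic_fun_on (\<lambda>z. c * f z) S"
  by (intro holomorphic_fun_on_mult holomorphic_fun_on_const)

lemma holomorphic_fun_on_diff:
  "holomorphic_fun_on f S \<Longrightarrow> holomorphic_fun_on g S \<Longrightarrow> holomorphic_fun_on (\<lambda>z. f z - g z) S"
  using holomorphic_fun_on_add[OF _ holomorphic_fun_on_cmult[of g S "-1"]] by simp

lemma holomorphic_fun_on_compose:
  assumes f: "holomorphic_fun_on f S" and g: "g holomorphic_on T" and T: "open T" "f ` S \<subseteq> T"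
  shows "holomorphic_fun_on (\<lambda>z. g (f z)) S"
  unfolding holomorphic_fun_on_def
proof
  fix z assume z: "z \<in> S"
  obtain f' where f': "(f has_derivative f') (at z within S)" "\<And>c v. f' (c *s v) = c * f' v"
    using f z unfolding holomorphic_fun_on_def by meson
  have "(g has_field_derivative deriv g (f z)) (at (f z))"
    using g T z holomorphic_derivI by blast
  then have "(g has_derivative (*) (deriv g (f z))) (at (f z))"
    by (simp add: has_field_derivative_def)
  from has_derivative_compose[OF f'(1) this]
  show "\<exists>L. ((\<lambda>z. g (f z)) has_derivative L) (at z within S) \<and> (\<forall>c v. L (c *s v) = c * L v)"
    by (intro exI[of _ "\<lambda>v. deriv g (f z) * f' v"]) (auto simp: f')
qed

section \<open>Restriction to complex lines and Cauchy estimates\<close>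

lemma holomorphic_fun_on_slice:
  fixes f :: "complex ^ 'n \<Rightarrow> complex"
  assumes f: "holomorphic_fun_on f S" and S: "open S" and z: "z + s *s v \<in> S"
  shows "((\<lambda>s. f (z + s *s v)) has_field_derivative dird v f (z + s *s v)) (at s)"
proof -
  note L = holomorphic_fun_on_dird[OF f S z]
  have "((\<lambda>s. f (z + s *s v)) has_derivative (\<lambda>h. dird (h *s v) f (z + s *s v))) (at s)"
    using has_derivative_compose[OF vec_affine_has_derivative[of z v s UNIV] L(1)] .
  then show ?thesis
    by (simp add: L(2) has_field_derivative_def mult.commute[of _ "dird v f (z + s *s v)"])
qed

lemma holomorphic_fun_on_slice_holomorphic:
  assumes f: "holomorphic_fun_on f S" and S: "open S" and T: "\<And>s. s \<in> T \<Longrightarrow> z + s *s v \<in> S"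
  shows "(\<lambda>s. f (z + s *s v)) holomorphic_on T"
  unfolding holomorphic_on_def field_differentiable_def
  using holomorphic_fun_on_slice[OF f S T] has_field_derivative_at_within by blast

lemma open_vimage_affine:
  "open S \<Longrightarrow> open {s. z + s *s v \<in> S}" for v :: "complex ^ 'n"
  using open_vimage[OF _ continuous_on_vec_affine] by (simp add: vimage_def)

lemma dird_bound:
  fixes f :: "complex ^ 'n \<Rightarrow> complex"
  assumes f: "holomorphic_fun_on f (ball z r)" and r: "0 < r"
    and M: "\<And>w. w \<in> ball z r \<Longrightarrow> cmod (f w) \<le> M"
  shows "cmod (dird v f z) \<le> 2 * M / r * norm v"
proof (cases "v = 0")
  case True
  then show ?thesis by (simp add: dird_def)
next
  case False
  \<comment> \<open>Half the radius of the largest disc of parameters that stays in the ball, so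
    that even the closed disc does; this causes the factor 2 in the bound.\<close>
  define t where "t = r / (2 * norm v)"
  have t: "t > 0" using False r by (simp add: t_def)
  have in_ball: "z + s *s v \<in> ball z r" if "cmod s \<le> t" for s
  proof -
    have "cmod s * norm v \<le> t * norm v" using that by (simp add: mult_right_mono)
    also have "\<dots> < r" using False r by (simp add: t_def)
    finally show ?thesis by (simp add: dist_norm norm_vector_scalar_mult)
  qed
  let ?g = "\<lambda>s. f (z + s *s v)"
  have hol: "?g holomorphic_on cball 0 t"
    by (rule holomorphic_fun_on_slice_holomorphic[OF f open_ball], rule in_ball) simp
  have "cmod ((deriv ^^ 1) ?g 0) \<le> fact 1 * M / t ^ 1"
  proof (rule Cauchy_inequality[OF _ _ t])
    show "?g holomorphic_on ball 0 t"
      using hol ball_subset_cball holomorphic_on_subset by blast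
    show "continuous_on (cball 0 t) ?g"
      using hol by (rule holomorphic_on_imp_continuous_on)
    show "cmod (?g x) \<le> M" if "cmod (0 - x) = t" for x
      by (rule M, rule in_ball) (use that in simp)
  qed
  also have "fact 1 * M / t ^ 1 = 2 * M / r * norm v"
    using r False by (simp add: t_def)
  finally show ?thesis by (simp add: dird_def)
qed

text \<open>Mean value inequality on the convex half ball: each of its points has a ball of radius
  \<open>r / 2\<close> inside the large one, where \<open>dird_bound\<close> gives
  \<open>2 * M / (r / 2)\<close>.\<close>

lemma holomorphic_fun_lipschitz:
  fixes f :: "complex ^ 'n \<Rightarrow> complex"
  assumes f: "holomorphic_fun_on f (ball z r)" and r: "0 < r"
    and M: "\<And>w. w \<in> ball z r \<Longrightarrow> cmod (f w) \<le> M"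
    and w: "w \<in> ball z (r / 2)" "w' \<in> ball z (r / 2)"
  shows "cmod (f w - f w') \<le> 4 * M / r * norm (w - w')"
proof (rule differentiable_bound[OF convex_ball _ _ w])
  fix x assume x: "x \<in> ball z (r / 2)"
  then have sub: "ball x (r / 2) \<subseteq> ball z r"
    using dist_triangle_lt[of z x] by (fastforce simp: dist_commute intro: dist_triangle_half_l)
  show "(f has_derivative (\<lambda>v. dird v f x)) (at x within ball z (r / 2))"
    by (rule has_derivative_at_withinI[OF holomorphic_fun_on_dird(1)[OF f open_ball]])
       (use x r in simp)
  have "cmod (dird v f x) \<le> 2 * M / (r / 2) * norm v" for v
    by (rule dird_bound[OF holomorphic_fun_on_subset[OF f sub]]) (use sub M r in auto)
  then show "onorm (\<lambda>v. dird v f x) \<le> 4 * M / r"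
    by (intro onorm_le) simp
qed

text \<open>One-variable Taylor expansion of the slice from parameter 0 to 1. The error depends on
  \<open>f\<close> only through the bound \<open>M\<close>, so it survives limits of uniformly
  bounded functions.\<close>

lemma holomorphic_fun_taylor:
  fixes f :: "complex ^ 'n \<Rightarrow> complex"
  assumes f: "holomorphic_fun_on f (ball z r)" and r: "0 < r"
    and M: "\<And>w. w \<in> ball z r \<Longrightarrow> cmod (f w) \<le> M" and v: "norm v \<le> r / 4"
  shows "cmod (f (z + v) - f z - dird v f z) \<le> 8 * M / r\<^sup>2 * (norm v)\<^sup>2"
proof (cases "v = 0")
  case True
  then show ?thesis by (simp add: dird_def)
next
  case False
  \<comment> \<open>The hypothesis on \<open>norm v\<close> becomes \<open>t \<ge> 2\<close>, so a
    disc of radius \<open>t\<close> about any parameter of modulus at most 1 lies in the disc of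
    radius \<open>2 * t\<close>; Cauchy's inequality there bounds the second derivative.\<close>
  define t where "t = r / (2 * norm v)"
  have t: "t \<ge> 2" using False v by (simp add: t_def field_simps)
  have in_ball: "z + s *s v \<in> ball z r" if "cmod s < 2 * t" for s
  proof -
    have "cmod s * norm v < 2 * t * norm v" using that False by (simp add: mult_right_mono)
    also have "\<dots> = r" using False r by (simp add: t_def)
    finally show ?thesis by (simp add: dist_norm norm_vector_scalar_mult)
  qed
  let ?g = "\<lambda>s. f (z + s *s v)"
  have hol: "?g holomorphic_on ball 0 (2 * t)"
    by (rule holomorphic_fun_on_slice_holomorphic[OF f open_ball], rule in_ball) simp
  have "cmod ((deriv ^^ 0) ?g 1 - (\<Sum>i\<le>1. (deriv ^^ i) ?g 0 * (1 - 0) ^ i / fact i)) \<le>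
      (2 * M / t\<^sup>2) * cmod (1 - 0) ^ Suc 1 / fact 1"
  proof (rule complex_Taylor[where S = "cball 0 1"])
    fix i :: nat and x :: complex assume x: "x \<in> cball 0 1"
    then have "x \<in> ball 0 (2 * t)" using t by auto
    then have "((deriv ^^ i) ?g has_field_derivative deriv ((deriv ^^ i) ?g) x) (at x)"
      using holomorphic_derivI holomorphic_higher_deriv[OF hol] by blast
    then show "((deriv ^^ i) ?g has_field_derivative (deriv ^^ Suc i) ?g x) (at x within cball 0 1)"
      by (simp add: has_field_derivative_at_within)
    have sub: "cball x t \<subseteq> ball 0 (2 * t)"
    proof
      fix y assume "y \<in> cball x t"
      then have "cmod y \<le> cmod x + t" using norm_triangle_sub[of y x] by (simp add: dist_norm norm_minus_commute)
      then show "y \<in> ball 0 (2 * t)" using x t by auto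
    qed
    have "cmod ((deriv ^^ 2) ?g x) \<le> fact 2 * M / t ^ 2"
    proof (rule Cauchy_inequality)
      show "?g holomorphic_on ball x t"
        by (rule holomorphic_on_subset[OF hol]) (use sub ball_subset_cball in blast)
      show "continuous_on (cball x t) ?g"
        by (rule holomorphic_on_imp_continuous_on, rule holomorphic_on_subset[OF hol sub])
      fix y assume "cmod (x - y) = t"
      then have "y \<in> ball 0 (2 * t)" using sub by (auto simp: dist_norm)
      then show "cmod (?g y) \<le> M" by (intro M, intro in_ball) simp
    qed (use t in simp)
    then show "cmod ((deriv ^^ Suc 1) ?g x) \<le> 2 * M / t\<^sup>2"
      by (simp add: numeral_2_eq_2)
  qed auto
  then have "cmod (f (z + v) - f z - dird v f z) \<le> 2 * M / t\<^sup>2"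
    by (simp add: dird_def diff_diff_eq)
  also have "2 * M / t\<^sup>2 = 8 * M / r\<^sup>2 * (norm v)\<^sup>2"
    using r False by (simp add: t_def power_divide power_mult_distrib)
  finally show ?thesis .
qed

lemma has_derivative_quadraticI:
  fixes f :: "'a::real_normed_vector \<Rightarrow> 'b::real_normed_vector"
  assumes L: "bounded_linear L" and d: "0 < d"
    and bd: "\<And>v. norm v < d \<Longrightarrow> norm (f (z + v) - f z - L v) \<le> C * (norm v)\<^sup>2"
  shows "(f has_derivative L) (at z)"
proof (rule has_derivativeI_sandwich[OF d L])
  fix y assume y: "y \<noteq> z" "dist y z < d"
  have "norm (f (z + (y - z)) - f z - L (y - z)) \<le> C * (norm (y - z))\<^sup>2"
    by (rule bd) (use y in \<open>simp add: dist_norm\<close>)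
  then show "norm (f y - f z - L (y - z)) / norm (y - z) \<le> C * norm (y - z)"
    using y by (simp add: divide_le_eq power2_eq_square mult_ac)
next
  have "((\<lambda>y. C * norm (y - z)) \<longlongrightarrow> C * norm (z - z)) (at z)"
    by (intro tendsto_intros)
  then show "((\<lambda>y. C * norm (y - z)) \<longlongrightarrow> 0) (at z)" by simp
qed

lemma dird_diff:
  assumes f: "holomorphic_fun_on f S" and g: "holomorphic_fun_on g S" and S: "open S" "z \<in> S"
  shows "dird v (\<lambda>z. f z - g z) z = dird v f z - dird v g z"
proof (rule dird_eqI)
  show "((\<lambda>z. f z - g z) has_derivative (\<lambda>v. dird v f z - dird v g z)) (at z)"
    by (intro has_derivative_diff holomorphic_fun_on_dird(1)[OF f S] holomorphic_fun_on_dird(1)[OF g S])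
qed (simp add: holomorphic_fun_on_dird(2)[OF f S] holomorphic_fun_on_dird(2)[OF g S] algebra_simps)

section \<open>Locally uniform limits and derivatives of holomorphic functions\<close>

text \<open>Weierstrass' theorem. Cauchy estimates for \<open>f m - f n\<close> make the directional
  derivatives at \<open>z\<close> converge to some \<open>L\<close>; the quadratic Taylor bound,
  uniform in \<open>n\<close>, passes to the limit and identifies \<open>L\<close> as the derivative
  of \<open>g\<close>.\<close>

lemma holomorphic_fun_uniform_limit:
  fixes f :: "nat \<Rightarrow> complex ^ 'n \<Rightarrow> complex"
  assumes hol: "\<And>n. holomorphic_fun_on (f n) S"
    and lim: "\<And>z. z \<in> S \<Longrightarrow> \<exists>r>0. ball z r \<subseteq> S \<and> uniform_limit (ball z r) f g sequentially"
  shows "holomorphic_fun_on g S"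
proof (rule holomorphic_fun_onI)
  fix z assume z: "z \<in> S"
  then obtain r0 where r0: "r0 > 0" "ball z r0 \<subseteq> S" and ul: "uniform_limit (ball z r0) f g sequentially"
    using lim by blast
  define r where "r = r0 / 2"
  have r: "r > 0" "cball z r \<subseteq> ball z r0" "ball z r \<subseteq> ball z r0" using r0 by (auto simp: r_def)
  have holr: "holomorphic_fun_on (f n) (ball z r)" for n
    by (rule holomorphic_fun_on_subset[OF hol]) (use r r0 in blast)
  have ev: "\<exists>N. \<forall>n\<ge>N. \<forall>x\<in>ball z r. cmod (f n x - g x) < e" if "e > 0" for e
    using uniform_limitD[OF ul that] r(3) unfolding eventually_sequentially dist_norm by blast
  obtain N where N: "\<And>n x. n \<ge> N \<Longrightarrow> x \<in> ball z r \<Longrightarrow> cmod (f n x - g x) < 1"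
    using ev[OF zero_less_one] by blast
  have "compact (f N ` cball z r)"
    using r r0 by (intro compact_continuous_image compact_cball holomorphic_fun_on_imp_continuous_on
        holomorphic_fun_on_subset[OF hol]) auto
  then obtain M0 where M0: "\<And>x. x \<in> cball z r \<Longrightarrow> cmod (f N x) \<le> M0"
    using compact_imp_bounded bounded_iff by (metis imageI)
  \<comment> \<open>For \<open>n \<ge> N\<close> both \<open>f n\<close> and \<open>f N\<close> are
    within 1 of \<open>g\<close>, so 2 is added to the bound for \<open>f N\<close>.\<close>
  define M where "M = M0 + 2"
  have M: "cmod (f n x) \<le> M" if "n \<ge> N" "x \<in> ball z r" for n x
  proof -
    have "cmod (f n x) = cmod (f N x + (f n x - g x) - (f N x - g x))" by simp
    also have "\<dots> \<le> cmod (f N x) + cmod (f n x - g x) + cmod (f N x - g x)"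
      by (meson norm_triangle_ineq norm_triangle_ineq4 add_right_mono order_trans)
    finally show ?thesis using N[OF that] N[OF order_refl that(2)] M0[of x] that(2)
      by (simp add: M_def)
  qed
  have "convergent (\<lambda>n. dird v (f n) z)" for v
    unfolding Cauchy_convergent_iff[symmetric]
  proof (rule metric_CauchyI)
    fix e :: real assume e: "e > 0"
    \<comment> \<open>The added 1 makes the divisor positive when \<open>v = 0\<close> and the later
      comparison strict.\<close>
    define K where "K = norm v + 1"
    have K: "K > 0" by (simp add: K_def add_nonneg_pos)
    define e' where "e' = e * r / K / 4"
    have e': "e' > 0" using e r K by (simp add: e'_def)
    obtain N' where N': "\<And>n x. n \<ge> N' \<Longrightarrow> x \<in> ball z r \<Longrightarrow> cmod (f n x - g x) < e'"
      using ev[OF e'] by blast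
    have "dist (dird v (f m) z) (dird v (f n) z) < e" if mn: "m \<ge> N'" "n \<ge> N'" for m n
    proof -
      have b: "cmod (f m w - f n w) \<le> 2 * e'" if "w \<in> ball z r" for w
        using N'[OF mn(1) that] N'[OF mn(2) that] norm_triangle_ineq4[of "f m w - g w" "f n w - g w"]
        by simp
      have "dird v (f m) z - dird v (f n) z = dird v (\<lambda>z. f m z - f n z) z"
        by (rule dird_diff[OF holr holr, symmetric]) (use r in auto)
      also have "cmod \<dots> \<le> 2 * (2 * e') / r * norm v"
        by (rule dird_bound[OF holomorphic_fun_on_diff[OF holr holr] r(1) b])
      also have "\<dots> < 2 * (2 * e') / r * K"
        by (intro mult_strict_left_mono) (use e' r in \<open>auto simp: K_def\<close>)
      also have "\<dots> = e"
        using r K by (simp add: e'_def)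
      finally show ?thesis by (simp add: dist_norm)
    qed
    then show "\<exists>M. \<forall>m\<ge>M. \<forall>n\<ge>M. dist (dird v (f m) z) (dird v (f n) z) < e" by blast
  qed
  then obtain L where L: "\<And>v. (\<lambda>n. dird v (f n) z) \<longlonglongrightarrow> L v"
    unfolding convergent_def by metis
  have zr: "z \<in> ball z r" using r by simp
  have hom: "L (c *s v) = c * L v" for c v
  proof (rule LIMSEQ_unique[OF L])
    show "(\<lambda>n. dird (c *s v) (f n) z) \<longlonglongrightarrow> c * L v"
      unfolding holomorphic_fun_on_dird(2)[OF holr open_ball zr] by (intro tendsto_intros L)
  qed
  have "linear L"
  proof (rule linearI)
    show "L (v + w) = L v + L w" for v w
    proof (rule LIMSEQ_unique[OF L])
      show "(\<lambda>n. dird (v + w) (f n) z) \<longlonglongrightarrow> L v + L w"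
        unfolding dird_add[OF holr open_ball zr] by (intro tendsto_intros L)
    qed
    show "L (c *\<^sub>R v) = c *\<^sub>R L v" for c v
      using hom[of "complex_of_real c" v] by (simp add: of_real_vector_scalar_mult scaleR_conv_of_real)
  qed
  then have bl: "bounded_linear L" by (simp add: linear_conv_bounded_linear)
  have "(g has_derivative L) (at z)"
  proof (rule has_derivative_quadraticI[OF bl, where d = "r / 4" and C = "8 * M / r\<^sup>2"])
    fix v :: "complex ^ 'n" assume v: "norm v < r / 4"
    have pt: "(\<lambda>n. f n x) \<longlonglongrightarrow> g x" if "x \<in> ball z r" for x
      using tendsto_uniform_limitI[OF ul] that r by blast
    have zv: "z + v \<in> ball z r" using v r by (simp add: dist_norm)
    have "(\<lambda>n. cmod (f n (z + v) - f n z - dird v (f n) z)) \<longlonglongrightarrow> cmod (g (z + v) - g z - L v)"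
      by (intro tendsto_intros pt zv zr L)
    moreover have "\<exists>N. \<forall>n\<ge>N. cmod (f n (z + v) - f n z - dird v (f n) z) \<le> 8 * M / r\<^sup>2 * (norm v)\<^sup>2"
      using holomorphic_fun_taylor[OF holr r(1) M] v by (metis less_eq_real_def)
    ultimately show "cmod (g (z + v) - g z - L v) \<le> 8 * M / r\<^sup>2 * (norm v)\<^sup>2"
      by (rule LIMSEQ_le_const2)
  qed (use r in simp)
  then show "\<exists>L. (g has_derivative L) (at z) \<and> (\<forall>c v. L (c *s v) = c * L v)"
    using hom by blast
qed

lemma holomorphic_fun_on_local:
  assumes "\<And>z. z \<in> S \<Longrightarrow> \<exists>T. open T \<and> z \<in> T \<and> holomorphic_fun_on f T"
  shows "holomorphic_fun_on f S"
  using assms holomorphic_fun_on_dird by (intro holomorphic_fun_onI) blast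

lemma holomorphic_fun_on_translate:
  assumes f: "holomorphic_fun_on f S" and S: "open S" and T: "\<And>z. z \<in> T \<Longrightarrow> z + w \<in> S"
  shows "holomorphic_fun_on (\<lambda>z. f (z + w)) T"
proof (rule holomorphic_fun_onI)
  fix z assume "z \<in> T"
  note L = holomorphic_fun_on_dird[OF f S T[OF this]]
  have "((\<lambda>z. f (z + w)) has_derivative (\<lambda>v. dird v f (z + w))) (at z)"
    by (rule has_derivative_compose[of "\<lambda>z. z + w" "\<lambda>v. v" z UNIV, OF _ L(1)])
      (auto intro!: derivative_eq_intros)
  then show "\<exists>L. ((\<lambda>z. f (z + w)) has_derivative L) (at z) \<and> (\<forall>c v. L (c *s v) = c * L v)"
    using L(2) by blast
qed

text \<open>The derivative along \<open>v\<close> is a locally uniform limit of difference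
  quotients, which are holomorphic: the Taylor bound makes the error a constant times the
  step.\<close>

lemma holomorphic_fun_on_dird_holomorphic:
  fixes f :: "complex ^ 'n \<Rightarrow> complex"
  assumes f: "holomorphic_fun_on f S" and S: "open S"
  shows "holomorphic_fun_on (dird v f) S"
proof (rule holomorphic_fun_on_local)
  fix z assume "z \<in> S"
  then obtain r0 where r0: "r0 > 0" "cball z r0 \<subseteq> S" using S open_contains_cball by blast
  define r where "r = r0 / 2"
  have r: "r > 0" using r0 by (simp add: r_def)
  have "compact (f ` cball z r0)"
    using r0 by (intro compact_continuous_image compact_cball holomorphic_fun_on_imp_continuous_on
        holomorphic_fun_on_subset[OF f]) auto
  then obtain M where M: "\<And>x. x \<in> cball z r0 \<Longrightarrow> cmod (f x) \<le> M"
    using compact_imp_bounded bounded_iff by (metis imageI)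
  have sub: "ball x r \<subseteq> cball z r0" if "x \<in> ball z r" for x
  proof
    fix y assume "y \<in> ball x r"
    then show "y \<in> cball z r0" using that dist_triangle[of z y x] by (simp add: r_def)
  qed
  \<comment> \<open>Steps tending to 0, all so small that the increment along \<open>v\<close> has
    norm at most \<open>r / 4\<close>, the range of \<open>holomorphic_fun_taylor\<close>.\<close>
  define h where "h n = r / (4 * (norm v + 1)) / real (Suc n)" for n
  have h: "h n > 0" for n using r by (simp add: h_def add_nonneg_pos)
  have hv: "norm (complex_of_real (h n) *s v) \<le> r / 4" for n
  proof -
    have "norm (complex_of_real (h n) *s v) = h n * norm v"
      using h[of n] by (simp add: norm_vector_scalar_mult)
    also have "\<dots> = r / 4 * (norm v / (norm v + 1)) / real (Suc n)" by (simp add: h_def)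
    also have "\<dots> \<le> r / 4 * 1 / 1"
      using r by (intro frac_le mult_left_mono) (auto simp: divide_le_eq add_nonneg_pos)
    finally show ?thesis by simp
  qed
  define F where "F n x = (f (x + complex_of_real (h n) *s v) - f x) / complex_of_real (h n)" for n x
  have xh: "x + complex_of_real (h n) *s v \<in> S" if "x \<in> ball z r" for x n
  proof -
    have "x + complex_of_real (h n) *s v \<in> ball x r" using hv[of n] r by (simp add: dist_norm)
    then show ?thesis using sub[OF that] r0 by blast
  qed
  have x0: "x \<in> S" if "x \<in> ball z r" for x using r0 sub[OF that] r centre_in_ball[of x r] by blast
  have est: "cmod (F n x - dird v f x) \<le> h n * (8 * M / r\<^sup>2 * (norm v)\<^sup>2)" if x: "x \<in> ball z r" for n x
  proof -
    let ?w = "complex_of_real (h n) *s v"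
    have fx: "holomorphic_fun_on f (ball x r)"
      by (rule holomorphic_fun_on_subset[OF f]) (use sub[OF x] r0 in blast)
    have "cmod (f (x + ?w) - f x - dird ?w f x) \<le> 8 * M / r\<^sup>2 * (norm ?w)\<^sup>2"
      by (rule holomorphic_fun_taylor[OF fx r _ hv]) (use M sub[OF x] in blast)
    also have "dird ?w f x = complex_of_real (h n) * dird v f x"
      by (rule holomorphic_fun_on_dird(2)[OF f S x0[OF x]])
    also have "f (x + ?w) - f x - \<dots> = complex_of_real (h n) * (F n x - dird v f x)"
      using h[of n] by (simp add: F_def right_diff_distrib diff_divide_distrib)
    finally have "h n * cmod (F n x - dird v f x) \<le> h n * (h n * (8 * M / r\<^sup>2 * (norm v)\<^sup>2))"
      using h[of n] by (simp add: norm_mult norm_vector_scalar_mult power_mult_distrib power2_eq_square mult_ac)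
    then show ?thesis using h[of n] by (simp del: times_divide_eq_right times_divide_eq_left)
  qed
  have "holomorphic_fun_on (dird v f) (ball z r)"
  proof (rule holomorphic_fun_uniform_limit)
    show "holomorphic_fun_on (F n) (ball z r)" for n
      unfolding F_def divide_inverse mult.commute[of _ "inverse _"]
      by (intro holomorphic_fun_on_cmult holomorphic_fun_on_diff holomorphic_fun_on_translate[OF f S] xh)
        (auto intro: holomorphic_fun_on_subset[OF f] x0)
    have "h \<longlonglongrightarrow> 0"
      unfolding h_def divide_inverse[of _ "real _"]
      by (rule tendsto_mult_right_zero[OF LIMSEQ_inverse_real_of_nat])
    then have h0: "(\<lambda>n. h n * (8 * M / r\<^sup>2 * (norm v)\<^sup>2)) \<longlonglongrightarrow> 0"
      by (rule tendsto_mult_left_zero)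
    have "uniform_limit (ball z r) F (dird v f) sequentially"
    proof (rule uniform_limitI)
      fix e :: real assume "e > 0"
      then have "\<forall>\<^sub>F n in sequentially. h n * (8 * M / r\<^sup>2 * (norm v)\<^sup>2) < e"
        using h0 order_tendstoD(2) by blast
      then show "\<forall>\<^sub>F n in sequentially. \<forall>x\<in>ball z r. dist (F n x) (dird v f x) < e"
        unfolding dist_norm by eventually_elim (use est le_less_trans in blast)
    qed
    then show "\<exists>r'>0. ball x r' \<subseteq> ball z r \<and> uniform_limit (ball x r') F (dird v f) sequentially"
      if "x \<in> ball z r" for x
      using that openE[OF open_ball that] uniform_limit_on_subset by metis
  qed
  then show "\<exists>T. open T \<and> z \<in> T \<and> holomorphic_fun_on (dird v f) T"
    using r by (intro exI[of _ "ball z r"]) auto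
qed

subsection \<open>Separate holomorphy and polarization\<close>

text \<open>The product of two coordinate spaces is modelled by vectors indexed by the sum type, so
  that functions of two vector variables are again covered by
  \<open>holomorphic_fun_on\<close>.\<close>

definition pr1 :: "complex ^ ('n::finite + 'm::finite) \<Rightarrow> complex ^ 'n" where "pr1 x = (\<chi> i. x $ Inl i)"
definition pr2 :: "complex ^ ('n::finite + 'm::finite) \<Rightarrow> complex ^ 'm" where "pr2 x = (\<chi> i. x $ Inr i)"
definition pair :: "complex ^ 'n \<Rightarrow> complex ^ 'm \<Rightarrow> complex ^ ('n::finite + 'm::finite)" where
  "pair z w = (\<chi> i. case i of Inl j \<Rightarrow> z $ j | Inr j \<Rightarrow> w $ j)"
definition cnjv :: "complex ^ 'n \<Rightarrow> complex ^ 'n" where "cnjv z = (\<chi> i. cnj (z $ i))"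

lemma pr_pair [simp]: "pr1 (pair z w) = z" "pr2 (pair z w) = w"
  by (simp_all add: pr1_def pr2_def pair_def vec_eq_iff)

lemma cnjv_cnjv [simp]: "cnjv (cnjv z) = z"
  by (simp add: cnjv_def vec_eq_iff)

lemma norm_cnjv [simp]: "norm (cnjv z) = norm z"
  by (simp add: cnjv_def norm_vec_def)

lemma cnjv_linear:
  "cnjv (z + w) = cnjv z + cnjv w" "cnjv (z - w) = cnjv z - cnjv w"
  "cnjv (c *s z) = cnj c *s cnjv z" "cnjv (t *\<^sub>R z) = t *\<^sub>R cnjv z"
  by (simp_all add: cnjv_def vec_eq_iff)

lemma pr_linear:
  "pr1 (x + y) = pr1 x + pr1 y" "pr2 (x + y) = pr2 x + pr2 y"
  "pr1 (x - y) = pr1 x - pr1 y" "pr2 (x - y) = pr2 x - pr2 y"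
  "pr1 (c *s x) = c *s pr1 x" "pr2 (c *s x) = c *s pr2 x"
  "pr1 (t *\<^sub>R x) = t *\<^sub>R pr1 x" "pr2 (t *\<^sub>R x) = t *\<^sub>R pr2 x"
  by (simp_all add: pr1_def pr2_def vec_eq_iff)

lemma pair_linear:
  "pair (z + z') (w + w') = pair z w + pair z' w'"
  "pair (t *\<^sub>R z) (t *\<^sub>R w) = t *\<^sub>R pair z w"
  by (simp_all add: pair_def vec_eq_iff split: sum.split)

lemma norm_pr_le: "norm (pr1 x) \<le> norm x" "norm (pr2 x) \<le> norm x"
proof -
  have eq: "(norm x)\<^sup>2 = (norm (pr1 x))\<^sup>2 + (norm (pr2 x))\<^sup>2"
    by (simp add: norm_vec_def L2_set_def sum_nonneg pr1_def pr2_def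
        flip: sum.Plus[of UNIV UNIV "\<lambda>i. (cmod (x $ i))\<^sup>2", unfolded o_def, simplified])
  show "norm (pr1 x) \<le> norm x" "norm (pr2 x) \<le> norm x"
    by (rule power2_le_imp_le; simp add: eq)+
qed

lemma bounded_linear_pr: "bounded_linear pr1" "bounded_linear pr2"
  by (auto intro!: bounded_linear_intro[where K = 1] simp: pr_linear norm_pr_le)

lemma bounded_linear_conj_pair: "bounded_linear (\<lambda>z. pair z (cnjv z))"
  by (simp add: linear_conv_bounded_linear[symmetric] linear_iff cnjv_linear pair_linear)

text \<open>The mixed second difference is bounded by the product of the two increments, so
  near a point the function is, up to second order, the sum of its two partial functions.\<close>

lemma holomorphic_joint:
  fixes f :: "complex ^ 'n \<Rightarrow> complex ^ 'm \<Rightarrow> complex"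
  assumes A: "open A" and B: "open B"
    and f1: "\<And>w. w \<in> B \<Longrightarrow> holomorphic_fun_on (\<lambda>z. f z w) A"
    and f2: "\<And>z. z \<in> A \<Longrightarrow> holomorphic_fun_on (f z) B"
    and bdd: "\<And>z w. z \<in> A \<Longrightarrow> w \<in> B \<Longrightarrow> \<exists>r>0. \<exists>M. ball z r \<subseteq> A \<and> ball w r \<subseteq> B \<and>
               (\<forall>z'\<in>ball z r. \<forall>w'\<in>ball w r. cmod (f z' w') \<le> M)"
  shows "holomorphic_fun_on (\<lambda>x. f (pr1 x) (pr2 x)) {x. pr1 x \<in> A \<and> pr2 x \<in> B}"
proof (rule holomorphic_fun_onI)
  fix x :: "complex ^ ('n::finite + 'm::finite)" assume "x \<in> {x. pr1 x \<in> A \<and> pr2 x \<in> B}"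
  then have xA: "pr1 x \<in> A" and xB: "pr2 x \<in> B" by auto
  define z0 where "z0 = pr1 x"
  define w0 where "w0 = pr2 x"
  obtain r M where r: "r > 0" "ball z0 r \<subseteq> A" "ball w0 r \<subseteq> B"
    and M: "\<And>z w. z \<in> ball z0 r \<Longrightarrow> w \<in> ball w0 r \<Longrightarrow> cmod (f z w) \<le> M"
    using bdd[OF xA xB] unfolding z0_def w0_def by metis
  define R where "R y = f (pr1 y) (pr2 y) - f (pr1 y) w0 - f z0 (pr2 y) + f z0 w0" for y
  have R: "(R has_derivative (\<lambda>v. 0)) (at x)"
  proof (rule has_derivative_quadraticI[where d = "r / 2" and C = "4 * (4 * M / r) / r"])
    fix v :: "complex ^ ('n::finite + 'm::finite)" assume v: "norm v < r / 2"
    let ?z = "z0 + pr1 v" and ?w = "w0 + pr2 v"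
    have z: "?z \<in> ball z0 (r / 2)" and w: "?w \<in> ball w0 (r / 2)"
      using v norm_pr_le[of v] by (auto simp: dist_norm)
    have r2: "z0 \<in> ball z0 (r / 2)" "w0 \<in> ball w0 (r / 2)" using r by auto
    have w': "?w \<in> ball w0 r" "w0 \<in> ball w0 r" using w r by auto
    have M0: "0 \<le> M" using M[of z0 w0] r norm_ge_zero order_trans by (metis centre_in_ball)
    let ?G = "\<lambda>z. f z ?w - f z w0"
    have G: "cmod (?G z) \<le> 4 * M / r * norm (pr2 v)" if "z \<in> ball z0 r" for z
    proof -
      have "cmod (?G z) \<le> 4 * M / r * norm (?w - w0)"
        by (rule holomorphic_fun_lipschitz[OF holomorphic_fun_on_subset[OF f2] r(1) M w r2(2)])
          (use that r in auto)
      then show ?thesis by simp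
    qed
    \<comment> \<open>The Lipschitz bound in \<open>w\<close> now serves as the sup bound for
      \<open>?G\<close> in the Lipschitz estimate in \<open>z\<close>; this produces the product of
      the two increments.\<close>
    have "cmod (?G ?z - ?G z0) \<le> 4 * (4 * M / r * norm (pr2 v)) / r * norm (?z - z0)"
      by (rule holomorphic_fun_lipschitz[OF holomorphic_fun_on_subset[OF holomorphic_fun_on_diff[OF f1 f1] r(2)] r(1) G z r2(1)])
        (use w' r in auto)
    also have "\<dots> = 4 * (4 * M / r) / r * (norm (pr1 v) * norm (pr2 v))" by simp
    also have "\<dots> \<le> 4 * (4 * M / r) / r * (norm v)\<^sup>2"
      unfolding power2_eq_square using M0 r
      by (intro mult_left_mono mult_mono norm_pr_le) auto
    also have "?G ?z - ?G z0 = R (x + v) - R x - 0"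
      by (simp add: R_def pr_linear z0_def w0_def)
    finally show "cmod (R (x + v) - R x - 0) \<le> 4 * (4 * M / r) / r * (norm v)\<^sup>2" .
  qed (use r in auto)
  note L1 = holomorphic_fun_on_dird[OF f1[OF xB] A xA, folded z0_def w0_def]
  note L2 = holomorphic_fun_on_dird[OF f2[OF xA] B xB, folded z0_def w0_def]
  have D1: "((\<lambda>y. f (pr1 y) w0) has_derivative (\<lambda>v. dird (pr1 v) (\<lambda>z. f z w0) z0)) (at x)"
    unfolding z0_def
    by (rule has_derivative_compose[OF bounded_linear_imp_has_derivative[OF bounded_linear_pr(1)] L1(1)[unfolded z0_def]])
  have D2: "((\<lambda>y. f z0 (pr2 y)) has_derivative (\<lambda>v. dird (pr2 v) (f z0) w0)) (at x)"
    unfolding w0_def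
    by (rule has_derivative_compose[OF bounded_linear_imp_has_derivative[OF bounded_linear_pr(2)] L2(1)[unfolded w0_def]])
  have "((\<lambda>y. R y + f (pr1 y) w0 + f z0 (pr2 y) - f z0 w0) has_derivative
      (\<lambda>v. 0 + dird (pr1 v) (\<lambda>z. f z w0) z0 + dird (pr2 v) (f z0) w0 - 0)) (at x)"
    by (intro has_derivative_add has_derivative_diff R D1 D2 has_derivative_const)
  then have "((\<lambda>y. f (pr1 y) (pr2 y)) has_derivative
      (\<lambda>v. dird (pr1 v) (\<lambda>z. f z w0) z0 + dird (pr2 v) (f z0) w0)) (at x)"
    by (simp add: R_def)
  then show "\<exists>L. ((\<lambda>y. f (pr1 y) (pr2 y)) has_derivative L) (at x) \<and> (\<forall>c v. L (c *s v) = c * L v)"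
    by (intro exI conjI) (auto simp: pr_linear L1(2) L2(2) distrib_left)
qed

text \<open>Chain rule along the real-linear embedding of \<open>z\<close> as
  \<open>pair z (cnjv z)\<close>. Agreement with \<open>G\<close> is asked only near
  \<open>z\<close>, since for the Bergman kernel it is known only inside \<open>D\<close>.\<close>

lemma real_dir_deriv_conj_pair:
  assumes G: "holomorphic_fun_on G S" and S: "open S" and z: "pair z (cnjv z) \<in> S"
    and u: "\<forall>\<^sub>F z in nhds z. u z = G (pair z (cnjv z))"
  shows "real_dir_deriv v u z = dird (pair v (cnjv v)) G (pair z (cnjv z))"
proof -
  have "((\<lambda>t. z + t *\<^sub>R v) has_vector_derivative v) (at (0::real))"
    by (auto intro!: derivative_eq_intros simp: has_vector_derivative_def)
  from bounded_linear.has_vector_derivative[OF bounded_linear_conj_pair this]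
  have "((\<lambda>t. pair (z + t *\<^sub>R v) (cnjv (z + t *\<^sub>R v))) has_vector_derivative pair v (cnjv v)) (at 0)" .
  from vector_derivative_diff_chain_within[OF this, of G "\<lambda>v. dird v G (pair z (cnjv z))"]
    holomorphic_fun_on_dird(1)[OF G S z]
  have 1: "((\<lambda>t. G (pair (z + t *\<^sub>R v) (cnjv (z + t *\<^sub>R v)))) has_vector_derivative
      dird (pair v (cnjv v)) G (pair z (cnjv z))) (at 0)"
    by (simp add: o_def has_derivative_at_withinI)
  have "filterlim (\<lambda>t::real. z + t *\<^sub>R v) (nhds (z + 0 *\<^sub>R v)) (nhds 0)"
    by (intro tendsto_intros filterlim_ident)
  then have lim: "filterlim (\<lambda>t::real. z + t *\<^sub>R v) (nhds z) (nhds 0)"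
    by simp
  have "\<forall>\<^sub>F t in nhds (0::real). u (z + t *\<^sub>R v) = G (pair (z + t *\<^sub>R v) (cnjv (z + t *\<^sub>R v)))"
    by (intro eventually_compose_filterlim[OF u lim])
  moreover have "u z = G (pair z (cnjv z))"
    using u by (rule eventually_nhds_x_imp_x)
  ultimately have "((\<lambda>t. u (z + t *\<^sub>R v)) has_vector_derivative dird (pair v (cnjv v)) G (pair z (cnjv z))) (at 0)"
    using 1 by (subst has_vector_derivative_cong_ev[where g = "\<lambda>t. G (pair (z + t *\<^sub>R v) (cnjv (z + t *\<^sub>R v)))"]) simp_all
  then show ?thesis unfolding real_dir_deriv_def by (rule vector_derivative_at)
qed

text \<open>Write e and e' for the unit vectors of index \<open>j\<close> in the two blocks. The
  real directions 1 and i of coordinate \<open>j\<close> become e + e' and i e - i e', so the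
  Wirtinger combinations isolate e and e' respectively. Iterated Wirtinger derivatives thus stay
  within holomorphic functions.\<close>

lemma wirtinger_conj_pair:
  assumes G: "holomorphic_fun_on G S" and S: "open S" and z: "pair z (cnjv z) \<in> S"
    and u: "\<forall>\<^sub>F z in nhds z. u z = G (pair z (cnjv z))"
  shows "wirtinger j u z = dird (axis (Inl j) 1) G (pair z (cnjv z))"
    and "wirtinger_bar j u z = dird (axis (Inr j) 1) G (pair z (cnjv z))"
proof -
  let ?D = "\<lambda>v. dird v G (pair z (cnjv z))"
  have e: "pair (axis j 1) (cnjv (axis j 1)) = axis (Inl j) 1 + axis (Inr j) 1"
    "pair (axis j \<i>) (cnjv (axis j \<i>)) = \<i> *s axis (Inl j) 1 + (-\<i>) *s axis (Inr j) 1"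
    by (auto simp: pair_def cnjv_def axis_def vec_eq_iff split: sum.split)
  have d: "real_dir_deriv (axis j 1) u z = ?D (axis (Inl j) 1) + ?D (axis (Inr j) 1)"
    "real_dir_deriv (axis j \<i>) u z = \<i> * ?D (axis (Inl j) 1) + (-\<i>) * ?D (axis (Inr j) 1)"
    unfolding real_dir_deriv_conj_pair[OF assms] e dird_add[OF G S z] holomorphic_fun_on_dird(2)[OF G S z]
    by auto
  show "wirtinger j u z = ?D (axis (Inl j) 1)" "wirtinger_bar j u z = ?D (axis (Inr j) 1)"
    unfolding wirtinger_def wirtinger_bar_def d by (simp_all add: algebra_simps)
qed

subsection \<open>Squeezing maps and completeness\<close>

text \<open>Neither supremum need be attained, so half the lower bound is used: it lies strictly
  below both and hence below an actual radius.\<close>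

lemma hhr_squeezing_maps:
  fixes D :: "(complex ^ 'n) set"
  assumes "holomorphic_homogeneous_regular D"
  obtains c where "c > 0" "\<And>p. p \<in> D \<Longrightarrow> \<exists>f \<in> squeezing_maps D p. ball 0 c \<subseteq> f ` D"
proof -
  obtain c where c: "c > 0" "\<And>p. p \<in> D \<Longrightarrow> c \<le> squeezing D p" and bD: "bounded D"
    using assms unfolding holomorphic_homogeneous_regular_def by auto
  have "\<exists>f \<in> squeezing_maps D p. ball 0 (c / 2) \<subseteq> f ` D" if p: "p \<in> D" for p
  proof -
    obtain R where R: "R > 0" "D \<subseteq> ball p R" using bounded_subset_ballD[OF bD] by metis
    \<comment> \<open>A rescaled translation is a squeezing map; the outer supremum is therefore
      over a nonempty set, without which its value says nothing.\<close>
    define f where "f z = (1 / R) *\<^sub>R (z - p)" for z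
    have "f \<in> squeezing_maps D p"
      unfolding squeezing_maps_def mem_Collect_eq
    proof (intro conjI allI impI)
      have fz: "f z $ j = complex_of_real (1 / R) * (z $ j - p $ j)" for z j
        unfolding f_def vector_scaleR_component by (simp add: scaleR_conv_of_real)
      show "holomorphic_map_on f D" unfolding holomorphic_map_on_def fz
        by (intro allI holomorphic_fun_on_cmult holomorphic_fun_on_diff holomorphic_fun_on_nth
            holomorphic_fun_on_const)
      show "inj_on f D" using R by (auto simp: inj_on_def f_def)
      show "f ` D \<subseteq> ball 0 1" using R by (auto simp: f_def dist_norm norm_minus_commute)
      show "open (f ` U)" if "open U \<and> U \<subseteq> D" for U
      proof -
        have eq: "f ` U = (\<lambda>x. (1 / R) *\<^sub>R x) ` ((\<lambda>x. - p + x) ` U)"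
          by (auto simp: f_def image_image)
        show ?thesis unfolding eq by (intro open_scaling open_translation) (use that R in auto)
      qed
    qed (simp add: f_def)
    then have ne: "squeezing_maps D p \<noteq> {}" by blast
    have "c / 2 < squeezing D p" using c p by force
    then obtain g where g: "g \<in> squeezing_maps D p" "c / 2 < Sup {r. ball 0 r \<subseteq> g ` D}"
      unfolding squeezing_def using less_cSupD[of "(\<lambda>f. Sup {r. ball 0 r \<subseteq> f ` D}) ` squeezing_maps D p"] ne
      by fastforce
    have "{r. ball 0 r \<subseteq> g ` D} \<noteq> {}" by (auto intro!: exI[of _ 0])
    then obtain r where "ball 0 r \<subseteq> g ` D" "c / 2 < r"
      using less_cSupD[OF _ g(2)] by blast
    then show ?thesis using g(1) subset_ball[of "c / 2" r 0] by (meson less_imp_le order_trans)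
  qed
  then show ?thesis using c that[of "c / 2"] by simp
qed

lemma norm_le_sum_cmod: "norm x \<le> (\<Sum>j\<in>UNIV. cmod (x $ j))" for x :: "complex ^ 'n"
  by (simp add: norm_vec_def L2_set_le_sum)

text \<open>The two distances enter the completeness argument only through \<open>lower\<close> and
  \<open>upper\<close>, so it is carried out once for an abstract \<open>d\<close>.\<close>

lemma hhr_mcomplete:
  fixes D :: "(complex ^ 'n) set"
  assumes hhr: "holomorphic_homogeneous_regular D" and d: "Metric_space D d"
    and lower: "\<And>\<phi> z w. holomorphic_fun_on \<phi> D \<Longrightarrow> \<phi> ` D \<subseteq> ball 0 1 \<Longrightarrow> z \<in> D \<Longrightarrow> w \<in> D \<Longrightarrow>
                  cmod (\<phi> z - \<phi> w) \<le> 2 * d z w"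
    and upper: "\<And>q e. q \<in> D \<Longrightarrow> e > 0 \<Longrightarrow> \<exists>\<delta>>0. \<forall>z. dist z q < \<delta> \<longrightarrow> z \<in> D \<and> d z q < e"
  shows "Metric_space.mcomplete D d"
proof -
  interpret Metric_space D d by (rule d)
  obtain c where c: "c > 0" "\<And>p. p \<in> D \<Longrightarrow> \<exists>f \<in> squeezing_maps D p. ball 0 c \<subseteq> f ` D"
    using hhr_squeezing_maps[OF hhr] by metis
  have oD: "open D" using hhr by (simp add: holomorphic_homogeneous_regular_def Cn_domain_def)
  show ?thesis unfolding mcomplete_def
  proof (intro allI impI)
    fix \<sigma> assume \<sigma>: "MCauchy \<sigma>"
    \<comment> \<open>Each coordinate of \<open>f\<close> will be at most \<open>2 * e\<close>, and
      summing over the \<open>CARD('n)\<close> coordinates gives the radius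
      \<open>c / 2\<close>.\<close>
    define e where "e = c / 2 / (2 * real CARD('n))"
    have e: "e > 0" using c by (simp add: e_def)
    obtain N where N: "\<And>n. n \<ge> N \<Longrightarrow> d (\<sigma> n) (\<sigma> N) < e" and \<sigma>D: "\<And>n. \<sigma> n \<in> D"
      using \<sigma> e unfolding MCauchy_def by (metis order_refl range_subsetD)
    obtain f where f: "f \<in> squeezing_maps D (\<sigma> N)" and fc: "ball 0 c \<subseteq> f ` D"
      using c(2)[OF \<sigma>D] by blast
    have hol: "holomorphic_fun_on (\<lambda>z. f z $ j) D" and inj: "inj_on f D" and f0: "f (\<sigma> N) = 0"
      and fB: "f ` D \<subseteq> ball 0 1" and fo: "\<And>U. open U \<Longrightarrow> U \<subseteq> D \<Longrightarrow> open (f ` U)" for j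
      using f by (auto simp: squeezing_maps_def holomorphic_map_on_def)
    have small: "f (\<sigma> n) \<in> cball 0 (c / 2)" if n: "n \<ge> N" for n
    proof -
      have "cmod (f (\<sigma> n) $ j) \<le> 2 * e" for j
      proof -
        have "(\<lambda>z. f z $ j) ` D \<subseteq> ball 0 1"
          using fB Finite_Cartesian_Product.norm_nth_le[of "f _" j] by (force simp: image_subset_iff intro: le_less_trans)
        then have "cmod (f (\<sigma> n) $ j - f (\<sigma> N) $ j) \<le> 2 * d (\<sigma> n) (\<sigma> N)"
          by (rule lower[OF hol _ \<sigma>D \<sigma>D])
        then show ?thesis using N[OF n] f0 by simp
      qed
      then have "(\<Sum>j\<in>UNIV. cmod (f (\<sigma> n) $ j)) \<le> (\<Sum>j\<in>(UNIV::'n set). 2 * e)" by (intro sum_mono)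
      also have "\<dots> = c / 2" by (simp add: e_def)
      finally show ?thesis using norm_le_sum_cmod[of "f (\<sigma> n)"] by simp
    qed
    have cf: "continuous_on D f"
    proof -
      have "continuous_on D (\<lambda>z. \<chi> j. f z $ j)"
        by (rule continuous_on_vec_lambda) (rule holomorphic_fun_on_imp_continuous_on[OF hol])
      then show ?thesis by simp
    qed
    \<comment> \<open>The openness clause in \<open>squeezing_maps\<close> makes the inverse
      continuous; this carries compactness of the closed ball back to \<open>D\<close>.\<close>
    have cg: "continuous_on (f ` D) (inv_into D f)"
    proof (rule continuous_on_inverse_open_map[OF cf refl])
      show "inv_into D f (f x) = x" if "x \<in> D" for x using inj that by simp
      show "openin (top_of_set (f ` D)) (f ` U)" if "openin (top_of_set D) U" for U
        using that oD fo by (metis image_mono openin_imp_subset openin_open_trans openin_subset open_openin open_subset topspace_euclidean_subtopology)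
    qed
    have sub: "cball 0 (c / 2) \<subseteq> f ` D" using fc c(1) by fastforce
    define C where "C = inv_into D f ` cball 0 (c / 2)"
    have "compact C" unfolding C_def
      by (intro compact_continuous_image continuous_on_subset[OF cg sub] compact_cball)
    have CD: "C \<subseteq> D" using sub by (auto simp: C_def intro!: inv_into_into)
    have "\<sigma> (n + N) \<in> C" for n
    proof -
      have "inv_into D f (f (\<sigma> (n + N))) \<in> C" using small[of "n + N"] by (auto simp: C_def)
      then show ?thesis using inj \<sigma>D by simp
    qed
    then obtain q r where q: "q \<in> C" "strict_mono r" "((\<lambda>n. \<sigma> (n + N)) \<circ> r) \<longlonglongrightarrow> q"
      using \<open>compact C\<close> unfolding compact_def by meson
    define s where "s n = r n + N" for n
    have s: "strict_mono s" using q(2) by (simp add: s_def strict_mono_def)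
    have "limitin mtopology (\<sigma> \<circ> s) q sequentially"
      unfolding limit_metric_sequentially
    proof (intro conjI allI impI)
      show "q \<in> D" using q CD by blast
      fix \<epsilon> :: real assume "\<epsilon> > 0"
      then obtain \<delta> where \<delta>: "\<delta> > 0" "\<And>z. dist z q < \<delta> \<Longrightarrow> z \<in> D \<and> d z q < \<epsilon>"
        using upper[OF \<open>q \<in> D\<close>] by meson
      then have "\<exists>M. \<forall>n\<ge>M. dist (\<sigma> (s n)) q < \<delta>"
        using metric_LIMSEQ_D[OF q(3)] by (simp add: s_def)
      then show "\<exists>M. \<forall>n\<ge>M. (\<sigma> \<circ> s) n \<in> D \<and> d ((\<sigma> \<circ> s) n) q < \<epsilon>"
        using \<delta>(2) by auto
    qed
    \<comment> \<open>A Cauchy sequence with a convergent subsequence converges, so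
      \<open>upper\<close> was needed only at the limit point \<open>q\<close>.\<close>
    then show "\<exists>x. limitin mtopology \<sigma> x sequentially"
      using MCauchy_convergent_subsequence[OF \<sigma> s] by blast
  qed
qed

text \<open>A scaled coordinate function suffices; together with the lower bound it shows that
  distinct points have positive distance.\<close>

lemma bounded_points_separated:
  fixes D :: "(complex ^ 'n) set"
  assumes "bounded D" "z \<noteq> w"
  obtains \<phi> where "holomorphic_fun_on \<phi> D" "\<phi> ` D \<subseteq> ball 0 1" "\<phi> z \<noteq> \<phi> w"
proof -
  obtain R where R: "R > 0" "D \<subseteq> ball 0 R" using bounded_subset_ballD[OF assms(1)] by metis
  obtain j where j: "z $ j \<noteq> w $ j" using assms(2) by (auto simp: vec_eq_iff)
  let ?\<phi> = "\<lambda>z::complex ^ 'n. complex_of_real (1 / R) * z $ j"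
  have "cmod (?\<phi> x) < 1" if "x \<in> D" for x
  proof -
    have "cmod (x $ j) < R" using R that Finite_Cartesian_Product.norm_nth_le[of x j] by force
    then show ?thesis using R by (simp add: norm_mult norm_divide)
  qed
  then show ?thesis
    using j R by (intro that[of ?\<phi>] holomorphic_fun_on_cmult holomorphic_fun_on_nth) auto
qed

subsection \<open>The Kobayashi distance\<close>

lemma artanh_ge_self: "x \<le> artanh x" if "0 \<le> x" "x < 1" for x :: real
proof -
  have "artanh 0 - 0 \<le> artanh x - x"
  proof (rule DERIV_nonneg_imp_nondecreasing[OF that(1)])
    fix y assume y: "0 \<le> y" "y \<le> x"
    then have "y\<^sup>2 < 1" using that by (simp add: power2_less_1_iff abs_square_less_1)
    moreover have "((\<lambda>x. artanh x - x) has_real_derivative 1 / (1 - y\<^sup>2) - 1) (at y)"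
      using y that by (auto intro!: derivative_eq_intros)
    ultimately show "\<exists>D. ((\<lambda>x. artanh x - x) has_real_derivative D) (at y) \<and> 0 \<le> D"
      by (intro exI[of _ "1 / (1 - y\<^sup>2) - 1"]) (simp add: le_divide_eq)
  qed
  then show ?thesis by simp
qed

lemma pseudo_hyperbolic_less_1:
  assumes "a \<in> ball 0 1" "b \<in> ball (0::complex) 1"
  shows "cmod ((a - b) / (1 - cnj a * b)) < 1"
proof -
  have "cmod (Moebius_function 0 a b) < 1"
    using assms by (intro Moebius_function_norm_lt_1) auto
  then show ?thesis
    by (simp add: Moebius_function_simple norm_divide norm_minus_commute)
qed

lemma poincare_dist_nonneg: "a \<in> ball 0 1 \<Longrightarrow> b \<in> ball 0 1 \<Longrightarrow> 0 \<le> poincare_dist a b"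
  unfolding poincare_dist_def by (rule order_trans[OF norm_ge_zero artanh_ge_self[OF norm_ge_zero pseudo_hyperbolic_less_1]])

lemma poincare_dist_commute: "poincare_dist a b = poincare_dist b a"
proof -
  have "cmod (1 - cnj a * b) = cmod (1 - cnj b * a)"
    by (metis complex_cnj_cnj complex_cnj_diff complex_cnj_mult complex_cnj_one complex_mod_cnj mult.commute)
  then show ?thesis by (simp add: poincare_dist_def norm_divide norm_minus_commute)
qed

text \<open>A weak form of Schwarz-Pick. A Moebius map takes 0 to \<open>a\<close>; then
  \<open>h - h a\<close>, halved to stay in the unit disc, vanishes at 0 and Schwarz's lemma
  applies. The halving is the factor 2, and the pseudo-hyperbolic distance is at most its
  \<open>artanh\<close>.\<close>

lemma poincare_dist_lower:
  assumes h: "h holomorphic_on ball 0 1" "h ` ball 0 1 \<subseteq> ball 0 1"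
    and ab: "a \<in> ball 0 1" "b \<in> ball (0::complex) 1"
  shows "cmod (h a - h b) \<le> 2 * poincare_dist a b"
proof -
  let ?m = "Moebius_function 0 (- a)"
  have nm: "cmod (?m \<zeta>) < 1" if "cmod \<zeta> < 1" for \<zeta>
    using ab that by (intro Moebius_function_norm_lt_1) auto
  define \<zeta> where "\<zeta> = Moebius_function 0 a b"
  have \<zeta>: "cmod \<zeta> < 1" unfolding \<zeta>_def using ab by (intro Moebius_function_norm_lt_1) auto
  have m\<zeta>: "?m \<zeta> = b"
    unfolding \<zeta>_def using ab by (intro Moebius_function_compose) auto
  define k where "k \<xi> = (h (?m \<xi>) - h a) / 2" for \<xi>
  have m0: "?m 0 = a" by (simp add: Moebius_function_simple)
  have "k holomorphic_on ball 0 1"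
  proof -
    have "?m holomorphic_on ball 0 1" using ab by (intro Moebius_function_holomorphic) auto
    then have "h \<circ> ?m holomorphic_on ball 0 1"
      by (rule holomorphic_on_compose_gen[OF _ h(1)]) (use nm in auto)
    then show ?thesis unfolding k_def o_def by (intro holomorphic_intros) auto
  qed
  moreover have "cmod (k \<xi>) < 1" if "cmod \<xi> < 1" for \<xi>
  proof -
    have "h x \<in> ball 0 1" if "x \<in> ball 0 1" for x using h(2) that by blast
    from this[of "?m \<xi>"] this[of a] have "cmod (h (?m \<xi>)) < 1" "cmod (h a) < 1"
      using nm[OF that] ab(1) by auto
    then show ?thesis using norm_triangle_ineq4[of "h (?m \<xi>)" "h a"] by (simp add: k_def norm_divide)
  qed
  ultimately have "cmod (k \<zeta>) \<le> cmod \<zeta>"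
    by (intro Schwarz_Lemma(1)[OF _ _ _ \<zeta>]) (assumption | simp add: k_def m0)+
  also have "cmod \<zeta> = cmod ((a - b) / (1 - cnj a * b))"
    by (simp add: \<zeta>_def Moebius_function_simple norm_divide norm_minus_commute)
  also have "\<dots> \<le> poincare_dist a b"
    unfolding poincare_dist_def by (intro artanh_ge_self pseudo_hyperbolic_less_1 ab) simp
  finally show ?thesis by (simp add: k_def m\<zeta> norm_divide norm_minus_commute)
qed

section \<open>Distances defined as infima of lengths\<close>

text \<open>\<open>P z w L\<close> stands for an admissible connection from \<open>z\<close> to
  \<open>w\<close> of length \<open>L\<close>: a chain of discs or a path. The metric axioms follow
  from reversal, concatenation and the lower bound; \<open>ex\<close> keeps \<open>Inf\<close> away
  from the empty set.\<close>

lemma hhr_metric_completeI: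
  fixes D :: "(complex ^ 'n) set" and P :: "complex ^ 'n \<Rightarrow> complex ^ 'n \<Rightarrow> real \<Rightarrow> bool"
  assumes hhr: "holomorphic_homogeneous_regular D"
    and d: "\<And>z w. d z w = (if z \<in> D \<and> w \<in> D then Inf {L. P z w L} else 0)"
    and nonneg: "\<And>z w L. z \<in> D \<Longrightarrow> w \<in> D \<Longrightarrow> P z w L \<Longrightarrow> 0 \<le> L"
    and commute: "\<And>z w L. z \<in> D \<Longrightarrow> w \<in> D \<Longrightarrow> P z w L \<Longrightarrow> P w z L"
    and trans: "\<And>x y z L M. x \<in> D \<Longrightarrow> y \<in> D \<Longrightarrow> z \<in> D \<Longrightarrow> P x y L \<Longrightarrow> P y z M \<Longrightarrow> P x z (L + M)"
    and ex: "\<And>z w. z \<in> D \<Longrightarrow> w \<in> D \<Longrightarrow> \<exists>L. P z w L"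
    and lower: "\<And>\<phi> z w L. holomorphic_fun_on \<phi> D \<Longrightarrow> \<phi> ` D \<subseteq> ball 0 1 \<Longrightarrow> z \<in> D \<Longrightarrow> w \<in> D \<Longrightarrow>
                  P z w L \<Longrightarrow> cmod (\<phi> z - \<phi> w) \<le> 2 * L"
    and upper: "\<And>q e. q \<in> D \<Longrightarrow> e > 0 \<Longrightarrow> \<exists>\<delta>>0. \<forall>z. dist z q < \<delta> \<longrightarrow> z \<in> D \<and> (\<exists>L<e. P z q L)"
  shows "Metric_space D d \<and> Metric_space.mcomplete D d"
proof -
  have dD: "d z w = Inf {L. P z w L}" if "z \<in> D" "w \<in> D" for z w using that d by simp
  have le: "d z w \<le> L" if "z \<in> D" "w \<in> D" "P z w L" for z w L
    unfolding dD[OF that(1,2)] by (intro cInf_lower bdd_belowI[of _ 0]) (use that nonneg in auto)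
  have ge: "C \<le> d z w" if "z \<in> D" "w \<in> D" "\<And>L. P z w L \<Longrightarrow> C \<le> L" for z w C
    unfolding dD[OF that(1,2)] by (intro cInf_greatest) (use that ex in auto)
  have low: "cmod (\<phi> z - \<phi> w) \<le> 2 * d z w"
    if "holomorphic_fun_on \<phi> D" "\<phi> ` D \<subseteq> ball 0 1" "z \<in> D" "w \<in> D" for \<phi> z w
  proof -
    have "cmod (\<phi> z - \<phi> w) / 2 \<le> d z w"
      by (rule ge[OF that(3,4)]) (use lower[OF that] in fastforce)
    then show ?thesis by simp
  qed
  have up: "\<exists>\<delta>>0. \<forall>z. dist z q < \<delta> \<longrightarrow> z \<in> D \<and> d z q < e" if q: "q \<in> D" and e: "e > 0" for q e
    using upper[OF q e] le[OF _ q] by (meson le_less_trans)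
  have M: "Metric_space D d"
  proof
    show "0 \<le> d z w" for z w
    proof (cases "z \<in> D \<and> w \<in> D")
      case True
      then show ?thesis by (intro ge) (auto intro: nonneg)
    next
      case False
      then show ?thesis using d by auto
    qed
    then have nn: "0 \<le> d z w" for z w .
    show "d z w = d w z" for z w
    proof (cases "z \<in> D \<and> w \<in> D")
      case True
      then have "{L. P z w L} = {L. P w z L}" using commute by blast
      then show ?thesis using d by simp
    next
      case False
      then show ?thesis using d by auto
    qed
    show "d z w = 0 \<longleftrightarrow> z = w" if z: "z \<in> D" and w: "w \<in> D" for z w
    proof
      assume "d z w = 0"
      show "z = w"
      proof (rule ccontr)
        assume "z \<noteq> w"
        moreover have "bounded D" using hhr by (simp add: holomorphic_homogeneous_regular_def)
        ultimately obtain \<phi> where "holomorphic_fun_on \<phi> D" "\<phi> ` D \<subseteq> ball 0 1" "\<phi> z \<noteq> \<phi> w"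
          using bounded_points_separated by blast
        then show False using low[of \<phi> z w] z w \<open>d z w = 0\<close> by simp
      qed
    next
      assume "z = w"
      \<comment> \<open>\<open>upper\<close> at the point itself provides connections from
        \<open>z\<close> to \<open>z\<close> of arbitrarily small length.\<close>
      have "d z z < e" if "e > 0" for e
        using up[OF z that] by (metis dist_self)
      then show "d z w = 0" using nn[of z z] \<open>z = w\<close> by (metis less_irrefl order_less_le)
    qed
    show "d x z \<le> d x y + d y z" if x: "x \<in> D" and y: "y \<in> D" and z: "z \<in> D" for x y z
    proof -
      \<comment> \<open>The infimum over the second leg is taken with the first leg fixed; the
        infimum over the first leg follows.\<close>
      have "d x z - L \<le> d y z" if L: "P x y L" for L
        by (rule ge[OF y z]) (use le[OF x z trans[OF x y z L]] in force)
      then have "d x z - d y z \<le> d x y" by (intro ge[OF x y]) force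
      then show ?thesis by simp
    qed
  qed
  show ?thesis using M hhr_mcomplete[OF hhr M low up] by blast
qed

section \<open>Chains of holomorphic discs\<close>

text \<open>The chains of \<open>kobayashi_dist\<close>, grown disc by disc at the far end.
  Concatenation and reversal become inductions, with no reindexing of families of discs.\<close>

inductive disc_chain :: "(complex ^ 'n) set \<Rightarrow> complex ^ 'n \<Rightarrow> complex ^ 'n \<Rightarrow> real \<Rightarrow> bool" for D z where
  disc_chain_refl: "disc_chain D z z 0"
| disc_chain_step: "disc_chain D z w L \<Longrightarrow> holomorphic_disc f D \<Longrightarrow> a \<in> ball 0 1 \<Longrightarrow> b \<in> ball 0 1 \<Longrightarrow>
    f a = w \<Longrightarrow> disc_chain D z (f b) (L + poincare_dist a b)"

text \<open>One inclusion is induction over the prefixes of the given chain; the other appends a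
  disc by updating the families at index \<open>m\<close>.\<close>

lemma disc_chain_eq:
  "{\<Sum>i<m. poincare_dist (a i) (b i) | (m::nat) p f a b.
      p 0 = z \<and> p m = w \<and>
      (\<forall>i<m. holomorphic_disc (f i) D \<and> a i \<in> ball 0 1 \<and> b i \<in> ball 0 1 \<and>
             f i (a i) = p i \<and> f i (b i) = p (Suc i))} = {L. disc_chain D z w L}"
  (is "?A w = _")
proof (intro set_eqI iffI)
  fix L assume "L \<in> ?A w"
  then obtain m p f a b where L: "L = (\<Sum>i<m. poincare_dist (a i) (b i))"
    and p: "p 0 = z" "p m = w" and *: "\<And>i. i < m \<Longrightarrow> holomorphic_disc (f i) D \<and> a i \<in> ball 0 1 \<and>
      b i \<in> ball 0 1 \<and> f i (a i) = p i \<and> f i (b i) = p (Suc i)"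
    by blast
  have "disc_chain D z (p k) (\<Sum>i<k. poincare_dist (a i) (b i))" if "k \<le> m" for k
    using that
  proof (induction k)
    case 0
    then show ?case using p by (auto intro: disc_chain_refl)
  next
    case (Suc k)
    then show ?case using disc_chain_step[of D z "p k" _ "f k" "a k" "b k"] *[of k] by auto
  qed
  then show "L \<in> {L. disc_chain D z w L}" using L p by auto
next
  fix L assume "L \<in> {L. disc_chain D z w L}"
  then have "disc_chain D z w L" by simp
  then show "L \<in> ?A w"
  proof induction
    case disc_chain_refl
    show ?case by (intro CollectI exI[of _ 0] exI[of _ "\<lambda>_. z"]) auto
  next
    case (disc_chain_step w L f a b)
    then obtain m p f' a' b' where L: "L = (\<Sum>i<m. poincare_dist (a' i) (b' i))"
      and p: "p 0 = z" "p m = w" and *: "\<And>i. i < m \<Longrightarrow> holomorphic_disc (f' i) D \<and> a' i \<in> ball 0 1 \<and>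
        b' i \<in> ball 0 1 \<and> f' i (a' i) = p i \<and> f' i (b' i) = p (Suc i)"
      by blast
    show ?case
      by (intro CollectI exI[of _ "Suc m"] exI[of _ "p(Suc m := f b)"] exI[of _ "f'(m := f)"]
          exI[of _ "a'(m := a)"] exI[of _ "b'(m := b)"])
        (use L p * disc_chain_step.hyps in \<open>auto simp: less_Suc_eq\<close>)
  qed
qed

text \<open>The second leg is the first assumption because the induction runs along it.\<close>

lemma disc_chain_trans:
  assumes "disc_chain D y z M" "disc_chain D x y L"
  shows "disc_chain D x z (L + M)"
  using assms
proof induction
  case (disc_chain_step w M f a b)
  then show ?case using disc_chain.disc_chain_step[of D x w "L + M" f a b] by (simp add: add.assoc)
qed simp

lemma disc_chain_commute: "disc_chain D z w L \<Longrightarrow> disc_chain D w z L"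
proof (induction rule: disc_chain.induct)
  case (disc_chain_step w L f a b)
  have "disc_chain D (f b) w (0 + poincare_dist b a)"
    using disc_chain.disc_chain_step[OF disc_chain_refl, of f D b a "f b"] disc_chain_step.hyps by simp
  then show ?case
    using disc_chain_trans[OF disc_chain_step.IH, of "f b" "poincare_dist b a"]
    by (simp add: poincare_dist_commute[of b] add.commute)
qed (rule disc_chain_refl)

lemma disc_chain_nonneg: "disc_chain D z w L \<Longrightarrow> 0 \<le> L"
  by (induction rule: disc_chain.induct) (auto intro!: add_nonneg_nonneg poincare_dist_nonneg)

text \<open>A disc is holomorphic coordinate by coordinate; the coordinate derivatives are assembled
  into a vector \<open>v\<close>, and complex linearity of the derivative of \<open>\<phi>\<close>
  turns the real chain rule into a complex derivative.\<close>

lemma holomorphic_disc_compose: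
  fixes f :: "complex \<Rightarrow> complex ^ 'n"
  assumes f: "holomorphic_disc f D" and D: "open D" and \<phi>: "holomorphic_fun_on \<phi> D"
  shows "(\<lambda>\<zeta>. \<phi> (f \<zeta>)) holomorphic_on ball 0 1"
  unfolding holomorphic_on_open[OF open_ball]
proof
  fix s :: complex assume s: "s \<in> ball 0 1"
  have fs: "f s \<in> D" using f s unfolding holomorphic_disc_def by blast
  define v where "v = (\<chi> j. deriv (\<lambda>\<zeta>. f \<zeta> $ j) s)"
  have j: "((\<lambda>\<zeta>. f \<zeta> $ j) has_derivative (\<lambda>h. (h *s v) $ j)) (at s)" for j
    using f s unfolding holomorphic_disc_def v_def vector_smult_component vec_lambda_beta
    by (metis (no_types, lifting) ext has_field_derivative_def holomorphic_derivI mult.commute open_ball)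
  have "(f has_derivative (\<lambda>h. h *s v)) (at s)"
    unfolding has_derivative_componentwise_within[where f = f]
  proof
    fix e :: "complex ^ 'n" assume "e \<in> Basis"
    then obtain j u where "e = axis j u" by (auto simp: Basis_vec_def)
    then show "((\<lambda>x. f x \<bullet> e) has_derivative (\<lambda>h. (h *s v) \<bullet> e)) (at s)"
      by (simp only: inner_axis) (rule has_derivative_inner_left[OF j])
  qed
  from has_derivative_compose[OF this holomorphic_fun_on_dird(1)[OF \<phi> D fs]]
  have "((\<lambda>\<zeta>. \<phi> (f \<zeta>)) has_derivative (\<lambda>h. dird v \<phi> (f s) * h)) (at s)"
    by (simp add: holomorphic_fun_on_dird(2)[OF \<phi> D fs] mult.commute)
  then show "\<exists>f'. ((\<lambda>\<zeta>. \<phi> (f \<zeta>)) has_field_derivative f') (at s)"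
    unfolding has_field_derivative_def by blast
qed

lemma disc_chain_lower:
  assumes "disc_chain D z w L" and D: "open D" "holomorphic_fun_on \<phi> D" "\<phi> ` D \<subseteq> ball 0 1"
  shows "cmod (\<phi> z - \<phi> w) \<le> 2 * L"
  using assms(1)
proof induction
  case (disc_chain_step w L f a b)
  have "cmod (\<phi> (f a) - \<phi> (f b)) \<le> 2 * poincare_dist a b"
    by (rule poincare_dist_lower[OF holomorphic_disc_compose[OF disc_chain_step.hyps(2) D(1,2)]])
      (use disc_chain_step.hyps D(3) in \<open>auto simp: holomorphic_disc_def image_subset_iff\<close>)
  then show ?case
    using disc_chain_step.IH disc_chain_step.hyps norm_triangle_ineq[of "\<phi> z - \<phi> w" "\<phi> (f a) - \<phi> (f b)"]
    by simp
qed simp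

lemma disc_chain_local:
  fixes q :: "complex ^ 'n"
  assumes r: "r > 0" "ball q r \<subseteq> D" and z: "dist z q < r"
  shows "disc_chain D z q (artanh (dist z q / r))"
proof (cases "z = q")
  case True
  then show ?thesis by (simp add: disc_chain_refl)
next
  case False
  \<comment> \<open>Scaled to norm \<open>r\<close>, so that the affine disc
    \<open>q + \<zeta> *s v\<close> fills a radius of the ball and passes through \<open>z\<close>
    at parameter \<open>dist z q / r\<close>.\<close>
  define v where "v = (r / dist z q) *\<^sub>R (z - q)"
  define f where "f \<zeta> = q + \<zeta> *s v" for \<zeta>
  define a where "a = complex_of_real (dist z q / r)"
  have v: "norm v = r" using False r by (simp add: v_def dist_norm)
  have "holomorphic_disc f D" unfolding holomorphic_disc_def
  proof
    show "\<forall>j. (\<lambda>\<zeta>. f \<zeta> $ j) holomorphic_on ball 0 1"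
      unfolding f_def vector_add_component vector_smult_component by (intro allI holomorphic_intros)
    have "f \<zeta> \<in> ball q r" if "\<zeta> \<in> ball 0 1" for \<zeta>
      using that r by (simp add: f_def dist_norm norm_vector_scalar_mult v)
    then show "f ` ball 0 1 \<subseteq> D" using r by blast
  qed
  moreover have "f a = z"
    unfolding f_def a_def of_real_vector_scalar_mult v_def using False r by simp
  moreover have "f 0 = q" by (simp add: f_def)
  moreover have "a \<in> ball 0 1" using r z by (simp add: a_def norm_divide)
  ultimately have "disc_chain D z (f 0) (0 + poincare_dist a 0)"
    by (intro disc_chain_step[OF disc_chain_refl]) auto
  also have "poincare_dist a 0 = artanh (dist z q / r)"
    using r by (simp add: poincare_dist_def a_def norm_divide)
  finally show ?thesis using \<open>f 0 = q\<close> by simp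
qed

lemma kobayashi_complete:
  fixes D :: "(complex ^ 'n) set"
  assumes hhr: "holomorphic_homogeneous_regular D"
  shows "Metric_space D (kobayashi_dist D) \<and> Metric_space.mcomplete D (kobayashi_dist D)"
proof (rule hhr_metric_completeI[OF hhr, where P = "disc_chain D"])
  have D: "open D" "connected D"
    using hhr by (auto simp: holomorphic_homogeneous_regular_def Cn_domain_def)
  show "kobayashi_dist D z w = (if z \<in> D \<and> w \<in> D then Inf {L. disc_chain D z w L} else 0)" for z w
    unfolding kobayashi_dist_def disc_chain_eq ..
  show up: "\<exists>\<delta>>0. \<forall>z. dist z q < \<delta> \<longrightarrow> z \<in> D \<and> (\<exists>L<e. disc_chain D z q L)"
    if q: "q \<in> D" and e: "e > 0" for q e
  proof -
    obtain r where r: "r > 0" "ball q r \<subseteq> D" using D(1) q openE by blast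
    have "((\<lambda>x. artanh (x / r)) \<longlongrightarrow> artanh (0 / r)) (at_right 0)"
      by (intro tendsto_intros) (use r in auto)
    then have "\<forall>\<^sub>F x in at_right 0. artanh (x / r) < e"
      using e by (auto dest: order_tendstoD(2))
    then obtain \<delta> where \<delta>: "\<delta> > 0" "\<And>x. 0 < x \<Longrightarrow> x < \<delta> \<Longrightarrow> artanh (x / r) < e"
      unfolding eventually_at_right[OF zero_less_one] by blast
    show ?thesis
    proof (rule exI[of _ "min \<delta> r"], intro conjI allI impI)
      fix z assume z: "dist z q < min \<delta> r"
      then show "z \<in> D" using r(2) by (auto simp: dist_commute)
      have "artanh (dist z q / r) < e" using \<delta>(2)[of "dist z q"] z e by (cases "z = q") auto
      then show "\<exists>L<e. disc_chain D z q L" using disc_chain_local[OF r, of z] z by auto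
    qed (use r \<delta> in auto)
  qed
  \<comment> \<open>Being joined by a chain is an equivalence relation whose classes are open, so
    the connected set \<open>D\<close> is a single class.\<close>
  show "\<exists>L. disc_chain D z w L" if zw: "z \<in> D" "w \<in> D" for z w
  proof (rule connected_equivalence_relation[where R = "\<lambda>z w. \<exists>L. disc_chain D z w L", OF D(2) zw])
    fix q assume q: "q \<in> D"
    obtain \<delta> where \<delta>: "\<delta> > 0" "\<And>z. dist z q < \<delta> \<Longrightarrow> z \<in> D \<and> (\<exists>L<1. disc_chain D z q L)"
      using up[OF q zero_less_one] by blast
    have "ball q \<delta> \<subseteq> D" "\<forall>x\<in>ball q \<delta>. \<exists>L. disc_chain D q x L"
      using \<delta>(2) disc_chain_commute by (auto simp: dist_commute) blast
    then show "\<exists>T. openin (top_of_set D) T \<and> q \<in> T \<and> (\<forall>x\<in>T. \<exists>L. disc_chain D q x L)"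
      using \<delta>(1) by (intro exI[of _ "ball q \<delta>"]) (auto intro: open_subset)
  qed (use disc_chain_commute disc_chain_trans in blast)+
  show "cmod (\<phi> z - \<phi> w) \<le> 2 * L"
    if "holomorphic_fun_on \<phi> D" "\<phi> ` D \<subseteq> ball 0 1" "disc_chain D z w L" for \<phi> z w L
    using disc_chain_lower[OF that(3) D(1) that(1,2)] .
qed (rule disc_chain_nonneg disc_chain_commute disc_chain_trans; assumption)+

subsection \<open>The sub-mean-value property on balls\<close>

text \<open>Translations and the reflection \<open>c = -1\<close>, where the Jacobian factor is 1;
  both occur in the proof of invariance under isometries.\<close>

lemma nn_integral_lborel_affine:
  fixes f :: "'a::euclidean_space \<Rightarrow> ennreal"
  assumes f: "f \<in> borel_measurable borel" and c: "\<bar>c\<bar> = 1"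
  shows "(\<integral>\<^sup>+x. f (t + c *\<^sub>R x) \<partial>lborel) = (\<integral>\<^sup>+x. f x \<partial>lborel)"
proof -
  have "(\<integral>\<^sup>+x. f x \<partial>lborel) = (\<integral>\<^sup>+x. f x \<partial>density (distr lborel borel (\<lambda>x. t + c *\<^sub>R x)) (\<lambda>_. \<bar>c\<bar> ^ DIM('a)))"
    using c by (subst lborel_affine[of c t]) auto
  also have "\<dots> = (\<integral>\<^sup>+x. f (t + c *\<^sub>R x) \<partial>lborel)"
    using f c by (simp add: nn_integral_density nn_integral_distr)
  finally show ?thesis ..
qed

text \<open>The uniqueness argument for Haar measure: the image measure under \<open>T\<close> is translation
  invariant, and it agrees with Lebesgue measure on the unit ball.\<close>

lemma nn_integral_lborel_isometry:
  fixes f :: "'a::euclidean_space \<Rightarrow> ennreal"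
    and T :: "'a \<Rightarrow> 'a"
  assumes f [measurable]: "f \<in> borel_measurable borel"
    and T: "linear T" "\<And>x. norm (T x) = norm x"
  shows "(\<integral>\<^sup>+x. f (T x) \<partial>lborel) = (\<integral>\<^sup>+x. f x \<partial>lborel)"
proof -
  have [measurable]: "T \<in> borel_measurable borel"
    using T(1) by (intro borel_measurable_continuous_onI linear_continuous_on)
      (simp add: linear_conv_bounded_linear)
  have "inj T" using T by (metis linear_injective_0 norm_eq_zero)
  then have "surj T" by (rule linear_inj_imp_surj[OF T(1)])
  define g :: "'a \<Rightarrow> ennreal" where "g = indicator (ball 0 1)"
  have g [measurable]: "g \<in> borel_measurable borel" unfolding g_def by (rule borel_measurable_indicator[OF borel_open[OF open_ball]])
  have gT: "g (T x) = g x" for x by (simp add: g_def indicator_def T(2))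
  have "(\<integral>\<^sup>+x. f (T x) \<partial>lborel) * (\<integral>\<^sup>+y. g y \<partial>lborel) =
      (\<integral>\<^sup>+x. (\<integral>\<^sup>+y. f (T x) * g y \<partial>lborel) \<partial>lborel)"
    by (simp add: nn_integral_cmult nn_integral_multc)
  \<comment> \<open>Shifting \<open>y\<close> by \<open>T x\<close> puts both variables into
    \<open>g\<close>. After exchanging the integrals, shifting \<open>x\<close> by
    \<open>- y'\<close> with \<open>T y' = y\<close> moves \<open>y\<close> from \<open>g\<close> to
    \<open>f\<close>, and the integral over \<open>y\<close> then no longer sees
    \<open>T\<close>.\<close>
  also have "\<dots> = (\<integral>\<^sup>+x. (\<integral>\<^sup>+y. f (T x) * g (T x + 1 *\<^sub>R y) \<partial>lborel) \<partial>lborel)"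
    by (intro nn_integral_cong nn_integral_lborel_affine[symmetric]) auto
  also have "\<dots> = (\<integral>\<^sup>+y. (\<integral>\<^sup>+x. f (T x) * g (T x + 1 *\<^sub>R y) \<partial>lborel) \<partial>lborel)"
    by (rule lborel_pair.Fubini'[symmetric]) measurable
  also have "\<dots> = (\<integral>\<^sup>+y. (\<integral>\<^sup>+x. f (T x - y) * g (T x) \<partial>lborel) \<partial>lborel)"
  proof (rule nn_integral_cong)
    fix y :: 'a
    obtain y' where y': "T y' = y" using \<open>surj T\<close> by (metis surjD)
    have "(\<integral>\<^sup>+x. f (T x) * g (T x + 1 *\<^sub>R y) \<partial>lborel) =
        (\<integral>\<^sup>+x. f (T (- y' + 1 *\<^sub>R x)) * g (T (- y' + 1 *\<^sub>R x) + 1 *\<^sub>R y) \<partial>lborel)"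
      by (rule nn_integral_lborel_affine[symmetric]) auto
    then show "(\<integral>\<^sup>+x. f (T x) * g (T x + 1 *\<^sub>R y) \<partial>lborel) = (\<integral>\<^sup>+x. f (T x - y) * g (T x) \<partial>lborel)"
      by (simp add: linear_add[OF T(1)] linear_neg[OF T(1)] y' linear_diff[OF T(1)])
  qed
  also have "\<dots> = (\<integral>\<^sup>+x. (\<integral>\<^sup>+y. f (T x - y) * g (T x) \<partial>lborel) \<partial>lborel)"
    by (rule lborel_pair.Fubini') measurable
  also have "\<dots> = (\<integral>\<^sup>+x. (\<integral>\<^sup>+y. f y \<partial>lborel) * g x \<partial>lborel)"
  proof (rule nn_integral_cong)
    fix x :: 'a
    have "(\<integral>\<^sup>+y. f (T x + (-1) *\<^sub>R y) \<partial>lborel) = (\<integral>\<^sup>+y. f y \<partial>lborel)"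
      by (rule nn_integral_lborel_affine) auto
    then show "(\<integral>\<^sup>+y. f (T x - y) * g (T x) \<partial>lborel) = (\<integral>\<^sup>+y. f y \<partial>lborel) * g x"
      by (simp add: nn_integral_multc gT)
  qed
  also have "\<dots> = (\<integral>\<^sup>+y. f y \<partial>lborel) * (\<integral>\<^sup>+x. g x \<partial>lborel)"
    by (simp add: nn_integral_cmult)
  finally have eq: "(\<integral>\<^sup>+x. f (T x) \<partial>lborel) * emeasure lborel (ball (0::'a) 1) =
      (\<integral>\<^sup>+y. f y \<partial>lborel) * emeasure lborel (ball (0::'a) 1)"
    by (simp add: g_def)
  have "emeasure lborel (ball (0::'a) 1) \<noteq> 0"
    using content_ball_pos[of 1 "0::'a"] by (auto simp: measure_def)
  moreover have "emeasure lborel (ball (0::'a) 1) \<noteq> \<infinity>"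
    using emeasure_lborel_ball_finite[of "0::'a" 1] by simp
  ultimately show ?thesis using eq by (simp add: ennreal_mult_cancel_left mult.commute[of _ "emeasure lborel (ball 0 1)"])
qed

text \<open>Cauchy's formula at the centre of the unit circle, parametrized over
  \<open>{0..1}\<close>. The form with a nonnegative integral lets Tonelli's theorem apply
  afterwards.\<close>

lemma holomorphic_mean_value_bound:
  assumes g: "g holomorphic_on cball 0 1"
  shows "ennreal (cmod (g 0)) \<le>
    (\<integral>\<^sup>+t. indicator {0..1} t * ennreal (cmod (g (exp (2 * of_real pi * \<i> * of_real t)))) \<partial>lborel)"
proof -
  let ?h = "\<lambda>t::real. g (exp (2 * of_real pi * \<i> * of_real t))"
  have "((\<lambda>u. g u / (u - 0)) has_contour_integral (2 * of_real pi * \<i> * g 0)) (circlepath 0 1)"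
    by (rule Cauchy_integral_circlepath_simple[OF g]) simp
  then have "((\<lambda>t. ?h t / exp (2 * of_real pi * \<i> * of_real t) *
      (2 * of_real pi * \<i> * exp (2 * of_real pi * \<i> * of_real t))) has_integral (2 * of_real pi * \<i> * g 0)) {0..1}"
    unfolding has_contour_integral_def
    by (rule has_integral_eq[rotated])
      (simp only: atLeastAtMost_iff vector_derivative_circlepath01, simp add: circlepath)
  then have "((\<lambda>t. (2 * of_real pi * \<i>) * ?h t) has_integral (2 * of_real pi * \<i>) * g 0) {0..1}"
    by (simp add: mult_ac)
  then have hi: "(?h has_integral g 0) {0..1}"
    by (simp add: has_integral_mult_right_iff)
  have cont: "continuous_on {0..1} ?h"
    by (rule continuous_on_compose2[OF holomorphic_on_imp_continuous_on[OF g]])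
      (auto intro!: continuous_intros simp: norm_exp_eq_Re)
  then have si: "set_integrable lborel {0..1} ?h"
    by (intro borel_integrable_atLeastAtMost') 
  have "g 0 = (LINT t:{0..1}|lborel. ?h t)"
    using set_borel_integral_eq_integral(2)[OF si] hi by (simp add: integral_unique)
  then have "ennreal (cmod (g 0)) \<le> (\<integral>\<^sup>+t. norm (indicat_real {0..1} t *\<^sub>R ?h t) \<partial>lborel)"
    using integral_norm_bound_ennreal[OF si[unfolded set_integrable_def]]
    by (simp add: set_lebesgue_integral_def)
  also have "\<dots> = (\<integral>\<^sup>+t. indicator {0..1} t * ennreal (cmod (?h t)) \<partial>lborel)"
    by (intro nn_integral_cong) (auto simp: indicator_def)
  finally show ?thesis .
qed

text \<open>For each \<open>x\<close> with \<open>norm x < r\<close> the circle of points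
  \<open>z + E t *s x\<close> gives a one-variable mean value bound. Integrate over \<open>x\<close>
  and exchange integrals: for fixed \<open>t\<close>, multiplication by the unit scalar
  \<open>E t\<close> is an isometry and preserves the integral over \<open>x\<close>, so the average
  over \<open>t\<close> disappears.\<close>

lemma holomorphic_fun_mean_value_bound:
  fixes f :: "complex ^ 'n \<Rightarrow> complex"
  assumes f: "holomorphic_fun_on f (ball z r)"
  shows "ennreal (cmod (f z)) * emeasure lborel (ball z r) \<le>
    (\<integral>\<^sup>+x. indicator (ball z r) x * ennreal (cmod (f x)) \<partial>lborel)"
proof -
  \<comment> \<open>The indicator makes the integrand Borel on the whole space, though
    \<open>f\<close> is continuous only on the ball.\<close>
  define h where "h x = indicator (ball z r) x * ennreal (cmod (f x))" for x
  define E where "E t = exp (2 * of_real pi * \<i> * of_real t)" for t :: real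
  have E: "cmod (E t) = 1" for t by (simp add: E_def norm_exp_eq_Re)
  have "(\<lambda>x. indicator (ball z r) x *\<^sub>R f x) \<in> borel_measurable borel"
    by (intro borel_measurable_continuous_on_indicator holomorphic_fun_on_imp_continuous_on[OF f]) simp
  then have "(\<lambda>x. ennreal (cmod (indicator (ball z r) x *\<^sub>R f x))) \<in> borel_measurable borel"
    by measurable
  also have "(\<lambda>x. ennreal (cmod (indicator (ball z r) x *\<^sub>R f x))) = h"
    by (auto simp: h_def indicator_def)
  finally have h [measurable]: "h \<in> borel_measurable borel" .
  have cont: "continuous_on UNIV (\<lambda>(x::complex ^ 'n, t). z + E t *s x)"
    unfolding E_def case_prod_beta vector_scalar_mult_def
    by (intro continuous_intros)
  have [measurable]: "(\<lambda>(x, t). z + E t *s x) \<in> borel_measurable (lborel \<Otimes>\<^sub>M lborel)"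
    using borel_measurable_continuous_onI[OF cont] by (simp add: lborel_prod)
  have "ennreal (cmod (f z)) * emeasure lborel (ball z r) =
      (\<integral>\<^sup>+x. ennreal (cmod (f z)) * indicator (ball z r) x \<partial>lborel)"
    by (simp add: nn_integral_cmult_indicator)
  also have "\<dots> = (\<integral>\<^sup>+x. ennreal (cmod (f z)) * indicator (ball z r) (z + 1 *\<^sub>R x) \<partial>lborel)"
    by (rule nn_integral_lborel_affine[symmetric]) (measurable, auto)
  also have "\<dots> \<le> (\<integral>\<^sup>+x. (\<integral>\<^sup>+t. indicator {0..1} t * h (z + E t *s x) \<partial>lborel) \<partial>lborel)"
  proof (rule nn_integral_mono)
    fix x :: "complex ^ 'n"
    show "ennreal (cmod (f z)) * indicator (ball z r) (z + 1 *\<^sub>R x) \<le>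
        (\<integral>\<^sup>+t. indicator {0..1} t * h (z + E t *s x) \<partial>lborel)"
    proof (cases "norm x < r")
      case True
      have "(\<lambda>s. f (z + s *s x)) holomorphic_on cball 0 1"
      proof (rule holomorphic_fun_on_slice_holomorphic[OF f open_ball])
        fix s :: complex assume "s \<in> cball 0 1"
        then have "cmod s * norm x \<le> norm x" by (simp add: mult_left_le_one_le)
        then show "z + s *s x \<in> ball z r" using True by (simp add: dist_norm norm_vector_scalar_mult)
      qed
      from holomorphic_mean_value_bound[OF this]
      have "ennreal (cmod (f z)) \<le> (\<integral>\<^sup>+t. indicator {0..1} t * ennreal (cmod (f (z + E t *s x))) \<partial>lborel)"
        by (simp add: E_def)
      also have "\<dots> = (\<integral>\<^sup>+t. indicator {0..1} t * h (z + E t *s x) \<partial>lborel)"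
        using True by (intro nn_integral_cong) (simp add: h_def dist_norm norm_vector_scalar_mult E)
      finally show ?thesis using True by (simp add: dist_norm)
    qed (simp add: dist_norm)
  qed
  also have "\<dots> = (\<integral>\<^sup>+t. (\<integral>\<^sup>+x. indicator {0..1} t * h (z + E t *s x) \<partial>lborel) \<partial>lborel)"
    by (rule lborel_pair.Fubini'[symmetric]) measurable
  also have "\<dots> = (\<integral>\<^sup>+t. indicator {0..1::real} t * (\<integral>\<^sup>+x. h x \<partial>lborel) \<partial>lborel)"
  proof (rule nn_integral_cong)
    fix t :: real
    have "(\<integral>\<^sup>+x. h (z + E t *s x) \<partial>lborel) = (\<integral>\<^sup>+x. h (z + x) \<partial>lborel)"
      by (rule nn_integral_lborel_isometry)
        (auto simp: norm_vector_scalar_mult E linear_iff vec_eq_iff algebra_simps)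
    also have "\<dots> = (\<integral>\<^sup>+x. h x \<partial>lborel)"
      using nn_integral_lborel_affine[of h 1 z] by simp
    finally show "(\<integral>\<^sup>+x. indicator {0..1} t * h (z + E t *s x) \<partial>lborel) =
        indicator {0..1} t * (\<integral>\<^sup>+x. h x \<partial>lborel)"
      by (auto simp: indicator_def)
  qed
  also have "\<dots> = (\<integral>\<^sup>+x. h x \<partial>lborel)"
    by (simp add: nn_integral_multc)
  finally show ?thesis by (simp add: h_def)
qed

subsection \<open>The Bergman space\<close>

locale bounded_domain =
  fixes D :: "(complex ^ 'n) set"
  assumes open_D: "open D" and bounded_D: "bounded D"
begin

definition ip :: "(complex ^ 'n \<Rightarrow> complex) \<Rightarrow> (complex ^ 'n \<Rightarrow> complex) \<Rightarrow> complex" where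
  "ip f g = (LINT z:D|lborel. f z * cnj (g z))"

text \<open>The square of the Bergman norm, not the norm itself; inequalities are kept in squared
  form.\<close>

definition nrm :: "(complex ^ 'n \<Rightarrow> complex) \<Rightarrow> real" where
  "nrm f = (LINT z:D|lborel. (cmod (f z))\<^sup>2)"

lemma bergman_spaceD:
  assumes "f \<in> bergman_space D"
  shows "holomorphic_fun_on f D" "set_integrable lborel D (\<lambda>z. (cmod (f z))\<^sup>2)"
  using assms by (auto simp: bergman_space_def)

lemma set_borel_measurable_continuous:
  fixes f :: "complex ^ 'n \<Rightarrow> 'b::real_normed_vector"
  assumes "continuous_on D f"
  shows "set_borel_measurable lborel D f"
  unfolding set_borel_measurable_def
  using borel_measurable_continuous_on_indicator[OF borel_open[OF open_D] assms] by simp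

lemma bergman_space_I:
  assumes f: "holomorphic_fun_on f D" and g: "set_integrable lborel D g"
    and le: "\<And>z. z \<in> D \<Longrightarrow> (cmod (f z))\<^sup>2 \<le> (g z :: real)"
  shows "f \<in> bergman_space D"
  unfolding bergman_space_def mem_Collect_eq
proof (intro conjI f set_integrable_bound[OF g])
  show "set_borel_measurable lborel D (\<lambda>z. (cmod (f z))\<^sup>2)"
    by (intro set_borel_measurable_continuous continuous_intros holomorphic_fun_on_imp_continuous_on f)
  show "AE x in lborel. x \<in> D \<longrightarrow> norm ((cmod (f x))\<^sup>2) \<le> norm (g x)"
    using le by (intro AE_I2) force
qed

lemma bergman_space_const: "(\<lambda>_. c) \<in> bergman_space D"
proof (rule bergman_space_I[OF holomorphic_fun_on_const])
  have "emeasure lborel D < \<infinity>" using bounded_D by (rule emeasure_bounded_finite)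
  then show "set_integrable lborel D (\<lambda>_. (cmod c)\<^sup>2)"
    unfolding set_integrable_def by (intro integrable_scaleR_left integrable_real_indicator borel_open open_D)
      (use open_D in auto)
qed simp

lemma bergman_space_cmult:
  assumes f: "f \<in> bergman_space D"
  shows "(\<lambda>z. c * f z) \<in> bergman_space D"
proof (rule bergman_space_I)
  show "holomorphic_fun_on (\<lambda>z. c * f z) D" by (rule holomorphic_fun_on_cmult[OF bergman_spaceD(1)[OF f]])
  show "set_integrable lborel D (\<lambda>z. (cmod c)\<^sup>2 * (cmod (f z))\<^sup>2)"
    using bergman_spaceD(2)[OF f] by (rule set_integrable_mult_right)
qed (simp add: norm_mult power_mult_distrib)

lemma bergman_space_add:
  assumes f: "f \<in> bergman_space D" and g: "g \<in> bergman_space D"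
  shows "(\<lambda>z. f z + g z) \<in> bergman_space D"
proof (rule bergman_space_I)
  show "holomorphic_fun_on (\<lambda>z. f z + g z) D"
    by (intro holomorphic_fun_on_add bergman_spaceD f g)
  show "set_integrable lborel D (\<lambda>z. 2 * (cmod (f z))\<^sup>2 + 2 * (cmod (g z))\<^sup>2)"
    by (intro set_integral_add set_integrable_mult_right bergman_spaceD f g)
  fix z
  have "(cmod (f z + g z))\<^sup>2 \<le> (cmod (f z) + cmod (g z))\<^sup>2"
    by (intro power_mono norm_triangle_ineq) simp
  also have "\<dots> \<le> 2 * (cmod (f z))\<^sup>2 + 2 * (cmod (g z))\<^sup>2"
    using sum_squares_bound[of "cmod (f z)" "cmod (g z)"] by (simp add: power2_sum)
  finally show "(cmod (f z + g z))\<^sup>2 \<le> 2 * (cmod (f z))\<^sup>2 + 2 * (cmod (g z))\<^sup>2" .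
qed

lemma bergman_space_diff:
  assumes f: "f \<in> bergman_space D" and g: "g \<in> bergman_space D"
  shows "(\<lambda>z. f z - g z) \<in> bergman_space D"
  using bergman_space_add[OF f bergman_space_cmult[OF g, of "-1"]] by simp

lemma bergman_space_mult_bounded:
  assumes f: "f \<in> bergman_space D" and h: "holomorphic_fun_on h D" "\<And>z. z \<in> D \<Longrightarrow> cmod (h z) \<le> M"
  shows "(\<lambda>z. h z * f z) \<in> bergman_space D" "nrm (\<lambda>z. h z * f z) \<le> M\<^sup>2 * nrm f"
proof -
  have le: "(cmod (h z * f z))\<^sup>2 \<le> M\<^sup>2 * (cmod (f z))\<^sup>2" if "z \<in> D" for z
    using h(2)[OF that] by (simp add: norm_mult power_mult_distrib mult_right_mono power_mono)
  have int: "set_integrable lborel D (\<lambda>z. M\<^sup>2 * (cmod (f z))\<^sup>2)"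
    using bergman_spaceD(2)[OF f] by (rule set_integrable_mult_right)
  show A: "(\<lambda>z. h z * f z) \<in> bergman_space D"
    by (rule bergman_space_I[OF holomorphic_fun_on_mult[OF h(1) bergman_spaceD(1)[OF f]] int le])
  have "nrm (\<lambda>z. h z * f z) \<le> (LINT z:D|lborel. M\<^sup>2 * (cmod (f z))\<^sup>2)"
    unfolding nrm_def by (rule set_integral_mono[OF bergman_spaceD(2)[OF A] int le])
  then show "nrm (\<lambda>z. h z * f z) \<le> M\<^sup>2 * nrm f" by (simp add: nrm_def)
qed

lemma ip_integrable:
  assumes f: "f \<in> bergman_space D" and g: "g \<in> bergman_space D"
  shows "set_integrable lborel D (\<lambda>z. f z * cnj (g z))"
proof (rule set_integrable_bound)
  show "set_integrable lborel D (\<lambda>z. (cmod (f z))\<^sup>2 + (cmod (g z))\<^sup>2)"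
    by (intro set_integral_add bergman_spaceD f g)
  show "set_borel_measurable lborel D (\<lambda>z. f z * cnj (g z))"
    by (intro set_borel_measurable_continuous continuous_intros
        holomorphic_fun_on_imp_continuous_on bergman_spaceD f g)
  have "cmod (f z) * cmod (g z) \<le> (cmod (f z))\<^sup>2 + (cmod (g z))\<^sup>2" for z
  proof -
    have "0 \<le> cmod (f z) * cmod (g z)" by simp
    then show ?thesis using sum_squares_bound[of "cmod (f z)" "cmod (g z)"] by linarith
  qed
  then show "AE x in lborel. x \<in> D \<longrightarrow> norm (f x * cnj (g x)) \<le> norm ((cmod (f x))\<^sup>2 + (cmod (g x))\<^sup>2)"
    by (intro AE_I2) (auto simp: norm_mult)
qed

lemma ip_cmult: "ip (\<lambda>z. c * f z) g = c * ip f g"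
  unfolding ip_def mult.assoc by (rule set_integral_mult_right)

lemma ip_cnj: "cnj (ip f g) = ip g f"
proof -
  have "cnj (ip f g) = (LINT z:D|lborel. cnj (f z * cnj (g z)))"
    unfolding ip_def set_lebesgue_integral_def Bochner_Integration.integral_cnj[symmetric] by (simp add: scaleR_conv_of_real)
  then show ?thesis by (simp add: ip_def mult.commute)
qed

lemma ip_diff:
  assumes "f \<in> bergman_space D" "g \<in> bergman_space D" "h \<in> bergman_space D"
  shows "ip (\<lambda>z. f z - g z) h = ip f h - ip g h"
  unfolding ip_def left_diff_distrib by (intro set_integral_diff ip_integrable assms)

lemma ip_right:
  "ip f (\<lambda>z. c * g z) = cnj c * ip f g"
  "f \<in> bergman_space D \<Longrightarrow> g \<in> bergman_space D \<Longrightarrow> h \<in> bergman_space D \<Longrightarrow>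
    ip f (\<lambda>z. g z - h z) = ip f g - ip f h"
  using ip_cmult[of c g f] ip_diff[of g h f] by (metis complex_cnj_mult complex_cnj_diff ip_cnj)+

lemma ip_self: "ip f f = of_real (nrm f)"
proof -
  have "ip f f = (LINT z:D|lborel. of_real ((cmod (f z))\<^sup>2))"
    unfolding ip_def by (simp only: complex_norm_square)
  also have "\<dots> = of_real (nrm f)" unfolding nrm_def
    by (rule set_integral_complex_of_real)
  finally show ?thesis .
qed

lemma nrm_nonneg: "0 \<le> nrm f"
  unfolding nrm_def set_lebesgue_integral_def by (rule Bochner_Integration.integral_nonneg) (simp add: indicator_def)

lemma nrm_cmult: "nrm (\<lambda>z. c * f z) = (cmod c)\<^sup>2 * nrm f"
  by (simp add: nrm_def norm_mult power_mult_distrib)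

lemma nrm_diff_cmult:
  assumes f: "f \<in> bergman_space D" and g: "g \<in> bergman_space D"
  shows "nrm (\<lambda>z. f z - c * g z) = nrm f - 2 * Re (cnj c * ip f g) + (cmod c)\<^sup>2 * nrm g"
proof -
  note cg = bergman_space_cmult[OF g, of c]
  note fcg = bergman_space_diff[OF f cg]
  have "complex_of_real (nrm (\<lambda>z. f z - c * g z)) = ip f f - cnj c * ip f g - (c * ip g f - c * (cnj c * ip g g))"
    by (simp add: ip_self[symmetric] ip_diff[OF f cg fcg] ip_right(2)[OF f f cg] ip_cmult
        ip_right(2)[OF g f cg] ip_right(1) right_diff_distrib)
  also have "\<dots> = ip f f - (cnj c * ip f g + cnj (cnj c * ip f g)) + (c * cnj c) * ip g g"
    by (simp add: ip_cnj algebra_simps)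
  also have "\<dots> = complex_of_real (nrm f - 2 * Re (cnj c * ip f g) + (cmod c)\<^sup>2 * nrm g)"
    unfolding ip_self complex_add_cnj complex_norm_square[symmetric] by simp
  finally show ?thesis using of_real_eq_iff by blast
qed

lemma nrm_nn_integral:
  assumes f: "f \<in> bergman_space D"
  shows "ennreal (nrm f) = (\<integral>\<^sup>+z. indicator D z * ennreal ((cmod (f z))\<^sup>2) \<partial>lborel)"
proof -
  have "(\<integral>\<^sup>+z. ennreal (indicat_real D z *\<^sub>R (cmod (f z))\<^sup>2) \<partial>lborel) = ennreal (nrm f)"
    unfolding nrm_def set_lebesgue_integral_def
    by (rule nn_integral_eq_integral) (use bergman_spaceD(2)[OF f] in \<open>auto simp: set_integrable_def\<close>)
  moreover have "(\<integral>\<^sup>+z. ennreal (indicat_real D z *\<^sub>R (cmod (f z))\<^sup>2) \<partial>lborel) =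
      (\<integral>\<^sup>+z. indicator D z * ennreal ((cmod (f z))\<^sup>2) \<partial>lborel)"
    by (intro nn_integral_cong) (auto simp: indicator_def)
  ultimately show ?thesis by simp
qed

text \<open>The sub-mean-value bound is applied to the holomorphic function \<open>f * f\<close>,
  whose modulus is the integrand of \<open>nrm\<close>.\<close>

lemma bergman_eval_bound:
  assumes f: "f \<in> bergman_space D" and r: "ball z r \<subseteq> D"
  shows "(cmod (f z))\<^sup>2 * measure lborel (ball z r) \<le> nrm f"
proof -
  have hol: "holomorphic_fun_on (\<lambda>z. f z * f z) (ball z r)"
    by (intro holomorphic_fun_on_mult holomorphic_fun_on_subset[OF bergman_spaceD(1)[OF f] r])
  have "ennreal ((cmod (f z))\<^sup>2 * measure lborel (ball z r)) = ennreal (cmod (f z * f z)) * emeasure lborel (ball z r)"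
    using emeasure_lborel_ball_finite[of z r]
    by (simp add: ennreal_mult' emeasure_eq_ennreal_measure norm_mult power2_eq_square)
  also have "\<dots> \<le> (\<integral>\<^sup>+x. indicator (ball z r) x * ennreal (cmod (f x * f x)) \<partial>lborel)"
    by (rule holomorphic_fun_mean_value_bound[OF hol])
  also have "\<dots> \<le> (\<integral>\<^sup>+x. indicator D x * ennreal ((cmod (f x))\<^sup>2) \<partial>lborel)"
    using r by (intro nn_integral_mono) (auto simp: indicator_def norm_mult power2_eq_square)
  also have "\<dots> = ennreal (nrm f)" by (rule nrm_nn_integral[OF f, symmetric])
  finally show ?thesis by (simp add: nrm_nonneg)
qed

text \<open>Each point of the half ball carries its own ball of radius \<open>r\<close> inside
  \<open>D\<close>, and all these balls have the same volume, so one constant serves them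
  all.\<close>

lemma bergman_locally_bounded:
  assumes "z \<in> D"
  obtains r C where "r > 0" "ball z r \<subseteq> D" "C > 0"
    "\<And>f x. f \<in> bergman_space D \<Longrightarrow> x \<in> ball z r \<Longrightarrow> (cmod (f x))\<^sup>2 \<le> C * nrm f"
proof -
  obtain s where s: "s > 0" "ball z s \<subseteq> D" using assms open_D openE by blast
  define r where "r = s / 2"
  have r: "r > 0" using s by (simp add: r_def)
  have sub: "ball x r \<subseteq> D" if x: "x \<in> ball z r" for x
  proof
    fix y assume "y \<in> ball x r"
    then have "y \<in> ball z s" using x dist_triangle[of z y x] by (simp add: r_def)
    then show "y \<in> D" using s by blast
  qed
  define V where "V = measure lborel (ball (0::complex ^ 'n) r)"
  have V: "V > 0" unfolding V_def by (rule content_ball_pos[OF r])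
  have Vx: "measure lborel (ball x r) = V" for x :: "complex ^ 'n"
    using r by (simp add: V_def content_ball)
  show ?thesis
  proof (rule that[of r "1 / V"])
    show "(cmod (f x))\<^sup>2 \<le> 1 / V * nrm f" if "f \<in> bergman_space D" "x \<in> ball z r" for f x
      using bergman_eval_bound[OF that(1) sub[OF that(2)]] V by (simp add: Vx le_divide_eq)
    show "ball z r \<subseteq> D" using sub[of z] r by simp
  qed (use r V in auto)
qed

lemma bergman_pointwise_bounded:
  assumes "z \<in> D"
  obtains C where "C > 0" "\<And>f. f \<in> bergman_space D \<Longrightarrow> (cmod (f z))\<^sup>2 \<le> C * nrm f"
  using bergman_locally_bounded[OF assms] by (metis centre_in_ball)

text \<open>If \<open>nrm g = 0\<close>, the evaluation bound makes \<open>g\<close> vanish at every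
  point of \<open>D\<close>, not just almost everywhere. Otherwise the multiple of \<open>g\<close>
  nearest to \<open>f\<close> is subtracted from \<open>f\<close>.\<close>

lemma ip_cauchy_schwarz:
  assumes f: "f \<in> bergman_space D" and g: "g \<in> bergman_space D"
  shows "(cmod (ip f g))\<^sup>2 \<le> nrm f * nrm g"
proof (cases "nrm g = 0")
  case True
  have "g z = 0" if "z \<in> D" for z
    using bergman_pointwise_bounded[OF that] g True by (metis mult_zero_right power2_less_eq_zero_iff norm_eq_zero)
  then have "ip f g = (LINT z:D|lborel. 0)"
    unfolding ip_def by (intro set_lebesgue_integral_cong) (use open_D in auto)
  then show ?thesis using True by simp
next
  case False
  then have g0: "nrm g > 0" using nrm_nonneg[of g] by simp
  define c where "c = ip f g / nrm g"
  have "0 \<le> nrm f - 2 * Re (cnj c * ip f g) + (cmod c)\<^sup>2 * nrm g"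
    using nrm_nonneg nrm_diff_cmult[OF f g, of c] by metis
  also have "cnj c * ip f g = complex_of_real ((cmod (ip f g))\<^sup>2 / nrm g)"
    by (simp add: c_def complex_norm_square mult.commute del: of_real_power)
  also have "(cmod c)\<^sup>2 * nrm g = (cmod (ip f g))\<^sup>2 / nrm g"
    using g0 by (simp add: c_def norm_divide power_divide power2_eq_square)
  finally show ?thesis using g0 by (simp add: divide_le_eq)
qed

end

subsection \<open>The Bergman kernel\<close>

context bounded_domain
begin

text \<open>A minimizing sequence is Cauchy in norm by the parallelogram law, hence locally
  uniformly Cauchy; Fatou's lemma shows that its limit is a minimizer.\<close>

lemma bergman_minimizer:
  assumes w: "w \<in> D"
  obtains g where "g \<in> bergman_space D" "g w = 1"
    "\<And>f. f \<in> bergman_space D \<Longrightarrow> f w = 1 \<Longrightarrow> nrm g \<le> nrm f"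
proof -
  define E where "E = {f \<in> bergman_space D. f w = 1}"
  define m where "m = Inf (nrm ` E)"
  have E: "(\<lambda>_. 1) \<in> E" by (simp add: E_def bergman_space_const)
  have m_le: "m \<le> nrm f" if "f \<in> E" for f
    unfolding m_def using that by (intro cInf_lower bdd_belowI2[of _ 0]) (auto simp: nrm_nonneg)
  have "\<exists>f\<in>E. nrm f < m + inverse (real (Suc n))" for n
  proof -
    have "m < m + inverse (real (Suc n))" by simp
    then obtain x where "x \<in> nrm ` E" "x < m + inverse (real (Suc n))"
      unfolding m_def using cInf_lessD[of "nrm ` E"] E by blast
    then show ?thesis by blast
  qed
  then obtain f where fE: "\<And>n. f n \<in> E" and f_less: "\<And>n. nrm (f n) < m + inverse (real (Suc n))"
    by metis
  have fA: "f n \<in> bergman_space D" and fw: "f n w = 1" for n using fE[of n] by (auto simp: E_def)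
  have par: "nrm (\<lambda>z. f n z - f k z) \<le> 2 * (inverse (real (Suc n)) + inverse (real (Suc k)))" for n k
  proof -
    \<comment> \<open>The midpoint again takes the value 1 at \<open>w\<close>, so its squared norm
      is at least \<open>m\<close>; by the parallelogram law the difference must be small.\<close>
    have "(\<lambda>z. (1/2) * (f n z + f k z)) \<in> bergman_space D"
      by (intro bergman_space_cmult bergman_space_add fA)
    then have "(\<lambda>z. (1/2) * (f n z + f k z)) \<in> E"
      by (simp add: E_def fw)
    from m_le[OF this] have "4 * m \<le> nrm (\<lambda>z. f n z - (-1) * f k z)"
      unfolding nrm_cmult by (simp add: norm_divide power_divide)
    also have "\<dots> = nrm (f n) + 2 * Re (ip (f n) (f k)) + nrm (f k)"
      unfolding nrm_diff_cmult[OF fA fA] by simp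
    finally have "4 * m \<le> \<dots>" .
    moreover have "nrm (\<lambda>z. f n z - f k z) = nrm (f n) - 2 * Re (ip (f n) (f k)) + nrm (f k)"
      using nrm_diff_cmult[OF fA fA, of n 1 k] by simp
    ultimately show ?thesis using f_less[of n] f_less[of k] by argo
  qed
  define g where "g z = lim (\<lambda>n. f n z)" for z
  have unif: "\<exists>r>0. ball z r \<subseteq> D \<and> uniform_limit (ball z r) f g sequentially" if z: "z \<in> D" for z
  proof -
    obtain r C where r: "r > 0" "ball z r \<subseteq> D" and C: "C > 0"
      "\<And>f x. f \<in> bergman_space D \<Longrightarrow> x \<in> ball z r \<Longrightarrow> (cmod (f x))\<^sup>2 \<le> C * nrm f"
      using bergman_locally_bounded[OF z] by metis
    have "uniformly_Cauchy_on (ball z r) f"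
      unfolding uniformly_Cauchy_on_def
    proof (intro allI impI)
      fix e :: real assume e: "e > 0"
      define d where "d = e\<^sup>2 / (C * 4)"
      have d: "d > 0" using e C by (simp add: d_def)
      obtain N where N: "inverse (real (Suc N)) < d" using reals_Archimedean[OF d] by blast
      have "dist (f n x) (f k x) < e" if x: "x \<in> ball z r" and n: "n \<ge> N" "k \<ge> N" for x n k
      proof -
        have "inverse (real (Suc n)) \<le> inverse (real (Suc N))" "inverse (real (Suc k)) \<le> inverse (real (Suc N))"
          using n by (auto intro!: le_imp_inverse_le)
        moreover have "2 * (a + b) < 4 * d" if "a \<le> c" "b \<le> c" "c < d" for a b c :: real
          using that by argo
        ultimately have "2 * (inverse (real (Suc n)) + inverse (real (Suc k))) < 4 * d" using N by blast
        then have *: "nrm (\<lambda>z. f n z - f k z) < 4 * d" using par[of n k] by linarith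
        have "(cmod (f n x - f k x))\<^sup>2 \<le> C * nrm (\<lambda>z. f n z - f k z)"
          by (rule C(2)[OF bergman_space_diff[OF fA fA] x])
        also have "\<dots> < C * (4 * d)" using * C(1) by simp
        also have "\<dots> = e\<^sup>2" using C(1) by (simp add: d_def)
        finally show ?thesis using e by (simp add: dist_norm power_less_imp_less_base)
      qed
      then show "\<exists>M. \<forall>x\<in>ball z r. \<forall>m\<ge>M. \<forall>n\<ge>M. dist (f m x) (f n x) < e" by blast
    qed
    then have "uniform_limit (ball z r) f g sequentially"
      using Cauchy_uniformly_convergent uniformly_convergent_uniform_limit_iff[of "ball z r" f]
      unfolding g_def by blast
    then show ?thesis using r by blast
  qed
  have lim: "(\<lambda>n. f n z) \<longlonglongrightarrow> g z" if "z \<in> D" for z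
    using unif[OF that] by (metis centre_in_ball tendsto_uniform_limitI)
  have hol: "holomorphic_fun_on g D"
    by (rule holomorphic_fun_uniform_limit[OF bergman_spaceD(1)[OF fA] unif])
  have meas: "(\<lambda>z. indicator D z * ennreal ((cmod (h z))\<^sup>2)) \<in> borel_measurable lborel"
    if "holomorphic_fun_on h D" for h
  proof -
    have "set_borel_measurable lborel D (\<lambda>z. (cmod (h z))\<^sup>2)"
      by (intro set_borel_measurable_continuous continuous_intros holomorphic_fun_on_imp_continuous_on that)
    then have "(\<lambda>z. ennreal (indicator D z *\<^sub>R (cmod (h z))\<^sup>2)) \<in> borel_measurable lborel"
      unfolding set_borel_measurable_def by measurable
    also have "(\<lambda>z. ennreal (indicator D z *\<^sub>R (cmod (h z))\<^sup>2)) = (\<lambda>z. indicator D z * ennreal ((cmod (h z))\<^sup>2))"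
      by (auto simp: indicator_def)
    finally show ?thesis .
  qed
  let ?I = "\<lambda>h. \<integral>\<^sup>+z. indicator D z * ennreal ((cmod (h z))\<^sup>2) \<partial>lborel"
  have "?I g = (\<integral>\<^sup>+z. liminf (\<lambda>n. indicator D z * ennreal ((cmod (f n z))\<^sup>2)) \<partial>lborel)"
  proof (rule nn_integral_cong)
    fix z
    show "indicator D z * ennreal ((cmod (g z))\<^sup>2) = liminf (\<lambda>n. indicator D z * ennreal ((cmod (f n z))\<^sup>2))"
    proof (cases "z \<in> D")
      case True
      have "(\<lambda>n. ennreal ((cmod (f n z))\<^sup>2)) \<longlonglongrightarrow> ennreal ((cmod (g z))\<^sup>2)"
        by (intro tendsto_intros lim True)
      then show ?thesis using lim_imp_Liminf[OF sequentially_bot] True by fastforce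
    qed (simp add: Liminf_const)
  qed
  also have "\<dots> \<le> liminf (\<lambda>n. ?I (f n))"
    by (rule nn_integral_liminf) (rule meas[OF bergman_spaceD(1)[OF fA]])
  also have "\<dots> \<le> liminf (\<lambda>n. ennreal (m + inverse (real (Suc n))))"
    by (intro Liminf_mono always_eventually allI)
      (simp only: nrm_nn_integral[OF fA, symmetric], intro ennreal_leI less_imp_le f_less)
  also have "\<dots> = ennreal (m + 0)"
    by (intro lim_imp_Liminf tendsto_intros LIMSEQ_inverse_real_of_nat) simp
  finally have Ig: "?I g \<le> ennreal m" by simp
  have "set_integrable lborel D (\<lambda>z. (cmod (g z))\<^sup>2)"
    unfolding set_integrable_def
  proof (rule integrableI_bounded)
    show "(\<lambda>z. indicat_real D z *\<^sub>R (cmod (g z))\<^sup>2) \<in> borel_measurable lborel"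
      by (rule set_borel_measurable_continuous[unfolded set_borel_measurable_def])
        (intro continuous_intros holomorphic_fun_on_imp_continuous_on hol)
    have "(\<integral>\<^sup>+z. ennreal (norm (indicat_real D z *\<^sub>R (cmod (g z))\<^sup>2)) \<partial>lborel) = ?I g"
      by (intro nn_integral_cong) (auto simp: indicator_def)
    then show "(\<integral>\<^sup>+z. ennreal (norm (indicat_real D z *\<^sub>R (cmod (g z))\<^sup>2)) \<partial>lborel) < \<infinity>"
      using Ig by (simp add: le_less_trans)
  qed
  then have gA: "g \<in> bergman_space D" using hol by (simp add: bergman_space_def)
  have gw: "g w = 1" using lim[OF w] fw by (simp add: LIMSEQ_const_iff)
  \<comment> \<open>\<open>ennreal\<close> sends negative reals to 0, so the sign of
    \<open>m\<close> is needed to return to a real inequality.\<close>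
  have "0 \<le> m" unfolding m_def using E by (intro cInf_greatest) (auto simp: nrm_nonneg)
  then have "nrm g \<le> m" using Ig by (simp add: ennreal_le_iff flip: nrm_nn_integral[OF gA])
  then show ?thesis using that[OF gA gw] m_le by (auto simp: E_def intro: order_trans)
qed

text \<open>The minimizer \<open>g\<close> is orthogonal to every function vanishing at
  \<open>w\<close>. Since \<open>f - f w * g\<close> is one, pairing it with \<open>g\<close> gives
  \<open>ip f g = f w * nrm g\<close>, so \<open>g / nrm g\<close> represents evaluation.\<close>

lemma bergman_representer:
  assumes w: "w \<in> D"
  shows "\<exists>k\<in>bergman_space D. \<forall>f\<in>bergman_space D. f w = ip f k"
proof -
  obtain g where gA: "g \<in> bergman_space D" and gw: "g w = 1"
    and gmin: "\<And>f. f \<in> bergman_space D \<Longrightarrow> f w = 1 \<Longrightarrow> nrm g \<le> nrm f"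
    using bergman_minimizer[OF w] by metis
  have orth: "ip g h = 0" if h: "h \<in> bergman_space D" "h w = 0" for h
  proof (rule ccontr)
    assume ne: "ip g h \<noteq> 0"
    \<comment> \<open>With \<open>t * nrm h < 1\<close> the quadratic term cannot compensate the
      linear gain; the added 1 covers \<open>nrm h = 0\<close>.\<close>
    define t where "t = 1 / (nrm h + 1)"
    have h0: "nrm h \<ge> 0" by (rule nrm_nonneg)
    have t: "t > 0" "t * nrm h < 1" using h0 by (auto simp: t_def)
    define c where "c = of_real t * ip g h"
    have "nrm g \<le> nrm (\<lambda>z. g z - c * h z)"
      using h gw by (intro gmin bergman_space_diff[OF gA] bergman_space_cmult) auto
    also have "\<dots> = nrm g - 2 * Re (cnj c * ip g h) + (cmod c)\<^sup>2 * nrm h"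
      by (rule nrm_diff_cmult[OF gA h(1)])
    also have "cnj c * ip g h = complex_of_real (t * (cmod (ip g h))\<^sup>2)"
      by (simp add: c_def complex_norm_square mult.commute del: of_real_power)
    also have "(cmod c)\<^sup>2 * nrm h = t * (cmod (ip g h))\<^sup>2 * (t * nrm h)"
      using t by (simp add: c_def norm_mult power_mult_distrib power2_eq_square)
    finally have "2 * (t * (cmod (ip g h))\<^sup>2) \<le> t * (cmod (ip g h))\<^sup>2 * (t * nrm h)" by simp
    also have "\<dots> \<le> t * (cmod (ip g h))\<^sup>2 * 1" using t by (intro mult_left_mono) auto
    finally show False using t ne by simp
  qed
  have n0: "nrm g > 0"
  proof -
    obtain C where "C > 0" "(cmod (g w))\<^sup>2 \<le> C * nrm g"
      using bergman_pointwise_bounded[OF w] gA by metis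
    then show ?thesis using gw nrm_nonneg[of g] by (cases "nrm g = 0") auto
  qed
  have "f w = ip f (\<lambda>z. of_real (1 / nrm g) * g z)" if f: "f \<in> bergman_space D" for f
  proof -
    let ?h = "\<lambda>z. f z - f w * g z"
    have "ip g ?h = 0"
      using gw by (intro orth bergman_space_diff[OF f] bergman_space_cmult gA) auto
    then have "0 = ip ?h g" using ip_cnj[of g ?h] by simp
    also have "\<dots> = ip f g - f w * ip g g"
      by (simp add: ip_diff[OF f bergman_space_cmult[OF gA] gA] ip_cmult)
    finally show ?thesis unfolding ip_right(1) using n0 by (simp add: ip_self field_simps)
  qed
  then show ?thesis using bergman_space_cmult[OF gA] by blast
qed

section \<open>The kernel function and its polarization\<close>

definition K :: "complex ^ 'n \<Rightarrow> complex ^ 'n \<Rightarrow> complex" where "K = bergman_kernel D"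

lemma is_bergman_kernel_K: "is_bergman_kernel D K"
proof -
  obtain k where "\<And>w. w \<in> D \<Longrightarrow> k w \<in> bergman_space D \<and> (\<forall>f\<in>bergman_space D. f w = ip f (k w))"
    using bergman_representer by metis
  then have "is_bergman_kernel D (\<lambda>z w. k w z)"
    unfolding is_bergman_kernel_def ip_def by blast
  then show ?thesis unfolding K_def bergman_kernel_def by (rule someI[of "is_bergman_kernel D"])
qed

lemma K_bergman_space: "w \<in> D \<Longrightarrow> (\<lambda>z. K z w) \<in> bergman_space D"
  using is_bergman_kernel_K by (simp add: is_bergman_kernel_def)

lemma K_reproducing: "f \<in> bergman_space D \<Longrightarrow> w \<in> D \<Longrightarrow> ip f (\<lambda>z. K z w) = f w"
  using is_bergman_kernel_K by (simp add: is_bergman_kernel_def ip_def)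

lemma K_cnj: "z \<in> D \<Longrightarrow> w \<in> D \<Longrightarrow> cnj (K z w) = K w z"
  using K_reproducing[OF K_bergman_space, of w z] K_reproducing[OF K_bergman_space, of z w]
  by (metis ip_cnj)

lemma K_diag: "z \<in> D \<Longrightarrow> K z z = of_real (nrm (\<lambda>x. K x z))"
  using K_reproducing[OF K_bergman_space, of z z] by (simp add: ip_self)

text \<open>Tested on the constant 1, which is square integrable because \<open>D\<close> is
  bounded. Positivity keeps the logarithm in the metric meaningful.\<close>

lemma K_diag_pos:
  assumes z: "z \<in> D"
  shows "nrm (\<lambda>x. K x z) > 0"
proof -
  have "(cmod (ip (\<lambda>_. 1) (\<lambda>x. K x z)))\<^sup>2 \<le> nrm (\<lambda>_. 1) * nrm (\<lambda>x. K x z)"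
    by (intro ip_cauchy_schwarz bergman_space_const K_bergman_space z)
  then have "1 \<le> nrm (\<lambda>_. 1) * nrm (\<lambda>x. K x z)"
    by (simp add: K_reproducing[OF bergman_space_const z])
  then show ?thesis using nrm_nonneg[of "\<lambda>x. K x z"] by (cases "nrm (\<lambda>x. K x z) = 0") auto
qed

text \<open>The evaluation bound for the kernel function at its own base point reads
  \<open>(K x x)^2 \<le> C * K x x\<close>; divide by \<open>K x x\<close>.\<close>

lemma K_diag_bound:
  assumes "z \<in> D"
  obtains r C where "r > 0" "ball z r \<subseteq> D" "C > 0" "\<And>x. x \<in> ball z r \<Longrightarrow> nrm (\<lambda>y. K y x) \<le> C"
proof -
  obtain r C where r: "r > 0" "ball z r \<subseteq> D" "C > 0"
    and C: "\<And>f x. f \<in> bergman_space D \<Longrightarrow> x \<in> ball z r \<Longrightarrow> (cmod (f x))\<^sup>2 \<le> C * nrm f"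
    using bergman_locally_bounded[OF assms] by metis
  have "nrm (\<lambda>y. K y x) \<le> C" if x: "x \<in> ball z r" for x
  proof -
    have xD: "x \<in> D" using x r by blast
    have "(cmod (K x x))\<^sup>2 \<le> C * nrm (\<lambda>y. K y x)" by (rule C[OF K_bergman_space[OF xD] x])
    then show ?thesis using K_diag_pos[OF xD] by (simp add: K_diag[OF xD] power2_eq_square)
  qed
  then show ?thesis using that r by blast
qed

text \<open>The polarization of the kernel: holomorphic in all \<open>2n\<close> variables, with the diagonal values
  \<open>K z z\<close> on the points \<open>pair z (cnjv z)\<close>.\<close>

definition H :: "complex ^ ('n + 'n) \<Rightarrow> complex" where "H x = K (pr1 x) (cnjv (pr2 x))"

definition S :: "(complex ^ ('n + 'n)) set" where
  "S = {x. pr1 x \<in> D \<and> cnjv (pr2 x) \<in> D}"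

lemma bounded_linear_cnjv: "bounded_linear (cnjv :: complex ^ 'n \<Rightarrow> _)"
  by (simp add: linear_conv_bounded_linear[symmetric] linear_iff cnjv_linear)

lemma open_cnjv: "open {w. cnjv w \<in> D}"
  using open_vimage[OF open_D linear_continuous_on[OF bounded_linear_cnjv]] by (simp add: vimage_def)

lemma open_S: "open S"
proof -
  have "S = pr1 -` D \<inter> pr2 -` {w. cnjv w \<in> D}" by (auto simp: S_def)
  then show ?thesis
    by (simp only:) (intro open_Int open_vimage open_D open_cnjv linear_continuous_on bounded_linear_pr)
qed

text \<open>Conjugating both argument and value makes the derivative complex linear again.\<close>

lemma holomorphic_conj:
  assumes g: "holomorphic_fun_on g D"
  shows "holomorphic_fun_on (\<lambda>w. cnj (g (cnjv w))) {w. cnjv w \<in> D}"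
proof (rule holomorphic_fun_onI)
  fix w assume "w \<in> {w. cnjv w \<in> D}"
  then have w: "cnjv w \<in> D" by simp
  note L = holomorphic_fun_on_dird[OF g open_D w]
  have "((\<lambda>w. cnj (g (cnjv w))) has_derivative (\<lambda>v. cnj (dird (cnjv v) g (cnjv w)))) (at w)"
    by (rule bounded_linear.has_derivative[OF bounded_linear_cnj])
      (rule has_derivative_compose[OF bounded_linear_imp_has_derivative[OF bounded_linear_cnjv] L(1)])
  then show "\<exists>L. ((\<lambda>w. cnj (g (cnjv w))) has_derivative L) (at w) \<and> (\<forall>c v. L (c *s v) = c * L v)"
    using L(2) by (auto simp: cnjv_linear)
qed

text \<open>Holomorphy in the second block comes from the Hermitian symmetry \<open>K_cnj\<close>;
  the local bound is Cauchy-Schwarz for two kernel functions, whose squared norms are locally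
  bounded by \<open>K_diag_bound\<close>.\<close>

lemma H_holomorphic: "holomorphic_fun_on H S"
proof -
  let ?f = "\<lambda>z w. K z (cnjv w)"
  have "holomorphic_fun_on (\<lambda>x. ?f (pr1 x) (pr2 x)) {x. pr1 x \<in> D \<and> pr2 x \<in> {w. cnjv w \<in> D}}"
  proof (rule holomorphic_joint[OF open_D open_cnjv])
    show "holomorphic_fun_on (\<lambda>z. K z (cnjv w)) D" if "w \<in> {w. cnjv w \<in> D}" for w
      using that K_bergman_space bergman_spaceD(1) by simp
    show "holomorphic_fun_on (\<lambda>w. K z (cnjv w)) {w. cnjv w \<in> D}" if z: "z \<in> D" for z
    proof -
      have "holomorphic_fun_on (\<lambda>w. cnj (K (cnjv w) z)) {w. cnjv w \<in> D}"
        by (rule holomorphic_conj[OF bergman_spaceD(1)[OF K_bergman_space[OF z]]])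
      then show ?thesis
        unfolding holomorphic_fun_on_def
        by (metis (no_types, lifting) K_cnj has_derivative_transform mem_Collect_eq z)
    qed
    show "\<exists>r>0. \<exists>M. ball z r \<subseteq> D \<and> ball w r \<subseteq> {w. cnjv w \<in> D} \<and>
        (\<forall>z'\<in>ball z r. \<forall>w'\<in>ball w r. cmod (K z' (cnjv w')) \<le> M)"
      if z: "z \<in> D" and w: "w \<in> {w. cnjv w \<in> D}" for z w
    proof -
      obtain r1 C1 where 1: "r1 > 0" "ball z r1 \<subseteq> D" "C1 > 0" "\<And>x. x \<in> ball z r1 \<Longrightarrow> nrm (\<lambda>y. K y x) \<le> C1"
        using K_diag_bound[OF z] by metis
      obtain r2 C2 where 2: "r2 > 0" "ball (cnjv w) r2 \<subseteq> D" "C2 > 0"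
        "\<And>x. x \<in> ball (cnjv w) r2 \<Longrightarrow> nrm (\<lambda>y. K y x) \<le> C2"
        using K_diag_bound w by (metis mem_Collect_eq)
      have cw: "cnjv w' \<in> ball (cnjv w) r2" if "w' \<in> ball w r2" for w'
        using that norm_cnjv[of "w - w'"] by (simp add: dist_norm cnjv_linear)
      have "cmod (K z' (cnjv w')) \<le> sqrt (C1 * C2)" if z': "z' \<in> ball z r1" and w': "w' \<in> ball w r2" for z' w'
      proof -
        have D: "z' \<in> D" "cnjv w' \<in> D" using z' 1 cw[OF w'] 2 by auto
        have "(cmod (K z' (cnjv w')))\<^sup>2 = (cmod (ip (\<lambda>x. K x (cnjv w')) (\<lambda>x. K x z')))\<^sup>2"
          by (simp add: K_reproducing[OF K_bergman_space[OF D(2)] D(1)])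
        also have "\<dots> \<le> nrm (\<lambda>x. K x (cnjv w')) * nrm (\<lambda>x. K x z')"
          by (intro ip_cauchy_schwarz K_bergman_space D)
        also have "\<dots> \<le> C2 * C1"
          using 1(4)[OF z'] 2(3) 2(4)[OF cw[OF w']] by (intro mult_mono nrm_nonneg) auto
        finally show ?thesis by (simp add: real_le_rsqrt mult.commute)
      qed
      moreover have "ball w r2 \<subseteq> {w. cnjv w \<in> D}" using cw 2(2) by blast
      ultimately show ?thesis using 1(1,2) 2(1)
        by (intro exI[of _ "min r1 r2"] exI[of _ "sqrt (C1 * C2)"] conjI ballI) auto
    qed
  qed
  then show ?thesis by (simp add: H_def[abs_def] S_def)
qed

end

subsection \<open>The Bergman metric\<close>

lemma dird_cong:
  fixes f :: "complex ^ 'n \<Rightarrow> complex"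
  assumes S: "open S" "z \<in> S" and eq: "\<And>x. x \<in> S \<Longrightarrow> f x = g x"
  shows "dird v f z = dird v g z"
  unfolding dird_def
proof (rule deriv_cong_ev[OF _ refl])
  have "open {s. z + s *s v \<in> S}" by (rule open_vimage_affine[OF S(1)])
  then have "\<forall>\<^sub>F s in nhds 0. s \<in> {s. z + s *s v \<in> S}"
    using S(2) by (intro eventually_nhds_in_open) auto
  then show "\<forall>\<^sub>F s in nhds 0. f (z + s *s v) = g (z + s *s v)"
    by eventually_elim (use eq in auto)
qed

lemma dird_linear_combination:
  assumes F: "\<And>k. k \<in> I \<Longrightarrow> holomorphic_fun_on (F k) S" and S: "open S" "z \<in> S"
  shows "dird v (\<lambda>x. \<Sum>k\<in>I. c k * F k x) z = (\<Sum>k\<in>I. c k * dird v (F k) z)"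
proof (rule dird_eqI)
  show "((\<lambda>x. \<Sum>k\<in>I. c k * F k x) has_derivative (\<lambda>v. \<Sum>k\<in>I. c k * dird v (F k) z)) (at z)"
    by (intro has_derivative_sum has_derivative_mult_right holomorphic_fun_on_dird(1)[OF F S])
qed (simp add: holomorphic_fun_on_dird(2)[OF F S] sum_distrib_left mult_ac)

lemma Re_slice_derivative:
  fixes F :: "complex ^ 'n \<Rightarrow> complex"
  assumes F: "holomorphic_fun_on F S" and S: "open S" "y + t *\<^sub>R b \<in> S"
  shows "((\<lambda>t. Re (F (y + t *\<^sub>R b))) has_real_derivative Re (dird b F (y + t *\<^sub>R b))) (at t)"
proof -
  have "((\<lambda>t. y + t *\<^sub>R b) has_vector_derivative b) (at t)"
    by (auto intro!: derivative_eq_intros simp: has_vector_derivative_def)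
  from vector_derivative_diff_chain_within[OF this, of F "\<lambda>v. dird v F (y + t *\<^sub>R b)"]
    holomorphic_fun_on_dird(1)[OF F S]
  have "((\<lambda>t. F (y + t *\<^sub>R b)) has_vector_derivative dird b F (y + t *\<^sub>R b)) (at t)"
    by (simp add: o_def has_derivative_at_withinI)
  from bounded_linear.has_vector_derivative[OF bounded_linear_Re this]
  show ?thesis by (simp add: has_real_derivative_iff_has_vector_derivative)
qed

text \<open>Two applications of the mean value theorem to real parts turn the quotient into the
  mixed derivative at an intermediate point, and continuity of that derivative gives the
  limit.\<close>

lemma mixed_difference_limit:
  fixes G :: "complex ^ 'n \<Rightarrow> complex"
  assumes G: "holomorphic_fun_on G S" and S: "open S" "x \<in> S"
  shows "((\<lambda>h. Re (G (x + h *\<^sub>R a + h *\<^sub>R b) - G (x + h *\<^sub>R b) - G (x + h *\<^sub>R a) + G x) / h\<^sup>2)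
    \<longlongrightarrow> Re (dird a (dird b G) x)) (at_right 0)"
proof (rule tendstoI)
  fix e :: real assume e: "e > 0"
  have hb: "holomorphic_fun_on (dird b G) S" by (rule holomorphic_fun_on_dird_holomorphic[OF G S(1)])
  let ?R = "\<lambda>y. Re (dird a (dird b G) y)"
  have "continuous_on S ?R"
    by (intro continuous_intros holomorphic_fun_on_imp_continuous_on holomorphic_fun_on_dird_holomorphic hb S)
  then have "isCont ?R x" using S continuous_on_eq_continuous_at by blast
  then obtain d0 where d0: "d0 > 0" "\<And>y. dist y x < d0 \<Longrightarrow> dist (?R y) (?R x) < e"
    using e unfolding continuous_at_eps_delta by (metis dist_commute)
  obtain d1 where d1: "d1 > 0" "ball x d1 \<subseteq> S" using S openE by blast
  \<comment> \<open>For steps below \<open>d\<close> the parallelogram spanned at \<open>x\<close>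
    stays in \<open>S\<close> and where \<open>?R\<close> varies by less than \<open>e\<close>; the
    added 1 covers \<open>a = b = 0\<close>.\<close>
  define d where "d = min d0 d1 / (norm a + norm b + 1)"
  have d: "d > 0" using d0 d1 by (simp add: d_def add_nonneg_pos)
  have near: "dist (x + s *\<^sub>R a + t *\<^sub>R b) x < min d0 d1" if "0 \<le> s" "s < d" "0 \<le> t" "t < d" for s t
  proof -
    have "dist (x + s *\<^sub>R a + t *\<^sub>R b) x = norm (s *\<^sub>R a + t *\<^sub>R b)" by (simp add: dist_norm)
    also have "\<dots> \<le> s * norm a + t * norm b"
      using that norm_triangle_ineq[of "s *\<^sub>R a" "t *\<^sub>R b"] by simp
    also have "\<dots> \<le> d * norm a + d * norm b"
      using that by (intro add_mono mult_right_mono) auto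
    also have "\<dots> < d * (norm a + norm b + 1)" using d by (simp add: distrib_left)
    also have "\<dots> = min d0 d1"
      unfolding d_def by (rule nonzero_eq_divide_eq[THEN iffD1, OF _ refl])
        (simp add: add_nonneg_pos less_imp_neq[symmetric])
    finally show ?thesis .
  qed
  have inS: "x + s *\<^sub>R a + t *\<^sub>R b \<in> S" if "0 \<le> s" "s < d" "0 \<le> t" "t < d" for s t
    using near[OF that] d1(2) by (auto simp: dist_commute)
  have "dist (Re (G (x + h *\<^sub>R a + h *\<^sub>R b) - G (x + h *\<^sub>R b) - G (x + h *\<^sub>R a) + G x) / h\<^sup>2) (?R x) < e"
    if h: "0 < h" "h < d" for h
  proof -
    \<comment> \<open>The mixed difference is the increment of \<open>q\<close> over
      \<open>{0..h}\<close>; writing \<open>0 *\<^sub>R a\<close> gives both terms the shape covered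
      by \<open>inS\<close>.\<close>
    define q where "q t = Re (G (x + h *\<^sub>R a + t *\<^sub>R b)) - Re (G (x + 0 *\<^sub>R a + t *\<^sub>R b))" for t
    have "\<exists>\<eta>. 0 < \<eta> \<and> \<eta> < h \<and> q h - q 0 = (h - 0) *
        (Re (dird b G (x + h *\<^sub>R a + \<eta> *\<^sub>R b)) - Re (dird b G (x + 0 *\<^sub>R a + \<eta> *\<^sub>R b)))"
    proof (rule MVT2[OF h(1)])
      fix t assume t: "0 \<le> t" "t \<le> h"
      show "(q has_real_derivative Re (dird b G (x + h *\<^sub>R a + t *\<^sub>R b)) - Re (dird b G (x + 0 *\<^sub>R a + t *\<^sub>R b))) (at t)"
        unfolding q_def by (intro DERIV_diff Re_slice_derivative[OF G S(1)] inS) (use t h d in auto)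
    qed
    then obtain \<eta> where \<eta>: "0 < \<eta>" "\<eta> < h" and q: "q h - q 0 = h *
        (Re (dird b G (x + h *\<^sub>R a + \<eta> *\<^sub>R b)) - Re (dird b G (x + \<eta> *\<^sub>R b)))"
      by auto
    have "\<exists>\<xi>. 0 < \<xi> \<and> \<xi> < h \<and> Re (dird b G (x + \<eta> *\<^sub>R b + h *\<^sub>R a)) - Re (dird b G (x + \<eta> *\<^sub>R b + 0 *\<^sub>R a)) =
        (h - 0) * Re (dird a (dird b G) (x + \<eta> *\<^sub>R b + \<xi> *\<^sub>R a))"
    proof (rule MVT2[OF h(1)])
      fix s assume s: "0 \<le> s" "s \<le> h"
      have "x + \<eta> *\<^sub>R b + s *\<^sub>R a \<in> S"
        using inS[of s \<eta>] s h \<eta> by (simp add: add_ac)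
      then show "((\<lambda>s. Re (dird b G (x + \<eta> *\<^sub>R b + s *\<^sub>R a))) has_real_derivative
          Re (dird a (dird b G) (x + \<eta> *\<^sub>R b + s *\<^sub>R a))) (at s)"
        by (rule Re_slice_derivative[OF hb S(1)])
    qed
    then obtain \<xi> where \<xi>: "0 < \<xi>" "\<xi> < h"
      and r: "Re (dird b G (x + h *\<^sub>R a + \<eta> *\<^sub>R b)) - Re (dird b G (x + \<eta> *\<^sub>R b)) =
        h * ?R (x + \<xi> *\<^sub>R a + \<eta> *\<^sub>R b)"
      by (auto simp: add_ac)
    have "Re (G (x + h *\<^sub>R a + h *\<^sub>R b) - G (x + h *\<^sub>R b) - G (x + h *\<^sub>R a) + G x) = q h - q 0"
      by (simp add: q_def)
    also have "\<dots> = h\<^sup>2 * ?R (x + \<xi> *\<^sub>R a + \<eta> *\<^sub>R b)"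
      unfolding q r by (simp add: power2_eq_square)
    finally show ?thesis using d0(2) near[of \<xi> \<eta>] h \<xi> \<eta> by simp
  qed
  then show "\<forall>\<^sub>F h in at_right 0. dist (Re (G (x + h *\<^sub>R a + h *\<^sub>R b) - G (x + h *\<^sub>R b) - G (x + h *\<^sub>R a) + G x) / h\<^sup>2) (?R x) < e"
    unfolding eventually_at_right[OF zero_less_one] using d by blast
qed

context bounded_domain
begin

section \<open>The logarithm of the polarized kernel and the Bergman form\<close>

text \<open>A neighbourhood of the points \<open>pair z (cnjv z)\<close> with \<open>z\<close> in
  \<open>D\<close> on which the principal logarithm of \<open>H\<close> is holomorphic; at these
  points \<open>H\<close> itself is positive.\<close>

definition S' :: "(complex ^ ('n + 'n)) set" where "S' = {x \<in> S. 0 < Re (H x)}"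

definition G :: "complex ^ ('n + 'n) \<Rightarrow> complex" where "G x = Ln (H x)"

lemma open_S': "open S'"
proof -
  have "continuous_on S (\<lambda>x. Re (H x))"
    by (intro continuous_intros holomorphic_fun_on_imp_continuous_on H_holomorphic)
  then have "open (S \<inter> (\<lambda>x. Re (H x)) -` {0<..})"
    using open_S by (intro continuous_open_preimage) auto
  moreover have "S' = S \<inter> (\<lambda>x. Re (H x)) -` {0<..}" by (auto simp: S'_def)
  ultimately show ?thesis by simp
qed

lemma G_holomorphic: "holomorphic_fun_on G S'"
proof -
  have "holomorphic_fun_on (\<lambda>x. Ln (H x)) S'"
  proof (rule holomorphic_fun_on_compose[where f = H and g = Ln])
    show "holomorphic_fun_on H S'"
      by (rule holomorphic_fun_on_subset[OF H_holomorphic]) (auto simp: S'_def)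
    show "Ln holomorphic_on {w. 0 < Re w}"
      by (intro holomorphic_intros) (auto simp: complex_nonpos_Reals_iff)
    show "open {w. 0 < Re w}" by (rule open_halfspace_Re_gt)
  qed (auto simp: S'_def)
  then show ?thesis by (simp add: G_def[abs_def])
qed

lemma conj_pair_in_S': "z \<in> D \<Longrightarrow> pair z (cnjv z) \<in> S'"
  using K_diag K_diag_pos by (simp add: S'_def S_def H_def)

text \<open>\<open>wirtinger_conj_pair\<close> is used twice, the second time with a derivative of
  \<open>G\<close> in place of \<open>G\<close>; this works because the first identity holds
  throughout the open set \<open>D\<close>.\<close>

lemma bergman_metric_coeff_eq:
  assumes z: "z \<in> D"
  shows "bergman_metric_coeff D j k z = dird (axis (Inl j) 1) (dird (axis (Inr k) 1) G) (pair z (cnjv z))"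
proof -
  let ?u = "\<lambda>z. complex_of_real (ln (Re (bergman_kernel D z z)))"
  have u: "?u x = G (pair x (cnjv x))" if "x \<in> D" for x
    using K_diag[OF that] K_diag_pos[OF that] by (simp add: G_def H_def Ln_of_real K_def)
  have ev: "\<forall>\<^sub>F x in nhds y. x \<in> D" if "y \<in> D" for y
    using open_D that by (rule eventually_nhds_in_open)
  have w: "wirtinger_bar k ?u x = dird (axis (Inr k) 1) G (pair x (cnjv x))" if x: "x \<in> D" for x
    by (rule wirtinger_conj_pair(2)[OF G_holomorphic open_S' conj_pair_in_S'[OF x]])
      (use ev[OF x] in eventually_elim, rule u)
  show ?thesis unfolding bergman_metric_coeff_def
    by (rule wirtinger_conj_pair(1)[OF holomorphic_fun_on_dird_holomorphic[OF G_holomorphic open_S'] open_S' conj_pair_in_S'[OF z]])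
      (use ev[OF z] in eventually_elim, rule w)
qed

lemma continuous_on_bergman_norm:
  assumes "continuous_on T \<gamma>" "continuous_on T v" "\<gamma> ` T \<subseteq> D"
  shows "continuous_on T (\<lambda>t. bergman_norm D (\<gamma> t) (v t))"
proof -
  have c: "continuous_on D (bergman_metric_coeff D j k)" for j k
  proof -
    have "continuous_on D (\<lambda>z. dird (axis (Inl j) 1) (dird (axis (Inr k) 1) G) (pair z (cnjv z)))"
      by (rule continuous_on_compose2[OF holomorphic_fun_on_imp_continuous_on[OF
              holomorphic_fun_on_dird_holomorphic[OF holomorphic_fun_on_dird_holomorphic[OF G_holomorphic open_S'] open_S']]
            linear_continuous_on[OF bounded_linear_conj_pair]])
        (use conj_pair_in_S' in blast)
    then show ?thesis by (subst continuous_on_cong[OF refl bergman_metric_coeff_eq])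
  qed
  show ?thesis unfolding bergman_norm_def
    by (intro continuous_intros continuous_on_compose2[OF c assms(1,3)] assms(2))
qed

text \<open>The Hermitian sum is the expansion of one mixed derivative, in \<open>v\<close> for the
  first block and in its conjugate for the second. The inner expansion holds on all of
  \<open>S'\<close> and may therefore be differentiated again.\<close>

lemma bergman_norm_eq:
  assumes z: "z \<in> D"
  shows "bergman_norm D z v =
    sqrt (Re (dird (pair v 0) (dird (pair 0 (cnjv v)) G) (pair z (cnjv z))))"
proof -
  let ?x = "pair z (cnjv z)"
  note x = conj_pair_in_S'[OF z]
  note hG = holomorphic_fun_on_dird_holomorphic[OF G_holomorphic open_S']
  have pv: "pair v 0 = (\<Sum>j\<in>UNIV. (v $ j) *s axis (Inl j) 1)"
    and pw: "pair 0 (cnjv v) = (\<Sum>k\<in>UNIV. cnj (v $ k) *s axis (Inr k) 1)"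
    by (auto simp: vec_eq_iff pair_def cnjv_def axis_def if_distrib cong: if_cong split: sum.split)
  have b: "dird (pair 0 (cnjv v)) G y = (\<Sum>k\<in>UNIV. cnj (v $ k) * dird (axis (Inr k) 1) G y)" if "y \<in> S'" for y
    unfolding pw by (simp only: dird_sum[OF G_holomorphic open_S' that] holomorphic_fun_on_dird(2)[OF G_holomorphic open_S' that])
  have "dird (pair v 0) (dird (pair 0 (cnjv v)) G) ?x =
      dird (pair v 0) (\<lambda>y. \<Sum>k\<in>UNIV. cnj (v $ k) * dird (axis (Inr k) 1) G y) ?x"
    by (rule dird_cong[OF open_S' x b])
  also have "\<dots> = (\<Sum>k\<in>UNIV. cnj (v $ k) * dird (pair v 0) (dird (axis (Inr k) 1) G) ?x)"
    by (rule dird_linear_combination[OF hG open_S' x])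
  also have "\<dots> = (\<Sum>k\<in>UNIV. \<Sum>j\<in>UNIV. cnj (v $ k) * ((v $ j) * bergman_metric_coeff D j k z))"
    unfolding pv bergman_metric_coeff_eq[OF z]
    by (simp only: dird_sum[OF hG open_S' x] holomorphic_fun_on_dird(2)[OF hG open_S' x] sum_distrib_left)
  also have "\<dots> = (\<Sum>j\<in>UNIV. \<Sum>k\<in>UNIV. bergman_metric_coeff D j k z * (v $ j) * cnj (v $ k))"
    by (subst sum.swap) (simp add: mult_ac)
  finally show ?thesis by (simp add: bergman_norm_def)
qed

text \<open>Removing from \<open>g\<close> its projection onto \<open>e\<close> leaves the pairing
  with \<open>\<phi>\<close> unchanged, as \<open>\<phi>\<close> is orthogonal to \<open>e\<close>.
  What remains of \<open>g\<close> has squared norm equal to the Gram determinant of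
  \<open>g\<close> and \<open>e\<close> divided by \<open>nrm e\<close>.\<close>

lemma ip_projection_bound:
  assumes A: "\<phi> \<in> bergman_space D" "g \<in> bergman_space D" "e \<in> bergman_space D"
    and e: "nrm e > 0" "ip \<phi> e = 0"
  shows "(cmod (ip \<phi> g))\<^sup>2 \<le> nrm \<phi> * (nrm g - (cmod (ip g e))\<^sup>2 / nrm e)"
    and "0 \<le> nrm g - (cmod (ip g e))\<^sup>2 / nrm e"
proof -
  define c where "c = ip g e / nrm e"
  note ce = bergman_space_cmult[OF A(3), of c]
  have "nrm (\<lambda>z. g z - c * e z) = nrm g - 2 * Re (cnj c * ip g e) + (cmod c)\<^sup>2 * nrm e"
    by (rule nrm_diff_cmult[OF A(2,3)])
  also have "cnj c * ip g e = complex_of_real ((cmod (ip g e))\<^sup>2 / nrm e)"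
    by (simp add: c_def complex_norm_square mult.commute del: of_real_power)
  also have "(cmod c)\<^sup>2 * nrm e = (cmod (ip g e))\<^sup>2 / nrm e"
    using e by (simp add: c_def norm_divide power_divide power2_eq_square)
  finally have n: "nrm (\<lambda>z. g z - c * e z) = nrm g - (cmod (ip g e))\<^sup>2 / nrm e" by simp
  then show "0 \<le> nrm g - (cmod (ip g e))\<^sup>2 / nrm e" using nrm_nonneg by metis
  have "ip \<phi> g = ip \<phi> (\<lambda>z. g z - c * e z)"
    using ip_right(2)[OF A(1,2) ce] e(2) by (simp add: ip_right(1))
  then show "(cmod (ip \<phi> g))\<^sup>2 \<le> nrm \<phi> * (nrm g - (cmod (ip g e))\<^sup>2 / nrm e)"
    using ip_cauchy_schwarz[OF A(1) bergman_space_diff[OF A(2) ce]] n by simp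
qed

text \<open>For \<open>\<phi> z = 0\<close>, projecting \<open>K (\<cdot>, z + hv)\<close> off \<open>K (\<cdot>, z)\<close> bounds \<open>\<phi> (z + hv)\<close> by the Gram
  determinant of these two functions. Up to the factor \<open>\<bar>K z (z + hv)\<bar>\<^sup>2\<close> it is \<open>exp \<Delta> - 1\<close> for a mixed
  second difference \<open>\<Delta>\<close> of \<open>G\<close>, and \<open>\<Delta> / h\<^sup>2\<close> tends to the Bergman form.\<close>

lemma bergman_norm_derivative_bound:
  fixes v z :: "complex ^ 'n"
  assumes \<phi>: "\<phi> \<in> bergman_space D" "\<phi> z = 0" and z: "z \<in> D"
  defines "q \<equiv> Re (dird (pair v 0) (dird (pair 0 (cnjv v)) G) (pair z (cnjv z)))"
  shows "0 \<le> q" and "(cmod (dird v \<phi> z))\<^sup>2 \<le> nrm \<phi> * nrm (\<lambda>x. K x z) * q"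
proof -
  let ?x = "pair z (cnjv z)" and ?a = "pair v 0" and ?b = "pair 0 (cnjv v)"
  define \<kappa> where "\<kappa> w = nrm (\<lambda>x. K x w)" for w
  define p where "p h = cmod (K z (z + h *\<^sub>R v))" for h :: real
  define \<Delta> where "\<Delta> h = Re (G (?x + h *\<^sub>R ?a + h *\<^sub>R ?b) - G (?x + h *\<^sub>R ?b) - G (?x + h *\<^sub>R ?a) + G ?x)" for h
  have lim\<Delta>: "((\<lambda>h. \<Delta> h / h\<^sup>2) \<longlongrightarrow> q) (at_right 0)"
    unfolding \<Delta>_def q_def by (rule mixed_difference_limit[OF G_holomorphic open_S' conj_pair_in_S'[OF z]])
  have ev_in: "\<forall>\<^sub>F h in at_right 0. f h \<in> U" if "open U" "f 0 \<in> U" "continuous_on UNIV f" for U and f :: "real \<Rightarrow> 'b::topological_space"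
  proof -
    have "(f \<longlongrightarrow> f 0) (at_right 0)"
      using that(3) by (metis continuous_on_def UNIV_I tendsto_within_subset subset_UNIV)
    then show ?thesis using that topological_tendstoD by blast
  qed
  have e1: "\<forall>\<^sub>F h in at_right 0. z + h *\<^sub>R v \<in> D"
    by (rule ev_in) (use z open_D in \<open>auto intro!: continuous_intros\<close>)
  have e2: "\<forall>\<^sub>F h in at_right 0. ?x + h *\<^sub>R ?b \<in> S'"
    by (rule ev_in) (use conj_pair_in_S'[OF z] open_S' in \<open>auto intro!: continuous_intros\<close>)
  have e3: "\<forall>\<^sub>F h in at_right 0. ?x + h *\<^sub>R ?a \<in> S'"
    by (rule ev_in) (use conj_pair_in_S'[OF z] open_S' in \<open>auto intro!: continuous_intros\<close>)
  have \<kappa>0: "\<kappa> z > 0" using K_diag_pos[OF z] by (simp add: \<kappa>_def)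
  have main: "0 \<le> \<Delta> h \<and> (cmod (\<phi> (z + h *\<^sub>R v)))\<^sup>2 \<le> nrm \<phi> * ((p h)\<^sup>2 * (exp (\<Delta> h) - 1) / \<kappa> z)"
    if zh: "z + h *\<^sub>R v \<in> D" and b: "?x + h *\<^sub>R ?b \<in> S'" and a: "?x + h *\<^sub>R ?a \<in> S'" for h
  proof -
    let ?w = "z + h *\<^sub>R v"
    have pts: "?x + h *\<^sub>R ?a + h *\<^sub>R ?b = pair ?w (cnjv ?w)"
      "?x + h *\<^sub>R ?b = pair z (cnjv ?w)" "?x + h *\<^sub>R ?a = pair ?w (cnjv z)"
      by (auto simp: vec_eq_iff pair_def cnjv_def split: sum.split)
    have eG: "exp (Re (G y)) = cmod (H y)" if "y \<in> S'" for y
    proof -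
      have "H y \<noteq> 0" using that by (auto simp: S'_def)
      then have "exp (G y) = H y" by (simp add: G_def)
      then show ?thesis by (metis norm_exp_eq_Re)
    qed
    have Kp: "cmod (K ?w z) = p h" using K_cnj[OF z zh] by (metis complex_mod_cnj p_def)
    have cK: "cmod (K y y) = \<kappa> y" if "y \<in> D" for y
      using K_diag[OF that] nrm_nonneg by (simp add: \<kappa>_def)
    have p0: "p h > 0"
    proof -
      have "H (pair z (cnjv ?w)) \<noteq> 0" using b unfolding pts S'_def by auto
      then show ?thesis by (simp add: H_def p_def)
    qed
    \<comment> \<open>On \<open>S'\<close> the real part of \<open>G\<close> is
      \<open>ln |H|\<close>, so the four values combine to the ratio of \<open>K w w * K z z\<close>
      to \<open>|K z w|^2\<close>, where \<open>w\<close> is the displaced point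
      \<open>?w\<close>.\<close>
    have "exp (\<Delta> h) = \<kappa> ?w * \<kappa> z / (p h * p h)"
      using a b conj_pair_in_S'[OF zh] conj_pair_in_S'[OF z]
      unfolding \<Delta>_def pts(1) unfolding pts(2,3) by (simp add: exp_add exp_diff eG H_def cK[OF z] cK[OF zh] Kp p_def[symmetric])
    then have \<kappa>w: "\<kappa> ?w - (p h)\<^sup>2 / \<kappa> z = (p h)\<^sup>2 * (exp (\<Delta> h) - 1) / \<kappa> z"
      using p0 \<kappa>0 by (simp add: power2_eq_square right_diff_distrib diff_divide_distrib)
    have ipK: "ip (\<lambda>x. K x ?w) (\<lambda>x. K x z) = K z ?w"
      by (rule K_reproducing[OF K_bergman_space[OF zh] z])
    have "ip \<phi> (\<lambda>x. K x z) = 0" using K_reproducing[OF \<phi>(1) z] \<phi>(2) by simp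
    note pr = ip_projection_bound[OF \<phi>(1) K_bergman_space[OF zh] K_bergman_space[OF z] K_diag_pos[OF z] this,
        unfolded ipK K_reproducing[OF \<phi>(1) zh], folded \<kappa>_def p_def, unfolded \<kappa>w]
    \<comment> \<open>Nonnegativity of the Gram determinant is the sign of
      \<open>\<Delta> h\<close>, and in the limit the positivity of the Bergman form.\<close>
    from pr(2) have "0 \<le> (p h)\<^sup>2 * (exp (\<Delta> h) - 1)" using \<kappa>0 by (simp add: zero_le_divide_iff)
    then have "0 \<le> \<Delta> h" using p0 by (simp add: zero_le_mult_iff)
    then show ?thesis using pr(1) by simp
  qed
  have ev: "\<forall>\<^sub>F h in at_right 0. 0 \<le> \<Delta> h \<and> (cmod (\<phi> (z + h *\<^sub>R v)))\<^sup>2 \<le> nrm \<phi> * ((p h)\<^sup>2 * (exp (\<Delta> h) - 1) / \<kappa> z)"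
    using e1 e2 e3 by eventually_elim (rule main)
  show q0: "0 \<le> q"
    by (rule tendsto_lowerbound[OF lim\<Delta> eventually_mono[OF ev]]) auto
  have h2: "((\<lambda>h::real. h\<^sup>2) \<longlongrightarrow> 0) (at_right 0)"
    by (rule tendsto_eq_intros | simp)+
  have "((\<lambda>h. \<Delta> h / h\<^sup>2 * h\<^sup>2) \<longlongrightarrow> q * 0) (at_right 0)"
    by (intro tendsto_mult lim\<Delta> h2)
  moreover have "\<forall>\<^sub>F h in at_right 0. \<Delta> h / h\<^sup>2 * h\<^sup>2 = \<Delta> h" by (auto simp: eventually_at_filter)
  ultimately have \<Delta>0: "(\<Delta> \<longlongrightarrow> 0) (at_right 0)"
    using Lim_transform_eventually[of _ "q * 0"] by simp
  have plim: "(p \<longlongrightarrow> \<kappa> z) (at_right 0)"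
  proof -
    have x: "?x \<in> S" using conj_pair_in_S'[OF z] by (simp add: S'_def)
    have "isCont H ?x"
      using holomorphic_fun_on_imp_continuous_on[OF H_holomorphic] x open_S continuous_on_eq_continuous_at by blast
    moreover have "((\<lambda>h::real. ?x + h *\<^sub>R ?b) \<longlongrightarrow> ?x + 0 *\<^sub>R ?b) (at_right 0)"
      by (intro tendsto_intros)
    ultimately have "((\<lambda>h. cmod (H (?x + h *\<^sub>R ?b))) \<longlongrightarrow> cmod (H ?x)) (at_right 0)"
      by (intro tendsto_norm isCont_tendsto_compose[of ?x H]) auto
    moreover have "?x + h *\<^sub>R ?b = pair z (cnjv (z + h *\<^sub>R v))" for h
      by (auto simp: vec_eq_iff pair_def cnjv_def split: sum.split)
    then have "(\<lambda>h. cmod (H (?x + h *\<^sub>R ?b))) = p" by (simp add: H_def p_def[abs_def])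
    moreover have "cmod (H ?x) = \<kappa> z" using K_diag[OF z] nrm_nonneg by (simp add: H_def \<kappa>_def)
    ultimately show ?thesis by simp
  qed
  have dlim: "((\<lambda>h. \<phi> (z + h *\<^sub>R v) / of_real h) \<longlongrightarrow> dird v \<phi> z) (at_right 0)"
  proof -
    have "((\<lambda>s. \<phi> (z + s *s v)) has_field_derivative dird v \<phi> z) (at 0)"
      using holomorphic_fun_on_slice[OF bergman_spaceD(1)[OF \<phi>(1)] open_D, of z 0 v] z by simp
    then have "((\<lambda>s. \<phi> (z + s *s v) / s) \<longlongrightarrow> dird v \<phi> z) (at 0)"
      by (simp add: DERIV_def \<phi>(2))
    moreover have "filterlim complex_of_real (at 0) (at_right 0)"
      unfolding filterlim_at by (auto intro!: tendsto_eq_intros simp: eventually_at_filter)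
    ultimately have "((\<lambda>h. \<phi> (z + complex_of_real h *s v) / complex_of_real h) \<longlongrightarrow> dird v \<phi> z) (at_right 0)"
      by (rule filterlim_compose)
    then show ?thesis by (simp only: of_real_vector_scalar_mult)
  qed
  show "(cmod (dird v \<phi> z))\<^sup>2 \<le> nrm \<phi> * nrm (\<lambda>x. K x z) * q"
  proof (rule tendsto_le[OF trivial_limit_at_right_real])
    show "((\<lambda>h. (cmod (\<phi> (z + h *\<^sub>R v) / of_real h))\<^sup>2) \<longlongrightarrow> (cmod (dird v \<phi> z))\<^sup>2) (at_right 0)"
      by (intro tendsto_intros dlim)
    have "((\<lambda>h. nrm \<phi> * ((p h)\<^sup>2 * (\<Delta> h / h\<^sup>2 + \<Delta> h * (\<Delta> h / h\<^sup>2)) / \<kappa> z)) \<longlongrightarrow>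
        nrm \<phi> * ((\<kappa> z)\<^sup>2 * (q + 0 * q) / \<kappa> z)) (at_right 0)"
      by (intro tendsto_intros plim \<Delta>0 lim\<Delta>) (use \<kappa>0 in simp)
    also have "nrm \<phi> * ((\<kappa> z)\<^sup>2 * (q + 0 * q) / \<kappa> z) = nrm \<phi> * nrm (\<lambda>x. K x z) * q"
      using \<kappa>0 by (simp add: power2_eq_square \<kappa>_def)
    finally show "((\<lambda>h. nrm \<phi> * ((p h)\<^sup>2 * (\<Delta> h / h\<^sup>2 + \<Delta> h * (\<Delta> h / h\<^sup>2)) / \<kappa> z)) \<longlongrightarrow>
        nrm \<phi> * nrm (\<lambda>x. K x z) * q) (at_right 0)" .
    have "\<forall>\<^sub>F h in at_right 0. \<Delta> h < 1" using order_tendstoD(2)[OF \<Delta>0] by simp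
    moreover have "\<forall>\<^sub>F h in at_right (0::real). h > 0" by (simp add: eventually_at_filter)
    ultimately show "\<forall>\<^sub>F h in at_right 0. (cmod (\<phi> (z + h *\<^sub>R v) / of_real h))\<^sup>2 \<le>
        nrm \<phi> * ((p h)\<^sup>2 * (\<Delta> h / h\<^sup>2 + \<Delta> h * (\<Delta> h / h\<^sup>2)) / \<kappa> z)"
      using ev
    proof eventually_elim
      case (elim h)
      \<comment> \<open>Linearizes \<open>exp\<close> for \<open>\<Delta> h\<close> between 0 and 1;
        after division by \<open>h^2\<close> the extra term
        \<open>\<Delta> h * (\<Delta> h / h^2)\<close> tends to 0.\<close>
      have "exp (\<Delta> h) \<le> 1 + \<Delta> h + (\<Delta> h)\<^sup>2" using elim by (intro exp_bound) auto
      then have "nrm \<phi> * ((p h)\<^sup>2 * (exp (\<Delta> h) - 1) / \<kappa> z) \<le> nrm \<phi> * ((p h)\<^sup>2 * (\<Delta> h + (\<Delta> h)\<^sup>2) / \<kappa> z)"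
        using \<kappa>0 by (intro mult_left_mono divide_right_mono nrm_nonneg) auto
      with elim have "(cmod (\<phi> (z + h *\<^sub>R v)))\<^sup>2 / h\<^sup>2 \<le> nrm \<phi> * ((p h)\<^sup>2 * (\<Delta> h + (\<Delta> h)\<^sup>2) / \<kappa> z) / h\<^sup>2"
        by (intro divide_right_mono) auto
      then show ?case
        using elim by (simp add: norm_divide power_divide add_divide_distrib distrib_left power2_eq_square mult_ac)
    qed
  qed
qed

end

context bounded_domain
begin

text \<open>Not automatic, since \<open>sqrt\<close> is odd on the reals. The zero function is
  admissible in \<open>bergman_norm_derivative_bound\<close> and yields the sign of the
  form.\<close>

lemma bergman_norm_nonneg: "z \<in> D \<Longrightarrow> 0 \<le> bergman_norm D z v"
  using bergman_norm_derivative_bound(1)[OF bergman_space_const[of 0] refl] by (simp add: bergman_norm_eq)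

text \<open>For \<open>\<phi>\<close> the product of \<open>f - f z\<close> and the kernel function
  \<open>k\<close>, the derivative at \<open>z\<close> is that of \<open>f\<close> times
  \<open>nrm k\<close>, while \<open>nrm \<phi> \<le> 4 * nrm k\<close> because
  \<open>f - f z\<close> is bounded by 2. The powers of \<open>nrm k\<close> cancel.\<close>

lemma bergman_norm_lower:
  assumes f: "holomorphic_fun_on f D" "f ` D \<subseteq> ball 0 1" and z: "z \<in> D"
  shows "cmod (dird v f z) \<le> 2 * bergman_norm D z v"
proof -
  define k where "k = (\<lambda>x. K x z)"
  define \<phi> where "\<phi> = (\<lambda>x. (f x - f z) * k x)"
  define q where "q = Re (dird (pair v 0) (dird (pair 0 (cnjv v)) G) (pair z (cnjv z)))"
  have kA: "k \<in> bergman_space D" unfolding k_def by (rule K_bergman_space[OF z])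
  have k0: "nrm k > 0" unfolding k_def by (rule K_diag_pos[OF z])
  have kz: "k z = of_real (nrm k)" unfolding k_def by (rule K_diag[OF z])
  have f1: "cmod (f x) < 1" if "x \<in> D" for x using f(2) that by auto
  have hf: "holomorphic_fun_on (\<lambda>x. f x - f z) D"
    by (intro holomorphic_fun_on_diff f holomorphic_fun_on_const)
  have f2: "cmod (f x - f z) \<le> 2" if "x \<in> D" for x
    using norm_triangle_ineq4[of "f x" "f z"] f1[OF that] f1[OF z] by simp
  have \<phi>A: "\<phi> \<in> bergman_space D" and n\<phi>: "nrm \<phi> \<le> 2\<^sup>2 * nrm k"
    unfolding \<phi>_def by (rule bergman_space_mult_bounded[OF kA hf f2], assumption)+
  have "\<phi> z = 0" by (simp add: \<phi>_def)
  note bd = bergman_norm_derivative_bound[OF \<phi>A this z, of v, folded q_def k_def]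
  have "(\<phi> has_derivative (\<lambda>v. (f z - f z) * dird v k z + (dird v f z - 0) * k z)) (at z)"
    unfolding \<phi>_def
    by (intro has_derivative_mult has_derivative_diff has_derivative_const
        holomorphic_fun_on_dird(1)[OF f(1) open_D z]
        holomorphic_fun_on_dird(1)[OF bergman_spaceD(1)[OF kA] open_D z])
  then have "dird v \<phi> z = dird v f z * k z"
    using dird_eqI[of \<phi> "\<lambda>v. dird v f z * k z" z v]
    by (simp add: holomorphic_fun_on_dird(2)[OF f(1) open_D z])
  then have "(cmod (dird v f z))\<^sup>2 * (nrm k)\<^sup>2 \<le> nrm \<phi> * nrm k * q"
    using bd(2) by (simp add: norm_mult power_mult_distrib kz nrm_nonneg)
  also have "\<dots> \<le> (2\<^sup>2 * nrm k) * nrm k * q"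
    using n\<phi> k0 bd(1) by (intro mult_right_mono) auto
  finally have "(cmod (dird v f z))\<^sup>2 * (nrm k)\<^sup>2 \<le> (2\<^sup>2 * q) * (nrm k)\<^sup>2"
    by (simp add: power2_eq_square mult_ac)
  then have "(cmod (dird v f z))\<^sup>2 \<le> 2\<^sup>2 * q"
    using k0 by (subst (asm) mult_le_cancel_right) auto
  also have "\<dots> = (2 * bergman_norm D z v)\<^sup>2"
    using bd(1) by (simp add: bergman_norm_eq[OF z] q_def[symmetric] power_mult_distrib)
  finally show ?thesis
    by (rule power2_le_imp_le) (simp add: bergman_norm_nonneg[OF z])
qed

lemma bergman_norm_scaleR: "bergman_norm D z (c *\<^sub>R v) = \<bar>c\<bar> * bergman_norm D z v"
proof -
  have "(\<Sum>j\<in>UNIV. \<Sum>k\<in>UNIV. bergman_metric_coeff D j k z * ((c *\<^sub>R v) $ j) * cnj ((c *\<^sub>R v) $ k)) =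
      c\<^sup>2 *\<^sub>R (\<Sum>j\<in>UNIV. \<Sum>k\<in>UNIV. bergman_metric_coeff D j k z * (v $ j) * cnj (v $ k))"
    unfolding scaleR_sum_right by (intro sum.cong refl) (simp add: power2_eq_square)
  then show ?thesis by (simp add: bergman_norm_def real_sqrt_mult)
qed

section \<open>Lengths of paths in the Bergman metric\<close>

definition path_len :: "complex ^ 'n \<Rightarrow> complex ^ 'n \<Rightarrow> real \<Rightarrow> bool" where
  "path_len z w L \<longleftrightarrow> (\<exists>\<gamma>. valid_path \<gamma> \<and> path_image \<gamma> \<subseteq> D \<and> pathstart \<gamma> = z \<and> pathfinish \<gamma> = w \<and>
     ((\<lambda>t. bergman_norm D (\<gamma> t) (vector_derivative \<gamma> (at t))) has_integral L) {0..1})"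

lemma path_len_nonneg: "path_len z w L \<Longrightarrow> 0 \<le> L"
  unfolding path_len_def path_image_def
  by (auto intro!: bergman_norm_nonneg elim!: has_integral_nonneg)

lemma valid_path_diff:
  assumes "valid_path \<gamma>"
  obtains T where "finite T" "\<And>t. t \<in> {0..1} - T \<Longrightarrow> (\<gamma> has_vector_derivative vector_derivative \<gamma> (at t)) (at t)"
  using assms unfolding valid_path_def piecewise_C1_differentiable_on_def C1_differentiable_on_eq
  by (metis vector_derivative_works)

text \<open>Integrates \<open>bergman_norm_lower\<close> along the path. The pointwise bound holds
  for every vector, hence also at break points, where \<open>vector_derivative\<close> may be an
  arbitrary value; the fundamental theorem tolerates these finitely many points.\<close>

lemma path_len_lower:
  assumes f: "holomorphic_fun_on f D" "f ` D \<subseteq> ball 0 1" and P: "path_len z w L"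
  shows "cmod (f z - f w) \<le> 2 * L"
proof -
  obtain \<gamma> where \<gamma>: "valid_path \<gamma>" "path_image \<gamma> \<subseteq> D" "pathstart \<gamma> = z" "pathfinish \<gamma> = w"
    and L: "((\<lambda>t. bergman_norm D (\<gamma> t) (vector_derivative \<gamma> (at t))) has_integral L) {0..1}"
    using P unfolding path_len_def by blast
  have \<gamma>D: "\<gamma> t \<in> D" if "t \<in> {0..1}" for t using \<gamma>(2) that by (auto simp: path_image_def)
  obtain T where T: "finite T" "\<And>t. t \<in> {0..1} - T \<Longrightarrow> (\<gamma> has_vector_derivative vector_derivative \<gamma> (at t)) (at t)"
    using valid_path_diff[OF \<gamma>(1)] by blast
  let ?f' = "\<lambda>t. dird (vector_derivative \<gamma> (at t)) f (\<gamma> t)"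
  have I: "(?f' has_integral f (\<gamma> 1) - f (\<gamma> 0)) {0..1}"
  proof (rule fundamental_theorem_of_calculus_strong[OF T(1), of 0 1 "\<lambda>t. f (\<gamma> t)"])
    fix t :: real assume t: "t \<in> {0..1} - T"
    show "((\<lambda>t. f (\<gamma> t)) has_vector_derivative ?f' t) (at t)"
      using vector_derivative_diff_chain_within[OF T(2)[OF t], of f "\<lambda>v. dird v f (\<gamma> t)"]
        holomorphic_fun_on_dird(1)[OF f(1) open_D \<gamma>D] t
      by (simp add: o_def has_derivative_at_withinI)
  next
    show "continuous_on {0..1} (\<lambda>t. f (\<gamma> t))"
      by (rule continuous_on_compose2[OF holomorphic_fun_on_imp_continuous_on[OF f(1)]])
        (use \<gamma> valid_path_imp_path in \<open>auto simp: path_def path_image_def\<close>)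
  qed simp
  have "norm (integral {0..1} ?f') \<le> integral {0..1} (\<lambda>t. 2 * bergman_norm D (\<gamma> t) (vector_derivative \<gamma> (at t)))"
    by (rule Henstock_Kurzweil_Integration.integral_norm_bound_integral)
      (use I L has_integral_mult_right[OF L, of 2] bergman_norm_lower[OF f \<gamma>D] in \<open>auto simp: integrable_on_def\<close>)
  also have "\<dots> = 2 * L" using has_integral_mult_right[OF L, of 2] by (rule integral_unique)
  finally show ?thesis
    using \<gamma>(3,4) integral_unique[OF I] by (simp add: pathstart_def pathfinish_def norm_minus_commute)
qed

lemma path_len_commute:
  assumes "path_len z w L"
  shows "path_len w z L"
proof -
  obtain \<gamma> where \<gamma>: "valid_path \<gamma>" "path_image \<gamma> \<subseteq> D" "pathstart \<gamma> = z" "pathfinish \<gamma> = w"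
    and L: "((\<lambda>t. bergman_norm D (\<gamma> t) (vector_derivative \<gamma> (at t))) has_integral L) {0..1}"
    using assms unfolding path_len_def by blast
  obtain T where T: "finite T" "\<And>t. t \<in> {0..1} - T \<Longrightarrow> (\<gamma> has_vector_derivative vector_derivative \<gamma> (at t)) (at t)"
    using valid_path_diff[OF \<gamma>(1)] by blast
  let ?F = "\<lambda>t. bergman_norm D (\<gamma> t) (vector_derivative \<gamma> (at t))"
  have "((\<lambda>t. ?F (1 - t)) has_integral L) {0..1}"
    using has_integral_affinity01[OF L, of "-1" 1] by simp
  then have "((\<lambda>t. bergman_norm D (reversepath \<gamma> t) (vector_derivative (reversepath \<gamma>) (at t))) has_integral L) {0..1}"
  proof (rule has_integral_spike_finite[rotated 2])
    show "finite ((\<lambda>t. 1 - t) ` T)" using T by simp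
    fix t assume t: "t \<in> {0..1} - (\<lambda>t. 1 - t) ` T"
    have "1 - t \<notin> T" using t by (metis DiffD2 diff_diff_eq2 add_diff_cancel_left' image_eqI)
    then have "(\<gamma> has_vector_derivative vector_derivative \<gamma> (at (1 - t))) (at (1 - t))"
      using T t by auto
    moreover have "((\<lambda>t. 1 - t) has_vector_derivative -1) (at t)"
      by (auto intro!: derivative_eq_intros)
    ultimately have "(\<gamma> \<circ> (\<lambda>t. 1 - t) has_vector_derivative -1 *\<^sub>R vector_derivative \<gamma> (at (1 - t))) (at t)"
      by (intro vector_diff_chain_at)
    then have "vector_derivative (reversepath \<gamma>) (at t) = -1 *\<^sub>R vector_derivative \<gamma> (at (1 - t))"
      unfolding reversepath_def o_def by (rule vector_derivative_at)
    then show "bergman_norm D (reversepath \<gamma> t) (vector_derivative (reversepath \<gamma>) (at t)) = ?F (1 - t)"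
      by (simp add: bergman_norm_scaleR[of _ "-1", simplified] reversepath_def)
  qed
  then show ?thesis unfolding path_len_def
    using \<gamma> by (intro exI[of _ "reversepath \<gamma>"]) auto
qed

text \<open>Each half runs at double speed, and homogeneity of the norm turns this into the factor 2
  of the substitution. The break points and the joint are finitely many and do not affect the
  integrals.\<close>

lemma path_len_trans:
  assumes "path_len x y L" "path_len y z M"
  shows "path_len x z (L + M)"
proof -
  obtain g where g: "valid_path g" "path_image g \<subseteq> D" "pathstart g = x" "pathfinish g = y"
    and L: "((\<lambda>t. bergman_norm D (g t) (vector_derivative g (at t))) has_integral L) {0..1}"
    using assms(1) unfolding path_len_def by blast
  obtain h where h: "valid_path h" "path_image h \<subseteq> D" "pathstart h = y" "pathfinish h = z"
    and M: "((\<lambda>t. bergman_norm D (h t) (vector_derivative h (at t))) has_integral M) {0..1}"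
    using assms(2) unfolding path_len_def by blast
  obtain T where T: "finite T" "\<And>t. t \<in> {0..1} - T \<Longrightarrow> (g has_vector_derivative vector_derivative g (at t)) (at t)"
    using valid_path_diff[OF g(1)] by blast
  obtain U where U: "finite U" "\<And>t. t \<in> {0..1} - U \<Longrightarrow> (h has_vector_derivative vector_derivative h (at t)) (at t)"
    using valid_path_diff[OF h(1)] by blast
  let ?B = "\<lambda>\<gamma> t. bergman_norm D (\<gamma> t) (vector_derivative \<gamma> (at t))"
  have i1: "((\<lambda>t. 2 * ?B g (2 * t)) has_integral L) {0..1/2}"
   and i2: "((\<lambda>t. 2 * ?B h (2 * t - 1)) has_integral M) {1/2..1}"
    using has_integral_affinity01 [OF L, where m= 2 and c=0, THEN has_integral_cmul [where c=2]]
          has_integral_affinity01 [OF M, where m= 2 and c="-1", THEN has_integral_cmul [where c=2]]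
    by (simp_all only: image_affinity_atLeastAtMost_div_diff, simp_all add: scaleR_conv_of_real mult_ac)
  have "(?B (g +++ h) has_integral L) {0..1/2}"
  proof (rule has_integral_spike_finite[OF _ _ i1])
    show "finite (insert (1/2) ((*) 2 -` T))"
      using T by (force intro: finite_vimageI inj_onI)
    fix t assume t: "t \<in> {0..1/2} - insert (1/2) ((*) 2 -` T)"
    then have lt: "t < 1/2" by auto
    have "((g \<circ> (*) 2) has_vector_derivative 2 *\<^sub>R vector_derivative g (at (2 * t))) (at t)"
    proof (rule vector_diff_chain_at)
      show "((*) 2 has_vector_derivative 2) (at t)" by (auto intro!: derivative_eq_intros)
      show "(g has_vector_derivative vector_derivative g (at (2 * t))) (at (2 * t))" using t by (intro T(2)) auto
    qed
    then have "((g +++ h) has_vector_derivative 2 *\<^sub>R vector_derivative g (at (2 * t))) (at t)"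
      by (rule has_vector_derivative_transform_within_open[where S = "{..<1/2}"]) (use lt in \<open>auto simp: joinpaths_def\<close>)
    then have "vector_derivative (g +++ h) (at t) = 2 *\<^sub>R vector_derivative g (at (2 * t))"
      by (rule vector_derivative_at)
    then show "?B (g +++ h) t = 2 * ?B g (2 * t)"
      using lt by (simp add: bergman_norm_scaleR joinpaths_def)
  qed
  moreover have "(?B (g +++ h) has_integral M) {1/2..1}"
  proof (rule has_integral_spike_finite[OF _ _ i2])
    show "finite (insert (1/2) ((\<lambda>t. 2 * t - 1) -` U))"
      using U by (force intro: finite_vimageI inj_onI)
    fix t assume t: "t \<in> {1/2..1} - insert (1/2) ((\<lambda>t. 2 * t - 1) -` U)"
    then have gt: "t > 1/2" by auto
    have "((h \<circ> (\<lambda>t. 2 * t - 1)) has_vector_derivative 2 *\<^sub>R vector_derivative h (at (2 * t - 1))) (at t)"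
    proof (rule vector_diff_chain_at)
      show "((\<lambda>t. 2 * t - 1) has_vector_derivative 2) (at t)" by (auto intro!: derivative_eq_intros)
      show "(h has_vector_derivative vector_derivative h (at (2 * t - 1))) (at (2 * t - 1))" using t by (intro U(2)) auto
    qed
    then have "((g +++ h) has_vector_derivative 2 *\<^sub>R vector_derivative h (at (2 * t - 1))) (at t)"
      by (rule has_vector_derivative_transform_within_open[where S = "{1/2<..}"]) (use gt in \<open>auto simp: joinpaths_def\<close>)
    then have "vector_derivative (g +++ h) (at t) = 2 *\<^sub>R vector_derivative h (at (2 * t - 1))"
      by (rule vector_derivative_at)
    then show "?B (g +++ h) t = 2 * ?B h (2 * t - 1)"
      using gt by (simp add: bergman_norm_scaleR joinpaths_def)
  qed
  ultimately have "(?B (g +++ h) has_integral (L + M)) {0..1}"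
    by (rule has_integral_combine[where c = "1/2", rotated 2]) auto
  then show ?thesis unfolding path_len_def
    using g h by (intro exI[of _ "g +++ h"]) (auto simp: path_image_join intro!: valid_path_join)
qed

text \<open>A polynomial path has continuous velocity, so its length integrand is continuous and the
  length is finite.\<close>

lemma path_len_exists:
  assumes D: "connected D" and zw: "z \<in> D" "w \<in> D"
  shows "\<exists>L. path_len z w L"
proof -
  obtain g where g: "polynomial_function g" "path_image g \<subseteq> D" "pathstart g = z" "pathfinish g = w"
    using connected_open_polynomial_connected[OF open_D D zw] by blast
  obtain g' where g': "polynomial_function g'" "\<And>t. (g has_vector_derivative g' t) (at t)"
    using has_vector_derivative_polynomial_function[OF g(1)] by metis
  have "continuous_on {0..1} (\<lambda>t. bergman_norm D (g t) (g' t))"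
    using g(2) by (intro continuous_on_bergman_norm continuous_on_polymonial_function g g')
      (auto simp: path_image_def)
  then obtain L where "((\<lambda>t. bergman_norm D (g t) (g' t)) has_integral L) {0..1}"
    using integrable_continuous_interval unfolding integrable_on_def by blast
  then show ?thesis unfolding path_len_def
    using g valid_path_polynomial_function[OF g(1)] vector_derivative_at[OF g'(2)]
    by (intro exI[of _ L] exI[of _ g]) simp
qed

text \<open>The norm is jointly continuous in point and vector and vanishes at
  \<open>(q, 0)\<close>, so on a short segment ending at \<open>q\<close> the integrand is small
  uniformly.\<close>

lemma path_len_local:
  assumes q: "q \<in> D" and e: "e > 0"
  shows "\<exists>\<delta>>0. \<forall>z. dist z q < \<delta> \<longrightarrow> z \<in> D \<and> (\<exists>L<e. path_len z q L)"
proof -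
  have c: "continuous_on (D \<times> UNIV) (\<lambda>x. bergman_norm D (fst x) (snd x))"
    by (rule continuous_on_bergman_norm) (auto intro!: continuous_intros)
  have cq: "isCont (\<lambda>x. bergman_norm D (fst x) (snd x)) (q, 0)"
    using c by (rule continuous_on_eq_continuous_at[THEN iffD1, rule_format, rotated])
      (use q open_D in \<open>auto intro: open_Times\<close>)
  obtain d where d: "d > 0" and d': "\<And>x. dist x (q, 0) < d \<Longrightarrow>
      dist (bergman_norm D (fst x) (snd x)) (bergman_norm D (fst (q, 0)) (snd (q, 0))) < e / 2"
    using cq[unfolded continuous_at_eps_delta, rule_format, of "e / 2"] e by auto
  have d2: "bergman_norm D (fst x) (snd x) < e / 2" if "dist x (q, 0) < d" for x
    using d'[OF that] by (simp add: bergman_norm_def dist_real_def)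
  obtain r where r: "r > 0" "ball q r \<subseteq> D" using q open_D openE by blast
  \<comment> \<open>\<open>d / 2\<close> is spent once on the base point and once on the velocity;
    \<open>r\<close> keeps the segment in \<open>D\<close>.\<close>
  define \<delta> where "\<delta> = min (d / 2) r"
  have \<delta>: "\<delta> > 0" using d r by (simp add: \<delta>_def)
  have "z \<in> D \<and> (\<exists>L<e. path_len z q L)" if z: "dist z q < \<delta>" for z
  proof
    have zr: "z \<in> ball q r" using z by (simp add: \<delta>_def dist_commute)
    then show "z \<in> D" using r by blast
    let ?g = "linepath z q"
    have gq: "dist (?g t) q \<le> dist z q" "?g t \<in> D" if t: "t \<in> {0..1}" for t
    proof -
      have "?g t - q = (1 - t) *\<^sub>R (z - q)" by (simp add: linepath_def algebra_simps)
      then show le: "dist (?g t) q \<le> dist z q"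
        using t by (simp add: dist_norm mult_left_le_one_le)
      show "?g t \<in> D" using le z r(2) by (auto simp: \<delta>_def dist_commute)
    qed
    have vd: "vector_derivative ?g (at t) = q - z" for t
      by (rule vector_derivative_at) (rule has_vector_derivative_linepath_within)
    have "continuous_on {0..1} (\<lambda>t. bergman_norm D (?g t) (q - z))"
      by (intro continuous_on_bergman_norm continuous_intros) (use gq in auto)
    then obtain L where L: "((\<lambda>t. bergman_norm D (?g t) (q - z)) has_integral L) {0..1}"
      using integrable_continuous_interval unfolding integrable_on_def by blast
    have "bergman_norm D (?g t) (q - z) \<le> e / 2" if t: "t \<in> {0..1}" for t
    proof -
      have "dist (?g t, q - z) (q, 0) \<le> dist (?g t) q + dist (q - z) 0"
        unfolding dist_prod_def by (simp add: sqrt_sum_squares_le_sum)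
      also have "\<dots> < d" using gq(1)[OF t] z by (simp add: \<delta>_def dist_norm norm_minus_commute)
      finally show ?thesis using d2[of "(?g t, q - z)"] by simp
    qed
    then have "L \<le> e / 2"
      using has_integral_le[OF L, of "\<lambda>_. e / 2" "e / 2"] has_integral_const_real[of "e / 2" 0 1] by simp
    moreover have "path_len z q L" unfolding path_len_def
      using L gq by (intro exI[of _ ?g]) (auto simp: vd path_image_def simp del: path_image_linepath)
    ultimately show "\<exists>L<e. path_len z q L" using e by (intro exI[of _ L]) auto
  qed
  then show ?thesis using \<delta> by blast
qed

end

lemma bergman_complete:
  fixes D :: "(complex ^ 'n) set"
  assumes hhr: "holomorphic_homogeneous_regular D"
  shows "Metric_space D (bergman_dist D) \<and> Metric_space.mcomplete D (bergman_dist D)"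
proof -
  have D: "open D" "connected D" "bounded D"
    using hhr by (auto simp: holomorphic_homogeneous_regular_def Cn_domain_def)
  interpret bounded_domain D using D by unfold_locales
  show ?thesis
  proof (rule hhr_metric_completeI[OF hhr, where P = path_len])
    show "bergman_dist D z w = (if z \<in> D \<and> w \<in> D then Inf {L. path_len z w L} else 0)" for z w
      unfolding bergman_dist_def path_len_def ..
    show "\<exists>L. path_len z w L" if "z \<in> D" "w \<in> D" for z w
      by (rule path_len_exists[OF D(2) that])
  qed (rule path_len_nonneg path_len_commute path_len_trans path_len_lower path_len_local; assumption)+
qed

theorem theorem4p6:
  fixes D :: "(complex ^ 'n) set"
  assumes "holomorphic_homogeneous_regular D"
  shows "Metric_space D (kobayashi_dist D) \<and> Metric_space.mcomplete D (kobayashi_dist D) \<and>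
         Metric_space D (bergman_dist D) \<and> Metric_space.mcomplete D (bergman_dist D)"
  using kobayashi_complete[OF assms] bergman_complete[OF assms] by blast

end
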